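(* Assume that $\sup_{N\ge1,\sigma\in\Sigma_N}\frac1N\mathbb E[H_N(\sigma)^2]<\infty$ and that for every $\epsilon>0$, $$\limsup_{N\to\infty}\frac1N\log\mu_N\Big(\sigma\in\Sigma_N:\ \Big|\frac1N\mathbb E[H_N(\sigma)^2]-1\Big|>\epsilon\Big)=-\infty .$$ Let $0\le\beta\le\beta_c$. Let $f_N:\Sigma_N\to\mathbb R$ be random fields ($\mathbb P$-a.s. $\mathcal F_N$-measurable, defined on the same probability space as $H_N$ and possibly depending on $H_N$) and let $A\subset\mathbb R$ be a Borel set such that the conditional probability $p_N(\sigma,E)=\mathbb P\big(f_N(\sigma)\in A\,\big|\,\frac1NH_N(\sigma)=E\big)$ is measurable on $\Sigma_N\times\mathbb R$. If $$\lim_{\epsilon\to0}\ \limsup_{N\to\infty}\ \frac1N\log\int_{\Sigma_N}\int_{\beta-\epsilon}^{\beta+\epsilon}\mathbb P\Big(f_N(\sigma)\in A\,\Big|\,\frac1NH_N(\sigma)=E\Big)\,dE\,d\mu_N(\sigma)<0,$$ then $$\limsup_{N\to\infty}\frac1N\log\mathbb E\big[G_{N,\beta}(f_N(\sigma)\in A)\big]<0 .$$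
   Context: For each $N\ge1$, $(\Sigma_N,\mathcal F_N,\mu_N)$ is a probability space and $H_N:\Sigma_N\to\mathbb R$ is a centered Gaussian field defined on an auxiliary probability space with probability $\mathbb P$ and expectation $\mathbb E$. Standing assumption: $\mathbb P$-a.s., every function on $\Sigma_N$ that is encountered is $\mathcal F_N$-measurable. For $\beta\ge0$: $Z_{N,\beta}=\int_{\Sigma_N}e^{\beta H_N(\sigma)}d\mu_N(\sigma)$, $F_{N,\beta}=\frac1N\log Z_{N,\beta}$, and $G_{N,\beta}$ is the random Gibbs probability measure on $\Sigma_N$ with $\frac{dG_{N,\beta}}{d\mu_N}(\sigma)=e^{\beta H_N(\sigma)}/Z_{N,\beta}$. Thus $G_{N,\beta}(f_N(\sigma)\in A)=\int_{\{\sigma: f_N(\sigma)\in A\}}e^{\beta H_N}d\mu_N/Z_{N,\beta}$. The critical inverse-temperature $\beta_c$ is the unique value such that $\lim_{N\to\infty}\mathbb E F_{N,\beta}=\frac12\beta^2$ if and only if $\beta\le\beta_c$. Conditional probability: for fixed $\sigma$ and Borel $A$ the sub-probability measure $\mathbb P(f_N(\sigma)\in A,\ \frac1NH_N(\sigma)\in\cdot)$ on $\mathbb R$ is absolutely continuous with respect to Lebesgue measure, and $p_N(\sigma,E)=\mathbb P(f_N(\sigma)\in A\mid\frac1NH_N(\sigma)=E)$ is defined as its Radon–Nikodym derivative at $E$ divided by the (positive) Gaussian density of $\frac1NH_N(\sigma)$ at $E$ (the variances of $H_N(\sigma)$ being taken positive for this purpose). Measurability on $\Sigma_N\times\mathbb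 R$ is with respect to the product of $\mu_N$ and Lebesgue measure.
   Formalization: The random fields H_N and f_N are also assumed jointly measurable on the product of Σ_N and the auxiliary probability space, up to null sets; with only P-a.s. measurable paths the claim can fail (e.g. β=0, f_N(σ)=0 a.s. for each σ but every path equal to 1 μ_N-a.e.). *)

theory Defs
  imports "HOL-Probability.Probability"
begin

text \<open>
  Throughout, \<open>M N\<close> is the probability space \<open>(\<Sigma>\<^sub>N, F\<^sub>N, \<mu>\<^sub>N)\<close>, \<open>P\<close> is the auxiliary probability
  space, and a random field \<open>X\<close> on \<open>\<Sigma>\<close> is curried as \<open>X \<sigma> \<omega>\<close>.
\<close>

text \<open>
  Almost every path is measurable on \<open>\<Sigma>\<close>.  Measurability of all the sections \<open>X \<sigma>\<close> and \<open>X \<cdot> \<omega>\<close> does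
  not give joint measurability, without which expectations over \<open>P\<close> and integrals over \<open>\<Sigma>\<close> need
  not commute.  For instance \<open>X\<close> can vanish almost surely at each fixed \<open>\<sigma>\<close> while every path of \<open>X\<close>
  is \<open>1\<close> off a countable set.  Joint measurability is therefore required, but only up to null sets.
\<close>
definition random_field :: "'b measure \<Rightarrow> 'a measure \<Rightarrow> ('a \<Rightarrow> 'b \<Rightarrow> real) \<Rightarrow> bool" where
  "random_field P S X \<longleftrightarrow>
     (\<forall>\<sigma>\<in>space S. X \<sigma> \<in> borel_measurable P) \<and>
     (AE \<omega> in P. (\<lambda>\<sigma>. X \<sigma> \<omega>) \<in> borel_measurable S) \<and>
     (\<lambda>(\<sigma>, \<omega>). X \<sigma> \<omega>) \<in> borel_measurable (completion (S \<Otimes>\<^sub>M P))"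

text \<open>The degenerate law, a point mass at \<open>0\<close>, counts as Gaussian.\<close>
definition centered_gaussian :: "'b measure \<Rightarrow> ('b \<Rightarrow> real) \<Rightarrow> bool" where
  "centered_gaussian P X \<longleftrightarrow>
     X \<in> borel_measurable P \<and>
     ((AE \<omega> in P. X \<omega> = 0) \<or> (\<exists>s>0. distributed P lborel X (normal_density 0 s)))"

definition centered_gaussian_field :: "'b measure \<Rightarrow> 'a set \<Rightarrow> ('a \<Rightarrow> 'b \<Rightarrow> real) \<Rightarrow> bool" where
  "centered_gaussian_field P T X \<longleftrightarrow>
     (\<forall>F c. finite F \<longrightarrow> F \<subseteq> T \<longrightarrow> centered_gaussian P (\<lambda>\<omega>. \<Sum>\<sigma>\<in>F. c \<sigma> * X \<sigma> \<omega>))"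

definition field_variance :: "'b measure \<Rightarrow> ('a \<Rightarrow> 'b \<Rightarrow> real) \<Rightarrow> 'a \<Rightarrow> real" where
  "field_variance P X \<sigma> = (\<integral>\<omega>. (X \<sigma> \<omega>)\<^sup>2 \<partial>P)"

definition partition_function ::
  "(nat \<Rightarrow> 'a measure) \<Rightarrow> (nat \<Rightarrow> 'a \<Rightarrow> 'b \<Rightarrow> real) \<Rightarrow> nat \<Rightarrow> real \<Rightarrow> 'b \<Rightarrow> real" where
  "partition_function M H N \<beta> \<omega> = (\<integral>\<sigma>. exp (\<beta> * H N \<sigma> \<omega>) \<partial>M N)"

definition free_energy ::
  "(nat \<Rightarrow> 'a measure) \<Rightarrow> (nat \<Rightarrow> 'a \<Rightarrow> 'b \<Rightarrow> real) \<Rightarrow> nat \<Rightarrow> real \<Rightarrow> 'b \<Rightarrow> real" where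
  "free_energy M H N \<beta> \<omega> = ln (partition_function M H N \<beta> \<omega>) / real N"

definition gibbs_measure ::
  "(nat \<Rightarrow> 'a measure) \<Rightarrow> (nat \<Rightarrow> 'a \<Rightarrow> 'b \<Rightarrow> real) \<Rightarrow> nat \<Rightarrow> real \<Rightarrow> 'b \<Rightarrow> 'a measure" where
  "gibbs_measure M H N \<beta> \<omega> =
     density (M N) (\<lambda>\<sigma>. ennreal (exp (\<beta> * H N \<sigma> \<omega>) / partition_function M H N \<beta> \<omega>))"

text \<open>
  The free energy is only almost surely given by a proper integral, so its expectation is taken over
  the completion of \<open>P\<close>; it would otherwise be \<open>0\<close> if it failed to be measurable on a null set.
  The critical value may be infinite.  It is never negative, as the limit is \<open>\<beta>\<^sup>2 / 2\<close> for \<open>\<beta> = 0\<close>, hence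
  it is unique.
\<close>
definition is_critical_inverse_temperature ::
  "'b measure \<Rightarrow> (nat \<Rightarrow> 'a measure) \<Rightarrow> (nat \<Rightarrow> 'a \<Rightarrow> 'b \<Rightarrow> real) \<Rightarrow> ereal \<Rightarrow> bool" where
  "is_critical_inverse_temperature P M H \<beta>\<^sub>c \<longleftrightarrow>
     (\<forall>\<beta>\<ge>0. (\<lambda>N. \<integral>\<omega>. free_energy M H N \<beta> \<omega> \<partial>completion P) \<longlonglongrightarrow> \<beta>\<^sup>2 / 2 \<longleftrightarrow> ereal \<beta> \<le> \<beta>\<^sub>c)"

text \<open>
  \<open>p\<close> is a version of \<open>E \<mapsto> P (Y \<in> A | X = E)\<close>, where \<open>X\<close> has density \<open>\<phi>\<close>: a Radon-Nikodym derivative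
  \<open>D\<close> of the sub-probability \<open>P (Y \<in> A, X \<in> \<cdot>)\<close> with respect to Lebesgue measure, divided by \<open>\<phi>\<close>.
\<close>
definition is_conditional_probability ::
  "'b measure \<Rightarrow> ('b \<Rightarrow> real) \<Rightarrow> real set \<Rightarrow> ('b \<Rightarrow> real) \<Rightarrow> (real \<Rightarrow> real) \<Rightarrow> (real \<Rightarrow> ennreal) \<Rightarrow> bool"
where
  "is_conditional_probability P Y A X \<phi> p \<longleftrightarrow>
     (\<exists>D\<in>borel_measurable lborel.
        density lborel D = distr (restrict_space P {\<omega>\<in>space P. Y \<omega> \<in> A}) borel X \<and>
        (\<forall>E. p E = D E / ennreal (\<phi> E)))"

text \<open>Natural logarithm on \<open>[0, \<infinity>]\<close> with \<open>log 0 = -\<infinity>\<close> and \<open>log \<infinity> = \<infinity>\<close>.\<close>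
definition elog :: "ennreal \<Rightarrow> ereal" where
  "elog x = (if x = 0 then -\<infinity> else if x = \<infinity> then \<infinity> else ereal (ln (enn2real x)))"

end

theory Submission
  imports Defs
begin

text \<open>
  The averaged Gibbs weight of the event \<open>f \<in> A\<close> is the expectation of \<open>Y / Z\<close>, where \<open>Z\<close> is the partition
  function and \<open>Y\<close> is the integral of \<open>exp (\<beta> * H)\<close> over the event.  Two facts make it exponentially small.

  The first is that \<open>E Y\<close> is exponentially smaller than \<open>exp (N * \<beta>\<^sup>2 / 2)\<close>.  For a single \<open>\<sigma>\<close> of variance about
  \<open>N\<close>, the weight \<open>exp (\<beta> * H)\<close> concentrates on energies \<open>H / N\<close> near \<open>\<beta>\<close>; there the conditional
  probability of the event enters, and its integral over the window decays by hypothesis, while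
  energies outside the window contribute an exponentially smaller amount than the total weight
  (\<open>gaussian_window_bound\<close>).  The set of \<open>\<sigma>\<close> with an atypical variance is superexponentially
  small, and its contribution is negligible (\<open>first_moment_le\<close>).

  The second fact is that \<open>Z\<close> is at least \<open>exp (N * (\<beta>\<^sup>2 / 2 - \<delta>))\<close> outside an event of exponentially small
  probability.  Up to the critical value the expectation of \<open>ln Z / N\<close> tends to \<open>\<beta>\<^sup>2 / 2\<close>, so that
  it suffices to control the lower tail of \<open>ln Z\<close> around its mean (\<open>ln_Z_lower_tail\<close>).  Then
  \<open>Y / Z\<close>, which never exceeds \<open>1\<close>, is compared with \<open>Y * exp (- N * (\<beta>\<^sup>2 / 2 - \<delta>))\<close> where \<open>Z\<close> is large and
  with \<open>1\<close> elsewhere (\<open>gibbs_average_le\<close>).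

  The lower tail is an instance of Gaussian concentration, proved here in the decoupled form
  \<open>E (Z ^ l) * E (Z ^ -l) \<le> exp (O(l\<^sup>2 * V))\<close> with a variance bound \<open>V\<close>.  For finitely many points of the
  space, two independent copies of the field are joined by a chain of small rotations.  Each rotated
  pair has the same joint law, because the law of a Gaussian vector is determined by
  its linear combinations (\<open>joint_law_eqI\<close>, \<open>rotated_copies_law\<close>), and the increment of the
  log-partition function over one rotation is at most a Gibbs average with weights that are independent of the
  direction of the increment (\<open>log_sum_exp_decoupled_bound\<close>).  The bound does not depend on the number of points.
  It passes to \<open>Z\<close> itself because \<open>Z\<close> is a limit of averages over finitely many well chosen
  points (\<open>ex_empirical_partition_functions\<close>).
\<close>

section \<open>Finite-dimensional laws are determined by linear combinations\<close>

text \<open>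
  A nonnegative integrable weight \<open>w\<close> turns \<open>P\<close> into a finite measure, and the law of \<open>X\<close> under it is
  determined by its characteristic function, whose real and imaginary parts are the phases \<open>a = 0\<close> and
  \<open>a = -\<pi>/2\<close> of the cosine.
\<close>
lemma weighted_laws_eqI:
  fixes X :: "'b \<Rightarrow> real" and Y :: "'c \<Rightarrow> real" and w :: "'b \<Rightarrow> real" and v :: "'c \<Rightarrow> real"
  assumes [measurable]: "X \<in> borel_measurable P" "Y \<in> borel_measurable Q"
    and w: "integrable P w" "\<And>\<omega>. 0 \<le> w \<omega>" and v: "integrable Q v" "\<And>\<omega>. 0 \<le> v \<omega>"
    and eq: "\<And>t a. (\<integral>\<omega>. w \<omega> * cos (t * X \<omega> + a) \<partial>P) = (\<integral>\<omega>. v \<omega> * cos (t * Y \<omega> + a) \<partial>Q)"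
    and [measurable]: "B \<in> sets borel"
  shows "(\<integral>\<omega>. w \<omega> * indicator B (X \<omega>) \<partial>P) = (\<integral>\<omega>. v \<omega> * indicator B (Y \<omega>) \<partial>Q)"
proof -
  define m where "m = (\<integral>\<omega>. w \<omega> \<partial>P)"
  have m': "m = (\<integral>\<omega>. v \<omega> \<partial>Q)" using eq[of 0 0] by (simp add: m_def)
  have [measurable]: "w \<in> borel_measurable P" "v \<in> borel_measurable Q" using w v by auto
  show ?thesis
  proof (cases "m = 0")
    case True
    then have "AE \<omega> in P. w \<omega> = 0" "AE \<omega> in Q. v \<omega> = 0"
      using True m' integral_nonneg_eq_0_iff_AE[OF w(1)] integral_nonneg_eq_0_iff_AE[OF v(1)]
      by (simp_all add: m_def w(2) v(2))
    then have "(\<integral>\<omega>. w \<omega> * indicator B (X \<omega>) \<partial>P) = (\<integral>\<omega>. 0 \<partial>P)"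
       "(\<integral>\<omega>. v \<omega> * indicator B (Y \<omega>) \<partial>Q) = (\<integral>\<omega>. 0 \<partial>Q)"
      by (intro integral_cong_AE; auto)+
    then show ?thesis by simp
  next
    case False
    moreover have "0 \<le> m" using w by (auto simp: m_def)
    ultimately have m: "0 < m" by simp
    have *: "real_distribution (distr (density R (\<lambda>x. ennreal (u x / m))) borel U) \<and>
       char (distr (density R (\<lambda>x. ennreal (u x / m))) borel U) t
         = Complex ((\<integral>\<omega>. u \<omega> * cos (t * U \<omega> + 0) \<partial>R) / m) ((\<integral>\<omega>. u \<omega> * cos (t * U \<omega> + (- (pi/2))) \<partial>R) / m) \<and>
       measure (distr (density R (\<lambda>x. ennreal (u x / m))) borel U) B = (\<integral>\<omega>. u \<omega> * indicator B (U \<omega>) \<partial>R) / m"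
      if [measurable]: "U \<in> borel_measurable R" and u: "integrable R u" "\<And>\<omega>. 0 \<le> u \<omega>"
        and mu: "m = (\<integral>\<omega>. u \<omega> \<partial>R)" for R :: "'d measure" and u U t
    proof -
      have [measurable]: "u \<in> borel_measurable R" using u by auto
      let ?D = "density R (\<lambda>x. ennreal (u x / m))"
      have "emeasure ?D (space ?D) = (\<integral>\<^sup>+\<omega>. ennreal (u \<omega> / m) \<partial>R)"
        by (simp add: emeasure_density cong: nn_integral_cong)
      also have "\<dots> = ennreal (\<integral>\<omega>. u \<omega> / m \<partial>R)"
        using u m by (intro nn_integral_eq_integral) auto
      also have "\<dots> = 1" using m mu by simp
      finally have D: "prob_space ?D" by (rule prob_spaceI)
      then have rd: "real_distribution (distr ?D borel U)"
        by (intro prob_space.real_distribution_distr) auto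
      have "char (distr ?D borel U) t = (CLINT x|?D. iexp (t * U x))"
        by (simp add: char_def integral_distr)
      also have "\<dots> = (CLINT x|R. (u x / m) *\<^sub>R iexp (t * U x))"
        using u m by (intro integral_density) auto
      finally have c: "char (distr ?D borel U) t = (CLINT x|R. (u x / m) *\<^sub>R iexp (t * U x))" .
      have i: "integrable R (\<lambda>x. (u x / m) *\<^sub>R iexp (t * U x))"
        by (rule Bochner_Integration.integrable_bound[of R "\<lambda>x. u x / m"])
          (use u m in \<open>auto intro!: integrable_divide_zero\<close>)
      have "char (distr ?D borel U) t = Complex ((\<integral>\<omega>. u \<omega> * cos (t * U \<omega>) \<partial>R) / m) ((\<integral>\<omega>. u \<omega> * sin (t * U \<omega>) \<partial>R) / m)"
        unfolding c complex_eq_iff using integral_Re[OF i] integral_Im[OF i]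
        by (simp add: Re_exp Im_exp)
      moreover have "cos (t * U x + - (pi/2)) = sin (t * U x)" for x
        by (simp add: cos_diff)
      moreover have "measure (distr ?D borel U) B = (\<integral>\<omega>. u \<omega> * indicator B (U \<omega>) \<partial>R) / m"
      proof -
        have "measure (distr ?D borel U) B = (\<integral>x. indicator B x \<partial>distr ?D borel U)" by simp
        also have "\<dots> = (\<integral>x. indicator B (U x) \<partial>?D)" by (intro integral_distr) auto
        also have "\<dots> = (\<integral>x. (u x / m) *\<^sub>R indicator B (U x) \<partial>R)"
          using u m by (intro integral_density) auto
        finally show ?thesis by simp
      qed
      ultimately show ?thesis using rd by simp
    qed
    note 1 = *[OF assms(1) w m_def] and 2 = *[OF assms(2) v m']
    have "distr (density P (\<lambda>x. ennreal (w x / m))) borel X = distr (density Q (\<lambda>x. ennreal (v x / m))) borel Y"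
      using 1 2 by (intro Levy_uniqueness) (simp_all only: fun_eq_iff eq simp_thms)
    then have "(\<integral>\<omega>. w \<omega> * indicator B (X \<omega>) \<partial>P) / m = (\<integral>\<omega>. v \<omega> * indicator B (Y \<omega>) \<partial>Q) / m"
      using 1[of 0, THEN conjunct2, THEN conjunct2] 2[of 0, THEN conjunct2, THEN conjunct2] by (simp only:)
    then show ?thesis using m by simp
  qed
qed

text \<open>
  The coordinates in \<open>K\<close> are passed from the cosine to indicators one at a time.  To move \<open>k\<close>, apply the
  one-dimensional statement to \<open>X k\<close> with the nonnegative weight \<open>\<Prod> indicator * (1 + cos S)\<close>, where \<open>S\<close> is the
  combination of the coordinates that remain: by the product formula for cosines its transforms are
  again cosine integrals with the indicators of \<open>K\<close>.  The constant \<open>1\<close>, which only makes the weight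
  nonnegative, is subtracted at the end.
\<close>
lemma indicator_cos_integral_eq:
  fixes X :: "'i \<Rightarrow> 'b \<Rightarrow> real" and Y :: "'i \<Rightarrow> 'c \<Rightarrow> real"
  assumes P: "prob_space P" and Q: "prob_space Q" and I: "finite I"
    and X: "\<And>i. i \<in> I \<Longrightarrow> X i \<in> borel_measurable P" and Y: "\<And>i. i \<in> I \<Longrightarrow> Y i \<in> borel_measurable Q"
    and eq: "\<And>c a. (\<integral>\<omega>. cos ((\<Sum>i\<in>I. c i * X i \<omega>) + a) \<partial>P) = (\<integral>\<omega>. cos ((\<Sum>i\<in>I. c i * Y i \<omega>) + a) \<partial>Q)"
    and B: "\<And>i. i \<in> I \<Longrightarrow> B i \<in> sets borel" and K: "K \<subseteq> I"
  shows "(\<integral>\<omega>. (\<Prod>k\<in>K. indicator (B k) (X k \<omega>)) * cos ((\<Sum>i\<in>I - K. c i * X i \<omega>) + a) \<partial>P)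
       = (\<integral>\<omega>. (\<Prod>k\<in>K. indicator (B k) (Y k \<omega>)) * cos ((\<Sum>i\<in>I - K. c i * Y i \<omega>) + a) \<partial>Q)"
proof -
  interpret P: prob_space P by fact
  interpret Q: prob_space Q by fact
  have "finite K" using K I by (rule finite_subset)
  then show ?thesis using K
  proof (induction K arbitrary: c a rule: finite_induct)
    case empty
    then show ?case by (simp add: eq)
  next
    case (insert k K)
    then have k: "k \<in> I" "k \<notin> K" "K \<subseteq> I" and IK: "I - K = insert k (I - insert k K)" by auto
    let ?S = "\<lambda>Z c \<omega>. \<Sum>i\<in>I - insert k K. c i * Z i \<omega>"
    let ?p = "\<lambda>Z \<omega>. \<Prod>k\<in>K. indicator (B k) (Z k \<omega>) :: real"
    have sumk: "(\<Sum>i\<in>I - K. (c(k := t)) i * Z i \<omega>) = t * Z k \<omega> + (\<Sum>i\<in>I - insert k K. c i * Z i \<omega>)"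
      for t :: real and Z :: "'i \<Rightarrow> 'd \<Rightarrow> real" and c \<omega>
      unfolding IK using I by (subst sum.insert) (auto intro!: sum.cong)
    have meas: "?p Z \<in> borel_measurable R" "?S Z d \<in> borel_measurable R" "Z k \<in> borel_measurable R"
      "(\<lambda>\<omega>. indicator (B k) (Z k \<omega>) :: real) \<in> borel_measurable R"
      if "\<And>i. i \<in> I \<Longrightarrow> Z i \<in> borel_measurable R" for R :: "'d measure" and Z d
    proof -
      note that[measurable] B[measurable]
      show "?S Z d \<in> borel_measurable R" by measurable
      show "Z k \<in> borel_measurable R" using that k by auto
      have ind: "(\<lambda>\<omega>. indicator (B i) (Z i \<omega>) :: real) \<in> borel_measurable R" if i: "i \<in> I" for i
      proof -
        have [measurable]: "Z i \<in> borel_measurable R" "B i \<in> sets borel" using i \<open>\<And>i. i \<in> I \<Longrightarrow> Z i \<in> borel_measurable R\<close> B by auto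
        show ?thesis by measurable
      qed
      show "?p Z \<in> borel_measurable R" using ind k by (intro borel_measurable_prod) auto
      show "(\<lambda>\<omega>. indicator (B k) (Z k \<omega>) :: real) \<in> borel_measurable R" using ind k by auto
    qed
    have p01: "0 \<le> ?p Z \<omega>" "?p Z \<omega> \<le> 1" for Z :: "'i \<Rightarrow> 'd \<Rightarrow> real" and \<omega>
      by (auto intro!: prod_nonneg prod_le_1)
    have p_int: "integrable R (\<lambda>\<omega>. ?p Z \<omega> * g \<omega>)"
      if "prob_space R" "\<And>i. i \<in> I \<Longrightarrow> Z i \<in> borel_measurable R" "g \<in> borel_measurable R" "\<And>\<omega>. \<bar>g \<omega>\<bar> \<le> 4"
      for R :: "'d measure" and Z g
    proof -
      interpret R: prob_space R by fact
      note [measurable] = meas(1)[OF that(2)] that(3)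
      show ?thesis
      proof (rule R.integrable_const_bound[of _ 4])
        have "\<bar>?p Z \<omega>\<bar> * \<bar>g \<omega>\<bar> \<le> 1 * 4" for \<omega>
          using p01[of Z \<omega>] that(4)[of \<omega>] by (intro mult_mono) auto
        then show "AE \<omega> in R. norm (?p Z \<omega> * g \<omega>) \<le> 4" by (simp add: abs_mult)
      qed measurable
    qed
    have abs2: "\<bar>1 + cos x\<bar> \<le> 2" for x :: real using cos_le_one[of x] cos_ge_minus_one[of x] by linarith
    have split: "(\<integral>\<omega>. (?p Z \<omega> * (1 + cos (?S Z c \<omega> + a))) * cos (t * Z k \<omega> + b) \<partial>R)
        = (\<integral>\<omega>. ?p Z \<omega> * cos ((\<Sum>i\<in>I - K. ((\<lambda>_. 0)(k := t)) i * Z i \<omega>) + b) \<partial>R)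
        + (\<integral>\<omega>. ?p Z \<omega> * cos ((\<Sum>i\<in>I - K. (c(k := t)) i * Z i \<omega>) + (a + b)) \<partial>R) / 2
        + (\<integral>\<omega>. ?p Z \<omega> * cos ((\<Sum>i\<in>I - K. (c(k := -t)) i * Z i \<omega>) + (a - b)) \<partial>R) / 2"
      if R: "prob_space R" and Z: "\<And>i. i \<in> I \<Longrightarrow> Z i \<in> borel_measurable R"
      for R :: "'d measure" and Z c a t b
    proof -
      note [measurable] = meas[OF Z]
      have e: "(?p Z \<omega> * (1 + cos (?S Z c \<omega> + a))) * cos (t * Z k \<omega> + b)
         = ?p Z \<omega> * cos ((\<Sum>i\<in>I - K. ((\<lambda>_. 0)(k := t)) i * Z i \<omega>) + b)
         + ?p Z \<omega> * cos ((\<Sum>i\<in>I - K. (c(k := t)) i * Z i \<omega>) + (a + b)) / 2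
         + ?p Z \<omega> * cos ((\<Sum>i\<in>I - K. (c(k := -t)) i * Z i \<omega>) + (a - b)) / 2" for \<omega>
      proof -
        have "cos (?S Z c \<omega> + a) * cos (t * Z k \<omega> + b) =
           (cos ((t * Z k \<omega> + ?S Z c \<omega>) + (a + b)) + cos ((- t * Z k \<omega> + ?S Z c \<omega>) + (a - b))) / 2"
          unfolding cos_times_cos by (simp add: algebra_simps)
        moreover have "(?p Z \<omega> * (1 + cos (?S Z c \<omega> + a))) * cos (t * Z k \<omega> + b)
          = ?p Z \<omega> * cos (t * Z k \<omega> + b) + ?p Z \<omega> * (cos (?S Z c \<omega> + a) * cos (t * Z k \<omega> + b))"
          by (simp add: algebra_simps)
        ultimately show ?thesis unfolding sumk by (simp add: distrib_left add_divide_distrib)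
      qed
      have i: "integrable R (\<lambda>\<omega>. ?p Z \<omega> * cos ((\<Sum>i\<in>I - K. (c(k := t)) i * Z i \<omega>) + b))" for c t b
        unfolding sumk by (intro p_int R Z) (auto intro: order_trans[OF abs_cos_le_one])
      note j = integrable_divide_zero[OF i]
      show ?thesis unfolding e
        by (simp only: Bochner_Integration.integral_add[OF Bochner_Integration.integrable_add[OF i j] j]
            Bochner_Integration.integral_add[OF i j] integral_divide_zero)
    qed
    have w: "(\<integral>\<omega>. (?p X \<omega> * (1 + cos (?S X c \<omega> + a))) * indicator (B k) (X k \<omega>) \<partial>P)
      = (\<integral>\<omega>. (?p Y \<omega> * (1 + cos (?S Y c \<omega> + a))) * indicator (B k) (Y k \<omega>) \<partial>Q)" for c a
    proof (rule weighted_laws_eqI)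
      note [measurable] = meas[OF X] meas[OF Y]
      show "X k \<in> borel_measurable P" "Y k \<in> borel_measurable Q" by measurable
      show "B k \<in> sets borel" using B k by auto
      show "integrable P (\<lambda>\<omega>. ?p X \<omega> * (1 + cos (?S X c \<omega> + a)))"
        by (intro p_int P X; (measurable)?; intro order_trans[OF abs2]; simp)
      show "integrable Q (\<lambda>\<omega>. ?p Y \<omega> * (1 + cos (?S Y c \<omega> + a)))"
        by (intro p_int Q Y; (measurable)?; intro order_trans[OF abs2]; simp)
      have "0 \<le> 1 + cos x" for x :: real using cos_ge_minus_one[of x] by linarith
      then show "0 \<le> ?p X \<omega> * (1 + cos (?S X c \<omega> + a))" "0 \<le> ?p Y \<omega>' * (1 + cos (?S Y c \<omega>' + a))" for \<omega> \<omega>'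
        using p01(1)[of X] p01(1)[of Y] by (auto intro!: mult_nonneg_nonneg)
      show "(\<integral>\<omega>. ?p X \<omega> * (1 + cos (?S X c \<omega> + a)) * cos (t * X k \<omega> + b) \<partial>P)
          = (\<integral>\<omega>. ?p Y \<omega> * (1 + cos (?S Y c \<omega> + a)) * cos (t * Y k \<omega> + b) \<partial>Q)" for t b
        by (rule trans[OF split[OF P X] trans[OF _ split[OF Q Y, symmetric]]])
          (simp_all only: insert.IH[OF k(3)])
    qed
    \<comment> \<open>The phase \<open>\<pi>/2\<close> kills the cosine of the zero combination, so the second integral has weight \<open>1\<close>.\<close>
    have fin: "(\<integral>\<omega>. (\<Prod>k\<in>insert k K. indicator (B k) (Z k \<omega>)) * cos (?S Z c \<omega> + a) \<partial>R)
       = (\<integral>\<omega>. (?p Z \<omega> * (1 + cos (?S Z c \<omega> + a))) * indicator (B k) (Z k \<omega>) \<partial>R)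
       - (\<integral>\<omega>. (?p Z \<omega> * (1 + cos (?S Z (\<lambda>_. 0) \<omega> + pi/2))) * indicator (B k) (Z k \<omega>) \<partial>R)"
      if R: "prob_space R" and Z: "\<And>i. i \<in> I \<Longrightarrow> Z i \<in> borel_measurable R" for R :: "'d measure" and Z
    proof -
      note [measurable] = meas[OF Z]
      have i: "integrable R (\<lambda>\<omega>. ?p Z \<omega> * ((1 + cos (?S Z c \<omega> + a)) * indicator (B k) (Z k \<omega>)))" for c a
        by (intro p_int R Z; (measurable)?) (auto simp: indicator_def intro: order_trans[OF abs2])
      show ?thesis
        by (subst Bochner_Integration.integral_diff[symmetric])
          (use i[of c a] i[of "\<lambda>_. 0" "pi/2"] k insert(1) in \<open>auto simp: mult.assoc intro!: Bochner_Integration.integral_cong simp: algebra_simps\<close>)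
    qed
    show ?case
      by (rule trans[OF fin[OF P X] trans[OF _ fin[OF Q Y, symmetric]]]) (simp_all only: w[of c a] w[of "\<lambda>_. 0" "pi/2"])
  qed
qed

text \<open>
  The Cramer--Wold device.  The previous lemma with \<open>K = I\<close> gives equality on boxes, and these generate
  the product \<open>\<sigma>\<close>-algebra.
\<close>
lemma joint_law_eqI:
  fixes X :: "'i \<Rightarrow> 'b \<Rightarrow> real" and Y :: "'i \<Rightarrow> 'c \<Rightarrow> real"
  assumes P: "prob_space P" and Q: "prob_space Q" and I: "finite I"
    and X: "\<And>i. i \<in> I \<Longrightarrow> X i \<in> borel_measurable P" and Y: "\<And>i. i \<in> I \<Longrightarrow> Y i \<in> borel_measurable Q"
    and eq: "\<And>c a. (\<integral>\<omega>. cos ((\<Sum>i\<in>I. c i * X i \<omega>) + a) \<partial>P) = (\<integral>\<omega>. cos ((\<Sum>i\<in>I. c i * Y i \<omega>) + a) \<partial>Q)"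
  shows "distr P (PiM I (\<lambda>_. borel)) (\<lambda>\<omega>. \<lambda>i\<in>I. X i \<omega>) = distr Q (PiM I (\<lambda>_. borel)) (\<lambda>\<omega>. \<lambda>i\<in>I. Y i \<omega>)"
    (is "?l = ?r")
proof (rule measure_eqI_PiM_finite[OF I])
  interpret P: prob_space P by fact
  interpret Q: prob_space Q by fact
  have mX[measurable]: "(\<lambda>\<omega>. \<lambda>i\<in>I. X i \<omega>) \<in> P \<rightarrow>\<^sub>M PiM I (\<lambda>_. borel)" using X by measurable
  have mY[measurable]: "(\<lambda>\<omega>. \<lambda>i\<in>I. Y i \<omega>) \<in> Q \<rightarrow>\<^sub>M PiM I (\<lambda>_. borel)" using Y by measurable
  show "sets ?l = sets (PiM I (\<lambda>_. borel))" "sets ?r = sets (PiM I (\<lambda>_. borel))" by simp_all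
  show "range (\<lambda>_::nat. PiE I (\<lambda>_. UNIV)) \<subseteq> prod_algebra I (\<lambda>_. borel)"
    using I by (auto intro!: prod_algebraI_finite simp: space_borel)
  show "\<Union> (range (\<lambda>_::nat. PiE I (\<lambda>_. UNIV))) = space (PiM I (\<lambda>_. borel))" by (simp add: space_PiM)
  interpret L: prob_space ?l by (rule P.prob_space_distr) measurable
  show "emeasure ?l (PiE I (\<lambda>_. UNIV)) \<noteq> \<infinity>" by simp
next
  interpret P: prob_space P by fact
  interpret Q: prob_space Q by fact
  fix A :: "'i \<Rightarrow> real set" assume A: "\<And>i. i \<in> I \<Longrightarrow> A i \<in> sets borel"
  have *: "emeasure (distr R (PiM I (\<lambda>_. borel)) (\<lambda>\<omega>. \<lambda>i\<in>I. Z i \<omega>)) (PiE I A)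
     = ennreal (\<integral>\<omega>. (\<Prod>k\<in>I. indicator (A k) (Z k \<omega>)) * cos ((\<Sum>i\<in>I - I. 0 * Z i \<omega>) + 0) \<partial>R)"
    if R: "prob_space R" and Z: "\<And>i. i \<in> I \<Longrightarrow> Z i \<in> borel_measurable R" for R :: "'d measure" and Z
  proof -
    interpret R: prob_space R by fact
    have m: "(\<lambda>\<omega>. \<lambda>i\<in>I. Z i \<omega>) \<in> R \<rightarrow>\<^sub>M PiM I (\<lambda>_. borel)" using Z by measurable
    let ?E = "(\<lambda>\<omega>. \<lambda>i\<in>I. Z i \<omega>) -` PiE I A \<inter> space R"
    have E: "?E \<in> sets R" by (rule measurable_sets[OF m]) (use A I in \<open>auto intro!: sets_PiM_I_finite\<close>)
    have "emeasure (distr R (PiM I (\<lambda>_. borel)) (\<lambda>\<omega>. \<lambda>i\<in>I. Z i \<omega>)) (PiE I A) = emeasure R ?E"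
      by (rule emeasure_distr[OF m]) (use A I in \<open>auto intro!: sets_PiM_I_finite\<close>)
    also have "\<dots> = ennreal (\<integral>\<omega>. indicator ?E \<omega> \<partial>R)" using E by (simp add: R.emeasure_eq_measure)
    also have "(\<integral>\<omega>. indicator ?E \<omega> \<partial>R) = (\<integral>\<omega>. (\<Prod>k\<in>I. indicator (A k) (Z k \<omega>) :: real) \<partial>R)"
    proof (rule Bochner_Integration.integral_cong[OF refl])
      fix \<omega> assume \<omega>: "\<omega> \<in> space R"
      show "indicator ?E \<omega> = (\<Prod>k\<in>I. indicator (A k) (Z k \<omega>) :: real)"
      proof (cases "\<forall>i\<in>I. Z i \<omega> \<in> A i")
        case True then show ?thesis using \<omega> by (auto simp: indicator_def)
      next
        case False
        then obtain i where "i \<in> I" "Z i \<omega> \<notin> A i" by auto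
        then have "(\<Prod>k\<in>I. indicator (A k) (Z k \<omega>) :: real) = 0" using I by (intro prod_zero) (auto simp: indicator_def)
        moreover have "\<omega> \<notin> ?E" using False by (auto simp: PiE_iff)
        ultimately show ?thesis by simp
      qed
    qed
    finally show ?thesis by (simp only: Diff_cancel sum.empty add_0 cos_zero mult_1_right)
  qed
  have "(\<integral>\<omega>. (\<Prod>k\<in>I. indicator (A k) (X k \<omega>)) * cos ((\<Sum>i\<in>I - I. 0 * X i \<omega>) + 0) \<partial>P)
      = (\<integral>\<omega>. (\<Prod>k\<in>I. indicator (A k) (Y k \<omega>)) * cos ((\<Sum>i\<in>I - I. 0 * Y i \<omega>) + 0) \<partial>Q)"
    by (rule indicator_cos_integral_eq[OF P Q I _ _ eq _ order_refl]) (fact X Y A)+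
  moreover have "emeasure ?l (PiE I A) = ennreal (\<integral>\<omega>. (\<Prod>k\<in>I. indicator (A k) (X k \<omega>)) * cos ((\<Sum>i\<in>I - I. 0 * X i \<omega>) + 0) \<partial>P)"
    by (rule *[OF P]) (fact X)
  moreover have "emeasure ?r (PiE I A) = ennreal (\<integral>\<omega>. (\<Prod>k\<in>I. indicator (A k) (Y k \<omega>)) * cos ((\<Sum>i\<in>I - I. 0 * Y i \<omega>) + 0) \<partial>Q)"
    by (rule *[OF Q]) (fact Y)
  ultimately show "emeasure ?l (PiE I A) = emeasure ?r (PiE I A)" by (simp only:)
qed

section \<open>Centered Gaussian variables and the rotation of two independent copies\<close>

lemma nn_integral_normal_density_exp:
  assumes "0 < s"
  shows "(\<integral>\<^sup>+x. ennreal (normal_density 0 s x * exp (t * x)) \<partial>lborel) = ennreal (exp (t\<^sup>2 * s\<^sup>2 / 2))"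
proof -
  \<comment> \<open>Completing the square: the tilted density is a normal density with mean \<open>t * s\<^sup>2\<close>.\<close>
  have "normal_density 0 s x * exp (t * x) = exp (t\<^sup>2 * s\<^sup>2 / 2) * normal_density (t * s\<^sup>2) s x" for x
  proof -
    have "- (x\<^sup>2) / (2 * s\<^sup>2) + t * x = t\<^sup>2 * s\<^sup>2 / 2 + - ((x - t * s\<^sup>2)\<^sup>2) / (2 * s\<^sup>2)"
      using assms by (simp add: field_simps power2_eq_square)
    then show ?thesis by (simp add: normal_density_def exp_add[symmetric] del: exp_add)
  qed
  then have "(\<integral>\<^sup>+x. ennreal (normal_density 0 s x * exp (t * x)) \<partial>lborel)
     = (\<integral>\<^sup>+x. ennreal (exp (t\<^sup>2 * s\<^sup>2 / 2) * normal_density (t * s\<^sup>2) s x) \<partial>lborel)" by simp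
  also have "\<dots> = ennreal (\<integral>x. exp (t\<^sup>2 * s\<^sup>2 / 2) * normal_density (t * s\<^sup>2) s x \<partial>lborel)"
    using assms by (intro nn_integral_eq_integral) auto
  also have "\<dots> = ennreal (exp (t\<^sup>2 * s\<^sup>2 / 2))" using assms by simp
  finally show ?thesis .
qed

lemma centered_gaussian_transforms:
  assumes P: "prob_space P" and X: "centered_gaussian P X"
  shows "X \<in> borel_measurable P"
    and "integrable P (\<lambda>\<omega>. (X \<omega>)\<^sup>2)"
    and "(\<integral>\<^sup>+\<omega>. ennreal (exp (t * X \<omega>)) \<partial>P) = ennreal (exp (t\<^sup>2 * (\<integral>\<omega>. (X \<omega>)\<^sup>2 \<partial>P) / 2))"
    and "(\<integral>\<omega>. cos (X \<omega> + a) \<partial>P) = exp (- (\<integral>\<omega>. (X \<omega>)\<^sup>2 \<partial>P) / 2) * cos a"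
proof -
  interpret prob_space P by fact
  show m[measurable]: "X \<in> borel_measurable P" using X by (simp add: centered_gaussian_def)
  consider (0) "AE \<omega> in P. X \<omega> = 0" | (pos) s where "s > 0" "distributed P lborel X (normal_density 0 s)"
    using X by (auto simp: centered_gaussian_def)
  then have "integrable P (\<lambda>\<omega>. (X \<omega>)\<^sup>2) \<and>
    (\<integral>\<^sup>+\<omega>. ennreal (exp (t * X \<omega>)) \<partial>P) = ennreal (exp (t\<^sup>2 * (\<integral>\<omega>. (X \<omega>)\<^sup>2 \<partial>P) / 2)) \<and>
    (\<integral>\<omega>. cos (X \<omega> + a) \<partial>P) = exp (- (\<integral>\<omega>. (X \<omega>)\<^sup>2 \<partial>P) / 2) * cos a"
  proof cases
    case 0
    have "integrable P (\<lambda>\<omega>. (X \<omega>)\<^sup>2) \<longleftrightarrow> integrable P (\<lambda>\<omega>. 0::real)"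
      by (rule integrable_cong_AE) (use 0 in auto)
    moreover have "(\<integral>\<omega>. (X \<omega>)\<^sup>2 \<partial>P) = (\<integral>\<omega>. 0 \<partial>P)"
      by (rule integral_cong_AE) (use 0 in auto)
    moreover have "(\<integral>\<omega>. cos (X \<omega> + a) \<partial>P) = (\<integral>\<omega>. cos a \<partial>P)"
      by (rule integral_cong_AE) (use 0 in auto)
    moreover have "(\<integral>\<^sup>+\<omega>. ennreal (exp (t * X \<omega>)) \<partial>P) = (\<integral>\<^sup>+\<omega>. 1 \<partial>P)"
      by (rule nn_integral_cong_AE) (use 0 in auto)
    ultimately show ?thesis by (simp add: prob_space emeasure_space_1)
  next
    case pos
    note s = pos(1) and d = pos(2)
    have sq: "has_bochner_integral lborel (\<lambda>x. normal_density 0 s x * x\<^sup>2) (s\<^sup>2)"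
      using normal_moment_even[OF s, of 0 1] s by (simp add: eval_nat_numeral)
    have i: "integrable P (\<lambda>\<omega>. (X \<omega>)\<^sup>2)"
      using distributed_integrable[OF d, of "\<lambda>x. x\<^sup>2"] sq by (auto simp: has_bochner_integral_iff)
    have v: "(\<integral>\<omega>. (X \<omega>)\<^sup>2 \<partial>P) = s\<^sup>2"
      using distributed_integral[OF d, of "\<lambda>x. x\<^sup>2"] sq by (auto simp: has_bochner_integral_iff)
    have e: "(\<integral>\<^sup>+\<omega>. ennreal (exp (t * X \<omega>)) \<partial>P) = ennreal (exp (t\<^sup>2 * s\<^sup>2 / 2))"
      using distributed_nn_integral[OF d, of "\<lambda>x. ennreal (exp (t * x))"] nn_integral_normal_density_exp[OF s, of t]
      by (simp add: ennreal_mult'')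
    have "distributed P lborel (\<lambda>\<omega>. 0 + (1 / s) * X \<omega>) (normal_density (0 + (1 / s) * 0) (\<bar>1 / s\<bar> * s))"
      using s by (intro normal_density_affine d) auto
    then have d1: "distributed P lborel (\<lambda>\<omega>. X \<omega> / s) std_normal_density" using s by simp
    then have "density lborel std_normal_density = distr P lborel (\<lambda>\<omega>. X \<omega> / s)"
      by (simp add: distributed_def)
    also have "\<dots> = distr P borel (\<lambda>\<omega>. X \<omega> / s)" by (intro distr_cong) auto
    finally have D: "std_normal_distribution = distr P borel (\<lambda>\<omega>. X \<omega> / s)" .
    have ic: "integrable P (\<lambda>\<omega>. iexp (X \<omega>))" by (rule integrable_iexp) auto
    have "char (distr P borel (\<lambda>\<omega>. X \<omega> / s)) s = (CLINT \<omega>|P. iexp (s * (X \<omega> / s)))"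
      unfolding char_def by (intro integral_distr) auto
    also have "\<dots> = (CLINT \<omega>|P. iexp (X \<omega>))" using s by simp
    finally have "(CLINT \<omega>|P. iexp (X \<omega>)) = complex_of_real (exp (- s\<^sup>2 / 2))"
      using char_std_normal_distribution D by (simp add: fun_eq_iff)
    then have c: "(\<integral>\<omega>. cos (X \<omega>) \<partial>P) = exp (- s\<^sup>2 / 2)" and sn: "(\<integral>\<omega>. sin (X \<omega>) \<partial>P) = 0"
      using integral_Re[OF ic] integral_Im[OF ic] by (simp_all add: Re_exp Im_exp)
    have "integrable P (\<lambda>\<omega>. cos (X \<omega>))" "integrable P (\<lambda>\<omega>. sin (X \<omega>))"
      by (rule integrable_const_bound[of _ 1]; simp)+
    then have "(\<integral>\<omega>. cos (X \<omega> + a) \<partial>P) = exp (- s\<^sup>2 / 2) * cos a"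
      by (simp add: cos_add c sn)
    then show ?thesis using i v e by simp
  qed
  then show "integrable P (\<lambda>\<omega>. (X \<omega>)\<^sup>2)"
    "(\<integral>\<^sup>+\<omega>. ennreal (exp (t * X \<omega>)) \<partial>P) = ennreal (exp (t\<^sup>2 * (\<integral>\<omega>. (X \<omega>)\<^sup>2 \<partial>P) / 2))"
    "(\<integral>\<omega>. cos (X \<omega> + a) \<partial>P) = exp (- (\<integral>\<omega>. (X \<omega>)\<^sup>2 \<partial>P) / 2) * cos a"
    by auto
qed

lemma integral_cos_independent_gaussians:
  assumes P: "prob_space P" and U: "centered_gaussian P U" and V: "centered_gaussian P V"
  shows "(\<integral>w. cos (U (fst w) + V (snd w) + a) \<partial>(P \<Otimes>\<^sub>M P))
    = exp (- ((\<integral>\<omega>. (U \<omega>)\<^sup>2 \<partial>P) + (\<integral>\<omega>. (V \<omega>)\<^sup>2 \<partial>P)) / 2) * cos a"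
proof -
  interpret prob_space P by fact
  interpret PP: pair_prob_space P P ..
  note [measurable] = centered_gaussian_transforms(1)[OF P U] centered_gaussian_transforms(1)[OF P V]
  have i: "integrable (P \<Otimes>\<^sub>M P) (\<lambda>(x, y). cos (V y + (U x + a)))"
    by (rule PP.P.integrable_const_bound[of _ 1]) auto
  have "(\<integral>w. cos (U (fst w) + V (snd w) + a) \<partial>(P \<Otimes>\<^sub>M P)) = (\<integral>(x, y). cos (V y + (U x + a)) \<partial>(P \<Otimes>\<^sub>M P))"
    by (intro Bochner_Integration.integral_cong) (auto simp: algebra_simps)
  also have "\<dots> = (\<integral>x. (\<integral>y. cos (V y + (U x + a)) \<partial>P) \<partial>P)"
    using PP.integral_fst'[OF i] by simp
  also have "\<dots> = (\<integral>x. exp (- (\<integral>\<omega>. (V \<omega>)\<^sup>2 \<partial>P) / 2) * cos (U x + a) \<partial>P)"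
    by (simp only: centered_gaussian_transforms(4)[OF P V])
  also have "\<dots> = exp (- (\<integral>\<omega>. (V \<omega>)\<^sup>2 \<partial>P) / 2) * (exp (- (\<integral>\<omega>. (U \<omega>)\<^sup>2 \<partial>P) / 2) * cos a)"
    by (simp add: centered_gaussian_transforms(4)[OF P U])
  finally show ?thesis by (simp add: exp_add[symmetric] add_divide_distrib mult.assoc[symmetric] add.commute)
qed

text \<open>
  The field \<open>X\<close> on \<open>P \<Otimes>\<^sub>M P\<close> yields two independent copies, one for each coordinate.  The family
  below is this pair rotated by the angle \<open>\<theta>\<close>; the index \<open>(False, i)\<close> belongs to the first component of
  the rotated pair and \<open>(True, i)\<close> to the second.  As \<open>\<theta>\<close> runs from \<open>0\<close> to \<open>\<pi>/2\<close>, the first component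
  moves from one copy to the other.
\<close>
definition rotated_copies :: "('i \<Rightarrow> 'b \<Rightarrow> real) \<Rightarrow> real \<Rightarrow> bool \<times> 'i \<Rightarrow> 'b \<times> 'b \<Rightarrow> real" where
  "rotated_copies X \<theta> j w =
     (if fst j then cos \<theta> * X (snd j) (snd w) - sin \<theta> * X (snd j) (fst w)
      else cos \<theta> * X (snd j) (fst w) + sin \<theta> * X (snd j) (snd w))"

lemma component_gaussian:
  fixes X :: "'i \<Rightarrow> 'b \<Rightarrow> real"
  assumes P: "prob_space P" and I: "finite I"
    and X: "\<And>c. centered_gaussian P (\<lambda>\<omega>. \<Sum>i\<in>I. c i * X i \<omega>)" and i: "i \<in> I"
  shows "centered_gaussian P (X i)" and "X i \<in> borel_measurable P"
proof -
  have "(\<lambda>\<omega>. \<Sum>k\<in>I. (if k = i then 1 else 0) * X k \<omega>) = X i"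
  proof
    fix \<omega>
    have "(\<Sum>k\<in>I. (if k = i then 1 else 0) * X k \<omega>) = (\<Sum>k\<in>I. if k = i then X k \<omega> else 0)"
      by (intro sum.cong) auto
    then show "(\<Sum>k\<in>I. (if k = i then 1 else 0) * X k \<omega>) = X i \<omega>" using i I by simp
  qed
  then show "centered_gaussian P (X i)" using X[of "\<lambda>k. if k = i then 1 else 0"] by simp
  then show "X i \<in> borel_measurable P" by (rule centered_gaussian_transforms(1)[OF P])
qed

text \<open>
  A combination of the rotated pair is \<open>U + V\<close> with independent centered Gaussian \<open>U\<close>, \<open>V\<close>, and the sum
  of their variances does not change under rotation because \<open>sin\<^sup>2 + cos\<^sup>2 = 1\<close>.
\<close>
lemma rotated_copies_law:
  fixes X :: "'i \<Rightarrow> 'b \<Rightarrow> real"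
  assumes P: "prob_space P" and I: "finite I"
    and X: "\<And>c. centered_gaussian P (\<lambda>\<omega>. \<Sum>i\<in>I. c i * X i \<omega>)"
  defines "J \<equiv> (UNIV :: bool set) \<times> I"
  shows "distr (P \<Otimes>\<^sub>M P) (PiM J (\<lambda>_. borel)) (\<lambda>w. \<lambda>j\<in>J. rotated_copies X \<theta> j w)
       = distr (P \<Otimes>\<^sub>M P) (PiM J (\<lambda>_. borel)) (\<lambda>w. \<lambda>j\<in>J. rotated_copies X \<theta>' j w)"
proof -
  interpret prob_space P by fact
  interpret PP: pair_prob_space P P ..
  note mX = component_gaussian[OF P I X]
  have mR: "rotated_copies X \<theta> j \<in> borel_measurable (P \<Otimes>\<^sub>M P)" if "j \<in> J" for j \<theta>
  proof -
    have [measurable]: "X (snd j) \<in> borel_measurable P" using that mX by (auto simp: J_def)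
    show ?thesis unfolding rotated_copies_def by measurable
  qed
  let ?S = "\<lambda>c \<omega>. \<Sum>i\<in>I. c i * X i \<omega>"
  let ?Q = "\<lambda>c. \<integral>\<omega>. (?S c \<omega>)\<^sup>2 \<partial>P"
  have ct: "(\<integral>w. cos ((\<Sum>j\<in>J. c j * rotated_copies X \<theta> j w) + a) \<partial>(P \<Otimes>\<^sub>M P))
     = exp (- (?Q (\<lambda>i. c (False, i)) + ?Q (\<lambda>i. c (True, i))) / 2) * cos a" for c \<theta> a
  proof -
    let ?u = "\<lambda>i. c (False, i) * cos \<theta> - c (True, i) * sin \<theta>"
    let ?v = "\<lambda>i. c (False, i) * sin \<theta> + c (True, i) * cos \<theta>"
    have J: "J = (\<lambda>i. (True, i)) ` I \<union> (\<lambda>i. (False, i)) ` I"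
      by (auto simp: J_def)
    have "(\<Sum>j\<in>J. c j * rotated_copies X \<theta> j w) = ?S ?u (fst w) + ?S ?v (snd w)" for w
      unfolding J using I
      by (subst sum.union_disjoint)
        (auto simp: sum.reindex inj_on_def rotated_copies_def sum.distrib[symmetric] algebra_simps intro!: sum.cong)
    then have "(\<integral>w. cos ((\<Sum>j\<in>J. c j * rotated_copies X \<theta> j w) + a) \<partial>(P \<Otimes>\<^sub>M P))
      = exp (- (?Q ?u + ?Q ?v) / 2) * cos a"
      using integral_cos_independent_gaussians[OF P X X, of ?u ?v a] by simp
    moreover have "?Q ?u + ?Q ?v = ?Q (\<lambda>i. c (False, i)) + ?Q (\<lambda>i. c (True, i))"
    proof -
      have "(?S ?u \<omega>)\<^sup>2 + (?S ?v \<omega>)\<^sup>2 = (?S (\<lambda>i. c (False, i)) \<omega>)\<^sup>2 + (?S (\<lambda>i. c (True, i)) \<omega>)\<^sup>2" for \<omega>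
      proof -
        have u: "?S ?u \<omega> = ?S (\<lambda>i. c (False, i)) \<omega> * cos \<theta> - ?S (\<lambda>i. c (True, i)) \<omega> * sin \<theta>"
          by (simp add: algebra_simps sum_subtractf sum_distrib_left)
        have v: "?S ?v \<omega> = ?S (\<lambda>i. c (False, i)) \<omega> * sin \<theta> + ?S (\<lambda>i. c (True, i)) \<omega> * cos \<theta>"
          by (simp add: algebra_simps sum.distrib sum_distrib_left)
        have "(x * cos \<theta> - y * sin \<theta>)\<^sup>2 + (x * sin \<theta> + y * cos \<theta>)\<^sup>2 = (x\<^sup>2 + y\<^sup>2) * ((sin \<theta>)\<^sup>2 + (cos \<theta>)\<^sup>2)" for x y :: real
          by algebra
        then show ?thesis unfolding u v by (simp only: sin_cos_squared_add mult_1_right)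
      qed
      then show ?thesis
        using centered_gaussian_transforms(2)[OF P X]
        by (subst (1 2) Bochner_Integration.integral_add[symmetric]) auto
    qed
    ultimately show ?thesis by simp
  qed
  show ?thesis
  proof (rule joint_law_eqI)
    show "prob_space (P \<Otimes>\<^sub>M P)" "prob_space (P \<Otimes>\<^sub>M P)" by unfold_locales
    show "finite J" using I by (simp add: J_def)
  qed (simp_all only: ct mR)
qed

lemma nn_integral_rotated_copies:
  fixes X :: "'i \<Rightarrow> 'b \<Rightarrow> real"
  assumes P: "prob_space P" and I: "finite I"
    and X: "\<And>c. centered_gaussian P (\<lambda>\<omega>. \<Sum>i\<in>I. c i * X i \<omega>)"
    and G: "G \<in> borel_measurable (PiM (UNIV \<times> I) (\<lambda>_. borel))"
  shows "(\<integral>\<^sup>+w. G (\<lambda>j\<in>UNIV \<times> I. rotated_copies X \<theta> j w) \<partial>(P \<Otimes>\<^sub>M P))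
       = (\<integral>\<^sup>+w. G (\<lambda>j\<in>UNIV \<times> I. rotated_copies X 0 j w) \<partial>(P \<Otimes>\<^sub>M P))"
proof -
  note mX = component_gaussian[OF P I X]
  have mR: "rotated_copies X \<theta> j \<in> borel_measurable (P \<Otimes>\<^sub>M P)" if "j \<in> UNIV \<times> I" for j \<theta>
  proof -
    have [measurable]: "X (snd j) \<in> borel_measurable P" using that mX by auto
    show ?thesis unfolding rotated_copies_def by measurable
  qed
  have m: "(\<lambda>w. \<lambda>j\<in>UNIV \<times> I. rotated_copies X \<theta> j w) \<in> P \<Otimes>\<^sub>M P \<rightarrow>\<^sub>M PiM (UNIV \<times> I) (\<lambda>_. borel)" for \<theta>
    by (intro measurable_restrict mR)
  have "(\<integral>\<^sup>+w. G (\<lambda>j\<in>UNIV \<times> I. rotated_copies X \<theta> j w) \<partial>(P \<Otimes>\<^sub>M P))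
     = integral\<^sup>N (distr (P \<Otimes>\<^sub>M P) (PiM (UNIV \<times> I) (\<lambda>_. borel)) (\<lambda>w. \<lambda>j\<in>UNIV \<times> I. rotated_copies X \<theta> j w)) G" for \<theta>
    by (rule nn_integral_distr[OF m, symmetric]) (use G in simp)
  then show ?thesis by (simp only: rotated_copies_law[OF P I X, of \<theta> 0])
qed

section \<open>Dimension-free concentration of log-sum-exp\<close>

definition log_sum_exp :: "real \<Rightarrow> 'i set \<Rightarrow> ('i \<Rightarrow> real) \<Rightarrow> real" where
  "log_sum_exp \<beta> I x = ln (\<Sum>i\<in>I. exp (\<beta> * x i))"

lemma exp_weighted_mean_le:
  fixes w y :: "'i \<Rightarrow> real"
  assumes "finite I" "I \<noteq> {}" "(\<Sum>i\<in>I. w i) = 1" "\<And>i. i \<in> I \<Longrightarrow> 0 \<le> w i"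
  shows "exp (\<Sum>i\<in>I. w i * y i) \<le> (\<Sum>i\<in>I. w i * exp (y i))"
  using convex_on_sum[OF assms(1,2) exp_convex assms(3,4), of y] by simp

text \<open>
  Jensen's inequality is used twice with the Gibbs weights of \<open>a\<close>: the function \<open>log_sum_exp\<close> is convex, so
  its increment from \<open>b\<close> to \<open>a\<close> is at most the Gibbs average of \<open>\<beta> * (a - b)\<close> at \<open>a\<close>, and the exponential
  of an average is at most the average of the exponentials.
\<close>
lemma exp_log_sum_exp_diff_le:
  fixes a b :: "'i \<Rightarrow> real"
  assumes I: "finite I" "I \<noteq> {}" and s: "0 \<le> s"
  shows "exp (s * (log_sum_exp \<beta> I a - log_sum_exp \<beta> I b))
    \<le> (\<Sum>i\<in>I. exp (\<beta> * a i) / (\<Sum>k\<in>I. exp (\<beta> * a k)) * exp (s * \<beta> * (a i - b i)))"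
proof -
  define Z where "Z = (\<Sum>k\<in>I. exp (\<beta> * a k))"
  define w where "w i = exp (\<beta> * a i) / Z" for i
  have Z: "0 < Z" unfolding Z_def using I by (intro sum_pos) auto
  have Zb: "0 < (\<Sum>k\<in>I. exp (\<beta> * b k))" using I by (intro sum_pos) auto
  have w: "(\<Sum>i\<in>I. w i) = 1" "0 \<le> w i" for i
    using Z by (auto simp: w_def sum_divide_distrib[symmetric]) (simp add: Z_def)
  note J = exp_weighted_mean_le[OF I w(1) w(2)]
  have "exp (\<Sum>i\<in>I. w i * (\<beta> * (b i - a i))) \<le> (\<Sum>i\<in>I. w i * exp (\<beta> * (b i - a i)))" by (rule J)
  also have "\<dots> = (\<Sum>i\<in>I. exp (\<beta> * b i)) / Z"
    by (simp add: w_def sum_divide_distrib exp_add[symmetric] algebra_simps)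
  finally have "(\<Sum>i\<in>I. w i * (\<beta> * (b i - a i))) \<le> ln ((\<Sum>i\<in>I. exp (\<beta> * b i)) / Z)"
    using Z Zb by (subst ln_ge_iff) auto
  also have "\<dots> = log_sum_exp \<beta> I b - log_sum_exp \<beta> I a"
    using Z Zb by (simp add: log_sum_exp_def Z_def ln_div)
  finally have "log_sum_exp \<beta> I a - log_sum_exp \<beta> I b \<le> - (\<Sum>i\<in>I. w i * (\<beta> * (b i - a i)))" by simp
  then have "s * (log_sum_exp \<beta> I a - log_sum_exp \<beta> I b) \<le> s * - (\<Sum>i\<in>I. w i * (\<beta> * (b i - a i)))"
    using s by (rule mult_left_mono)
  also have "\<dots> = (\<Sum>i\<in>I. w i * (s * \<beta> * (a i - b i)))"
    by (simp add: sum_distrib_left sum_negf[symmetric] algebra_simps)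
  finally have "exp (s * (log_sum_exp \<beta> I a - log_sum_exp \<beta> I b)) \<le> exp (\<Sum>i\<in>I. w i * (s * \<beta> * (a i - b i)))"
    by simp
  also have "\<dots> \<le> (\<Sum>i\<in>I. w i * exp (s * \<beta> * (a i - b i)))" by (rule J)
  finally show ?thesis by (simp add: w_def Z_def)
qed

lemma one_minus_cos_le: "1 - cos h \<le> h\<^sup>2 / 2" for h :: real
proof -
  have "1 - cos h = 2 * (sin (h / 2))\<^sup>2" using cos_double_sin[of "h / 2"] by simp
  also have "(sin (h / 2))\<^sup>2 \<le> (h / 2)\<^sup>2"
    using abs_sin_x_le_abs_x[of "h / 2"] by (simp only: abs_le_square_iff)
  finally show ?thesis by (simp add: power2_eq_square)
qed

lemma exp_mult_le:
  fixes x y :: real assumes "\<bar>y\<bar> \<le> 1"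
  shows "exp (y * x) \<le> 1 + \<bar>y\<bar> * (exp x + exp (- x))"
proof -
  have "exp (y * x) \<le> exp (\<bar>y\<bar> * \<bar>x\<bar>)" by (simp add: abs_mult[symmetric])
  also have "\<dots> = exp ((1 - \<bar>y\<bar>) *\<^sub>R 0 + \<bar>y\<bar> *\<^sub>R \<bar>x\<bar>)" by simp
  also have "\<dots> \<le> (1 - \<bar>y\<bar>) * exp 0 + \<bar>y\<bar> * exp \<bar>x\<bar>"
    using assms by (intro convex_onD[OF exp_convex]) auto
  also have "\<dots> \<le> 1 + \<bar>y\<bar> * exp \<bar>x\<bar>" by simp
  also have "exp \<bar>x\<bar> \<le> exp x + exp (- x)" by (cases "0 \<le> x") auto
  finally show ?thesis by (simp add: mult_left_mono)
qed

context
  fixes P :: "'b measure" and X :: "'i \<Rightarrow> 'b \<Rightarrow> real" and I :: "'i set" and V \<beta> l :: real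
  assumes P: "prob_space P" and I: "finite I" "I \<noteq> {}"
    and X: "\<And>c. centered_gaussian P (\<lambda>\<omega>. \<Sum>i\<in>I. c i * X i \<omega>)"
    and V: "\<And>i. i \<in> I \<Longrightarrow> (\<integral>\<omega>. (X i \<omega>)\<^sup>2 \<partial>P) \<le> V"
    and l: "0 \<le> l"
begin

interpretation P: prob_space P by (rule P)
interpretation PP: pair_prob_space P P ..

lemma exp_component_bound:
  assumes i: "i \<in> I" and t: "t\<^sup>2 \<le> u"
  shows "(\<integral>\<^sup>+\<omega>. ennreal (exp (t * X i \<omega>)) \<partial>P) \<le> ennreal (exp (u * V / 2))"
proof -
  have "0 \<le> (\<integral>\<omega>. (X i \<omega>)\<^sup>2 \<partial>P)" by simp
  then have "t\<^sup>2 * (\<integral>\<omega>. (X i \<omega>)\<^sup>2 \<partial>P) \<le> u * V"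
    using V[OF i] t by (intro mult_mono) (auto intro: order_trans[OF zero_le_power2])
  then show ?thesis
    unfolding centered_gaussian_transforms(3)[OF P component_gaussian(1)[OF P I(1) X i]]
    by (intro ennreal_leI) simp
qed

text \<open>
  The case of one small rotation.  The weights in \<open>exp_log_sum_exp_diff_le\<close> depend on the first
  copy alone, so that the second copy can be integrated out separately; it contributes the main
  factor.  The first copy enters only through \<open>1 - cos h\<close>, which is of order \<open>h\<^sup>2\<close>, and a crude bound on
  its contribution is enough.
\<close>
lemma small_rotation_bound:
  assumes s: "0 \<le> s" and y: "\<bar>s * \<beta> * (1 - cos h)\<bar> \<le> 1"
  shows "(\<integral>\<^sup>+w. ennreal (exp (s * (log_sum_exp \<beta> I (\<lambda>i. X i (fst w)) -
            log_sum_exp \<beta> I (\<lambda>i. cos h * X i (fst w) + sin h * X i (snd w))))) \<partial>(P \<Otimes>\<^sub>M P))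
     \<le> ennreal ((1 + \<bar>s * \<beta> * (1 - cos h)\<bar> * (2 * real (card I) * exp (V / 2))) * exp ((s * \<beta> * h)\<^sup>2 * V / 2))"
proof -
  note [measurable] = component_gaussian(2)[OF P I(1) X]
  define y where "y = s * \<beta> * (1 - cos h)"
  define K where "K = exp ((s * \<beta> * h)\<^sup>2 * V / 2)"
  define w where "w i \<omega> = exp (\<beta> * X i \<omega>) / (\<Sum>k\<in>I. exp (\<beta> * X k \<omega>))" for i \<omega>
  have Z: "0 < (\<Sum>k\<in>I. exp (\<beta> * X k \<omega>))" for \<omega> using I by (intro sum_pos) auto
  have w0: "0 \<le> w i \<omega>" for i \<omega> using Z[of \<omega>] by (simp add: w_def)
  have w1: "(\<Sum>i\<in>I. w i \<omega>) = 1" for \<omega>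
    using Z[of \<omega>] by (simp add: w_def sum_divide_distrib[symmetric])
  have wle: "w i \<omega> \<le> 1" if "i \<in> I" for i \<omega>
    using member_le_sum[OF that, of "\<lambda>i. w i \<omega>"] w0 w1 I by simp
  have mw[measurable]: "i \<in> I \<Longrightarrow> w i \<in> borel_measurable P" for i unfolding w_def by measurable
  have "(\<integral>\<^sup>+w. ennreal (exp (s * (log_sum_exp \<beta> I (\<lambda>i. X i (fst w)) -
            log_sum_exp \<beta> I (\<lambda>i. cos h * X i (fst w) + sin h * X i (snd w))))) \<partial>(P \<Otimes>\<^sub>M P))
     \<le> (\<integral>\<^sup>+p. (\<Sum>i\<in>I. ennreal (w i (fst p) * exp (y * X i (fst p))) * ennreal (exp ((- (s * \<beta> * sin h)) * X i (snd p)))) \<partial>(P \<Otimes>\<^sub>M P))"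
  proof (rule nn_integral_mono)
    fix p
    have e: "exp (s * \<beta> * (X i (fst p) - (cos h * X i (fst p) + sin h * X i (snd p))))
       = exp (y * X i (fst p)) * exp ((- (s * \<beta> * sin h)) * X i (snd p))" for i
      unfolding y_def exp_add[symmetric] by (rule arg_cong[where f=exp]) (simp add: algebra_simps)
    have "exp (s * (log_sum_exp \<beta> I (\<lambda>i. X i (fst p)) -
            log_sum_exp \<beta> I (\<lambda>i. cos h * X i (fst p) + sin h * X i (snd p))))
       \<le> (\<Sum>i\<in>I. (w i (fst p) * exp (y * X i (fst p))) * exp ((- (s * \<beta> * sin h)) * X i (snd p)))"
      using exp_log_sum_exp_diff_le[OF I s, of \<beta> "\<lambda>i. X i (fst p)" "\<lambda>i. cos h * X i (fst p) + sin h * X i (snd p)"]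
      unfolding e by (simp add: w_def mult.assoc)
    then show "ennreal (exp (s * (log_sum_exp \<beta> I (\<lambda>i. X i (fst p)) -
            log_sum_exp \<beta> I (\<lambda>i. cos h * X i (fst p) + sin h * X i (snd p)))))
       \<le> (\<Sum>i\<in>I. ennreal (w i (fst p) * exp (y * X i (fst p))) * ennreal (exp ((- (s * \<beta> * sin h)) * X i (snd p))))"
      using w0 by (simp add: ennreal_mult[symmetric] sum_nonneg ennreal_leI del: exp_minus mult_minus_left)
  qed
  also have "\<dots> = (\<Sum>i\<in>I. (\<integral>\<^sup>+\<omega>. ennreal (w i \<omega> * exp (y * X i \<omega>)) \<partial>P) * (\<integral>\<^sup>+\<omega>. ennreal (exp ((- (s * \<beta> * sin h)) * X i \<omega>)) \<partial>P))"
  proof (subst nn_integral_sum)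
    show "(\<Sum>i\<in>I. \<integral>\<^sup>+p. ennreal (w i (fst p) * exp (y * X i (fst p))) * ennreal (exp ((- (s * \<beta> * sin h)) * X i (snd p))) \<partial>(P \<Otimes>\<^sub>M P))
       = (\<Sum>i\<in>I. (\<integral>\<^sup>+\<omega>. ennreal (w i \<omega> * exp (y * X i \<omega>)) \<partial>P) * (\<integral>\<^sup>+\<omega>. ennreal (exp ((- (s * \<beta> * sin h)) * X i \<omega>)) \<partial>P))"
    proof (rule sum.cong[OF refl])
      fix i assume [simp]: "i \<in> I"
      show "(\<integral>\<^sup>+p. ennreal (w i (fst p) * exp (y * X i (fst p))) * ennreal (exp ((- (s * \<beta> * sin h)) * X i (snd p))) \<partial>(P \<Otimes>\<^sub>M P))
       = (\<integral>\<^sup>+\<omega>. ennreal (w i \<omega> * exp (y * X i \<omega>)) \<partial>P) * (\<integral>\<^sup>+\<omega>. ennreal (exp ((- (s * \<beta> * sin h)) * X i \<omega>)) \<partial>P)"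
        by (subst P.nn_integral_fst[symmetric]) (auto simp: nn_integral_cmult nn_integral_multc)
    qed
  qed auto
  also have "\<dots> \<le> (\<Sum>i\<in>I. (\<integral>\<^sup>+\<omega>. ennreal (w i \<omega> * exp (y * X i \<omega>)) \<partial>P) * ennreal K)"
  proof (rule sum_mono, rule mult_left_mono)
    fix i assume i: "i \<in> I"
    have "\<bar>sin h\<bar> \<le> \<bar>h\<bar>" by (rule abs_sin_x_le_abs_x)
    then have "(- (s * \<beta> * sin h))\<^sup>2 \<le> (s * \<beta> * h)\<^sup>2"
      by (simp add: power_mult_distrib mult_left_mono abs_le_square_iff)
    then show "(\<integral>\<^sup>+\<omega>. ennreal (exp ((- (s * \<beta> * sin h)) * X i \<omega>)) \<partial>P) \<le> ennreal K"
      unfolding K_def by (rule exp_component_bound[OF i])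
  qed simp
  also have "\<dots> = (\<integral>\<^sup>+\<omega>. (\<Sum>i\<in>I. ennreal (w i \<omega> * exp (y * X i \<omega>))) \<partial>P) * ennreal K"
    by (subst nn_integral_sum) (auto simp: sum_distrib_right)
  also have "\<dots> \<le> (\<integral>\<^sup>+\<omega>. 1 + (\<Sum>i\<in>I. ennreal \<bar>y\<bar> * (ennreal (exp (1 * X i \<omega>)) + ennreal (exp ((- 1) * X i \<omega>)))) \<partial>P) * ennreal K"
  proof (rule mult_right_mono, rule nn_integral_mono)
    fix \<omega>
    have "(\<Sum>i\<in>I. w i \<omega> * exp (y * X i \<omega>)) \<le> (\<Sum>i\<in>I. w i \<omega> + \<bar>y\<bar> * (exp (X i \<omega>) + exp (- X i \<omega>)))"
    proof (rule sum_mono)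
      fix i assume i: "i \<in> I"
      have "w i \<omega> * exp (y * X i \<omega>) \<le> w i \<omega> * (1 + \<bar>y\<bar> * (exp (X i \<omega>) + exp (- X i \<omega>)))"
        using y w0 by (intro mult_left_mono exp_mult_le) (auto simp: y_def)
      also have "\<dots> \<le> w i \<omega> + 1 * (\<bar>y\<bar> * (exp (X i \<omega>) + exp (- X i \<omega>)))"
        unfolding distrib_left[of "w i \<omega>"] mult_1_right using wle[OF i, of \<omega>]
        by (intro add_left_mono mult_right_mono) auto
      finally show "w i \<omega> * exp (y * X i \<omega>) \<le> w i \<omega> + \<bar>y\<bar> * (exp (X i \<omega>) + exp (- X i \<omega>))" by simp
    qed
    also have "\<dots> = 1 + (\<Sum>i\<in>I. \<bar>y\<bar> * (exp (X i \<omega>) + exp (- X i \<omega>)))"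
      by (simp add: sum.distrib w1)
    finally have "ennreal (\<Sum>i\<in>I. w i \<omega> * exp (y * X i \<omega>)) \<le> ennreal (1 + (\<Sum>i\<in>I. \<bar>y\<bar> * (exp (X i \<omega>) + exp (- X i \<omega>))))"
      by (rule ennreal_leI)
    then show "(\<Sum>i\<in>I. ennreal (w i \<omega> * exp (y * X i \<omega>))) \<le> 1 + (\<Sum>i\<in>I. ennreal \<bar>y\<bar> * (ennreal (exp (1 * X i \<omega>)) + ennreal (exp ((- 1) * X i \<omega>))))"
      using w0 by (simp add: sum_nonneg ennreal_mult[symmetric] ennreal_plus[symmetric] ennreal_1[symmetric] del: ennreal_plus ennreal_1)
  qed simp
  also have "\<dots> = (1 + (\<Sum>i\<in>I. ennreal \<bar>y\<bar> * ((\<integral>\<^sup>+\<omega>. ennreal (exp (1 * X i \<omega>)) \<partial>P) + (\<integral>\<^sup>+\<omega>. ennreal (exp ((- 1) * X i \<omega>)) \<partial>P)))) * ennreal K"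
    by (subst nn_integral_add)
      (auto simp: nn_integral_sum nn_integral_add nn_integral_cmult P.emeasure_space_1 intro!: sum.cong borel_measurable_sum)
  also have "\<dots> \<le> (1 + (\<Sum>i\<in>I. ennreal \<bar>y\<bar> * (ennreal (exp (1 * V / 2)) + ennreal (exp (1 * V / 2))))) * ennreal K"
    by (intro mult_right_mono add_left_mono sum_mono mult_left_mono add_mono exp_component_bound) auto
  also have "\<dots> = ennreal ((1 + \<bar>y\<bar> * (2 * real (card I) * exp (V / 2))) * K)"
    by (simp add: K_def ennreal_mult[symmetric] ennreal_plus[symmetric] ennreal_1[symmetric] ennreal_of_nat_eq_real_of_nat
        algebra_simps del: ennreal_plus ennreal_1)
  finally show ?thesis by (simp add: y_def K_def)
qed

text \<open>
  Gaussian concentration in decoupled form, with a constant that does not depend on the number of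
  components.  The path from one copy to the other is cut into \<open>m\<close> rotations by \<open>\<pi>/(2m)\<close>, and Jensen's
  inequality for the exponential reduces the total increment to the average over the single steps, each
  magnified by \<open>m\<close>.  All steps have the law of the first one.  The second-order errors are \<open>O(1/m)\<close> and vanish
  in the limit; this is a discrete form of the Maurey--Pisier argument.
\<close>
lemma log_sum_exp_decoupled_bound:
  "(\<integral>\<^sup>+w. ennreal (exp (l * (log_sum_exp \<beta> I (\<lambda>i. X i (fst w)) - log_sum_exp \<beta> I (\<lambda>i. X i (snd w))))) \<partial>(P \<Otimes>\<^sub>M P))
     \<le> ennreal (exp (l\<^sup>2 * pi\<^sup>2 * \<beta>\<^sup>2 * V / 8))" (is "?L \<le> ennreal ?K")
proof -
  note [measurable] = component_gaussian(2)[OF P I(1) X]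
  define h where "h m = pi / (2 * real m)" for m :: nat
  define y where "y m = l * real m * \<beta> * (1 - cos (h m))" for m
  define c where "c = \<bar>l * \<beta>\<bar> * pi\<^sup>2 / 8"
  have y: "\<bar>y m\<bar> \<le> c / real m" if "0 < m" for m
  proof -
    have "\<bar>y m\<bar> = \<bar>l * \<beta>\<bar> * real m * (1 - cos (h m))"
      using cos_le_one[of "h m"] by (simp add: y_def abs_mult)
    also have "\<dots> \<le> \<bar>l * \<beta>\<bar> * real m * ((h m)\<^sup>2 / 2)"
      by (intro mult_left_mono one_minus_cos_le) auto
    also have "\<dots> = c / real m" using that by (simp add: h_def c_def power2_eq_square)
    finally show ?thesis .
  qed
  have y0: "y \<longlonglongrightarrow> 0"
  proof (rule tendsto_0_le[where K=1])
    show "(\<lambda>m. c / real m) \<longlonglongrightarrow> 0" by (rule lim_const_over_n)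
    show "\<forall>\<^sub>F m in sequentially. norm (y m) \<le> norm (c / real m) * 1"
      using eventually_gt_at_top[of 0] by eventually_elim (use y in \<open>auto simp: c_def\<close>)
  qed
  let ?J = "UNIV \<times> I :: (bool \<times> 'i) set"
  have step: "?L \<le> ennreal ((1 + \<bar>y m\<bar> * (2 * real (card I) * exp (V / 2))) * ?K)" if m: "0 < m" and ym: "\<bar>y m\<bar> \<le> 1" for m
  proof -
    define s where "s = l * real m"
    have s: "0 \<le> s" using l by (simp add: s_def)
    define F where "F = (\<lambda>k w. log_sum_exp \<beta> I (\<lambda>i. rotated_copies X (real k * h m) (False, i) w))"
    define G :: "(bool \<times> 'i \<Rightarrow> real) \<Rightarrow> ennreal" where
      "G = (\<lambda>x. ennreal (exp (s * (log_sum_exp \<beta> I (\<lambda>i. x (False, i)) -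
          log_sum_exp \<beta> I (\<lambda>i. cos (h m) * x (False, i) + sin (h m) * x (True, i))))))"
    have G[measurable]: "G \<in> borel_measurable (PiM ?J (\<lambda>_. borel))"
      unfolding G_def log_sum_exp_def
      by (intro measurable_compose[OF _ measurable_ennreal] borel_measurable_exp borel_measurable_times
          borel_measurable_diff borel_measurable_ln borel_measurable_sum borel_measurable_const borel_measurable_add
          borel_measurable_exp measurable_component_singleton) auto
    have GF: "G (\<lambda>j\<in>?J. rotated_copies X (real k * h m) j w) = ennreal (exp (s * (F k w - F (Suc k) w)))" for k w
    proof -
      have "cos (h m) * rotated_copies X (real k * h m) (False, i) w + sin (h m) * rotated_copies X (real k * h m) (True, i) w
          = rotated_copies X (real (Suc k) * h m) (False, i) w" for i
      proof -
        have "real (Suc k) * h m = real k * h m + h m" by (simp add: algebra_simps)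
        then show ?thesis by (simp only:) (simp add: rotated_copies_def cos_add sin_add algebra_simps)
      qed
      then show ?thesis unfolding G_def F_def log_sum_exp_def by (simp cong: sum.cong)
    qed
    have F_end: "F 0 w = log_sum_exp \<beta> I (\<lambda>i. X i (fst w))" "F m w = log_sum_exp \<beta> I (\<lambda>i. X i (snd w))" for w
      using m by (simp_all add: F_def rotated_copies_def h_def)
    have mF[measurable]: "F k \<in> borel_measurable (P \<Otimes>\<^sub>M P)" for k
      unfolding F_def log_sum_exp_def rotated_copies_def by measurable
    have same_law: "(\<integral>\<^sup>+w. ennreal (exp (s * (F k w - F (Suc k) w))) \<partial>(P \<Otimes>\<^sub>M P))
        = (\<integral>\<^sup>+w. G (\<lambda>j\<in>?J. rotated_copies X 0 j w) \<partial>(P \<Otimes>\<^sub>M P))" for k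
      using nn_integral_rotated_copies[OF P I(1) X G, of "real k * h m"] by (simp only: GF)
    have "?L \<le> (\<integral>\<^sup>+w. (\<Sum>k<m. ennreal (1 / real m) * ennreal (exp (s * (F k w - F (Suc k) w)))) \<partial>(P \<Otimes>\<^sub>M P))"
    proof (rule nn_integral_mono)
      fix w
      have "l * (F 0 w - F m w) = (\<Sum>k<m. (1 / real m) * (s * (F k w - F (Suc k) w)))"
        using m sum_lessThan_telescope'[of "\<lambda>k. F k w" m]
        by (simp add: sum_distrib_left[symmetric] s_def)
      also have "exp \<dots> \<le> (\<Sum>k<m. (1 / real m) * exp (s * (F k w - F (Suc k) w)))"
        using m by (intro exp_weighted_mean_le) auto
      finally have "ennreal (exp (l * (F 0 w - F m w))) \<le> ennreal (\<Sum>k<m. (1 / real m) * exp (s * (F k w - F (Suc k) w)))"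
        by (rule ennreal_leI)
      also have "\<dots> = (\<Sum>k<m. ennreal (1 / real m) * ennreal (exp (s * (F k w - F (Suc k) w))))"
        by (subst sum_ennreal[symmetric]) (auto simp: ennreal_mult[symmetric])
      finally show "ennreal (exp (l * (log_sum_exp \<beta> I (\<lambda>i. X i (fst w)) - log_sum_exp \<beta> I (\<lambda>i. X i (snd w)))))
        \<le> (\<Sum>k<m. ennreal (1 / real m) * ennreal (exp (s * (F k w - F (Suc k) w))))"
        by (simp only: F_end)
    qed
    also have "\<dots> = (\<Sum>k<m. ennreal (1 / real m) * (\<integral>\<^sup>+w. ennreal (exp (s * (F k w - F (Suc k) w))) \<partial>(P \<Otimes>\<^sub>M P)))"
      by (subst nn_integral_sum) (auto simp: nn_integral_cmult)
    also have "\<dots> = (\<Sum>k<m. ennreal (1 / real m) * (\<integral>\<^sup>+w. ennreal (exp (s * (F 0 w - F (Suc 0) w))) \<partial>(P \<Otimes>\<^sub>M P)))"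
      by (simp only: same_law)
    also have "\<dots> = (\<integral>\<^sup>+w. ennreal (exp (s * (F 0 w - F (Suc 0) w))) \<partial>(P \<Otimes>\<^sub>M P))"
      using m by (simp add: mult.assoc[symmetric] ennreal_of_nat_eq_real_of_nat ennreal_mult[symmetric])
    also have "\<dots> \<le> ennreal ((1 + \<bar>s * \<beta> * (1 - cos (h m))\<bar> * (2 * real (card I) * exp (V / 2))) * exp ((s * \<beta> * h m)\<^sup>2 * V / 2))"
      using small_rotation_bound[OF s, of "h m"] ym
      by (simp add: F_def rotated_copies_def y_def s_def)
    also have "s * \<beta> * (1 - cos (h m)) = y m" by (simp add: y_def s_def)
    also have "(s * \<beta> * h m)\<^sup>2 * V / 2 = l\<^sup>2 * pi\<^sup>2 * \<beta>\<^sup>2 * V / 8"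
      using m by (simp add: s_def h_def power_mult_distrib power_divide)
    finally show ?thesis .
  qed
  have "(\<lambda>m. ennreal ((1 + \<bar>y m\<bar> * (2 * real (card I) * exp (V / 2))) * ?K)) \<longlonglongrightarrow> ennreal ((1 + \<bar>0\<bar> * (2 * real (card I) * exp (V / 2))) * ?K)"
    by (intro tendsto_ennrealI tendsto_intros y0)
  moreover have "eventually (\<lambda>m. \<bar>y m\<bar> < 1) sequentially"
    using order_tendstoD(2)[OF tendsto_rabs[OF y0], of 1] by simp
  then have "eventually (\<lambda>m. ?L \<le> ennreal ((1 + \<bar>y m\<bar> * (2 * real (card I) * exp (V / 2))) * ?K)) sequentially"
    using eventually_gt_at_top[of 0] by eventually_elim (auto intro: step)
  ultimately have "?L \<le> ennreal ((1 + \<bar>0\<bar> * (2 * real (card I) * exp (V / 2))) * ?K)"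
    by (rule tendsto_lowerbound) simp
  then show ?thesis by simp
qed

end

section \<open>Empirical approximation of the partition function\<close>

lemma (in prob_space) ex_le_expectation:
  fixes g :: "'a \<Rightarrow> real"
  assumes g: "integrable M g" and Q: "AE x in M. Q x"
  shows "\<exists>x\<in>space M. Q x \<and> g x \<le> expectation g"
proof (rule ccontr)
  assume neg: "\<not> ?thesis"
  have gt: "AE x in M. expectation g < g x"
    using Q AE_space by eventually_elim (use neg in force)
  have "expectation (\<lambda>x. g x - expectation g) = 0"
    using g by (simp add: prob_space)
  then have "AE x in M. g x - expectation g = 0"
    using gt g by (subst (asm) integral_nonneg_eq_0_iff_AE) auto
  then have "AE x in M. False" using gt by eventually_elim simp
  then show False by simp
qed

lemma (in pair_prob_space) integrable_snd_factor:
  fixes g :: "'b \<Rightarrow> real"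
  assumes g: "integrable M2 g"
  shows "integrable (M1 \<Otimes>\<^sub>M M2) (\<lambda>(x, y). g y)"
proof (rule integrableI_bounded)
  have [measurable]: "g \<in> borel_measurable M2" using g by auto
  show "(\<lambda>(x, y). g y) \<in> borel_measurable (M1 \<Otimes>\<^sub>M M2)" by measurable
  have "(\<integral>\<^sup>+w. ennreal (norm (case w of (x, y) \<Rightarrow> g y)) \<partial>(M1 \<Otimes>\<^sub>M M2)) = (\<integral>\<^sup>+x. (\<integral>\<^sup>+y. ennreal (norm (g y)) \<partial>M2) \<partial>M1)"
    by (subst M2.nn_integral_fst[symmetric]) auto
  also have "\<dots> < \<infinity>"
    using g by (simp add: integrable_iff_bounded M1.emeasure_space_1)
  finally show "(\<integral>\<^sup>+w. ennreal (norm (case w of (x, y) \<Rightarrow> g y)) \<partial>(M1 \<Otimes>\<^sub>M M2)) < \<infinity>" .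
qed

text \<open>
  If \<open>x\<close> is chosen at random, then \<open>d x y\<close> has mean \<open>0\<close> for almost every \<open>y\<close>, so \<open>d x\<close> is orthogonal to \<open>Y\<close>
  on average and the asserted inequality holds with equality in the mean.  Some \<open>x\<close> is at least as good as the mean.
\<close>
lemma (in pair_prob_space) ex_section_small_increment:
  fixes d :: "'a \<Rightarrow> 'b \<Rightarrow> real" and Y :: "'b \<Rightarrow> real"
  assumes d[measurable]: "(\<lambda>(x, y). d x y) \<in> borel_measurable (M1 \<Otimes>\<^sub>M M2)"
    and d2: "integrable (M1 \<Otimes>\<^sub>M M2) (\<lambda>(x, y). (d x y)\<^sup>2)"
    and d0: "AE y in M2. (\<integral>x. d x y \<partial>M1) = 0"
    and Q: "AE x in M1. Q x"
    and Y[measurable]: "Y \<in> borel_measurable M2" and Y2: "integrable M2 (\<lambda>y. (Y y)\<^sup>2)"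
  shows "\<exists>x\<in>space M1. Q x \<and> integrable M2 (\<lambda>y. (d x y)\<^sup>2) \<and>
    (\<integral>y. (Y y + d x y)\<^sup>2 \<partial>M2) \<le> (\<integral>y. (Y y)\<^sup>2 \<partial>M2) + (\<integral>(x, y). (d x y)\<^sup>2 \<partial>(M1 \<Otimes>\<^sub>M M2))"
proof -
  have iY: "integrable (M1 \<Otimes>\<^sub>M M2) (\<lambda>(x, y). (Y y)\<^sup>2)"
    by (rule integrable_snd_factor[OF Y2])
  have iYd: "integrable (M1 \<Otimes>\<^sub>M M2) (\<lambda>(x, y). Y y * d x y)"
  proof (rule Bochner_Integration.integrable_bound[OF Bochner_Integration.integrable_add[OF iY d2]])
    show "AE z in M1 \<Otimes>\<^sub>M M2. norm (case z of (x, y) \<Rightarrow> Y y * d x y)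
       \<le> norm ((case z of (x, y) \<Rightarrow> (Y y)\<^sup>2) + (case z of (x, y) \<Rightarrow> (d x y)\<^sup>2))"
    proof (rule AE_I2, clarsimp)
      fix x y
      have "2 * (\<bar>Y y\<bar> * \<bar>d x y\<bar>) \<le> (Y y)\<^sup>2 + (d x y)\<^sup>2"
        using sum_squares_bound[of "\<bar>Y y\<bar>" "\<bar>d x y\<bar>"] by (simp add: mult.assoc)
      moreover have "0 \<le> \<bar>Y y\<bar> * \<bar>d x y\<bar>" by simp
      ultimately show "\<bar>Y y * d x y\<bar> \<le> (Y y)\<^sup>2 + (d x y)\<^sup>2" unfolding abs_mult by linarith
    qed
  qed measurable
  have expand: "(Y y + d x y)\<^sup>2 = (Y y)\<^sup>2 + 2 * (Y y * d x y) + (d x y)\<^sup>2" for x y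
    by (simp add: power2_sum)
  have ig: "integrable (M1 \<Otimes>\<^sub>M M2) (\<lambda>(x, y). (Y y + d x y)\<^sup>2)"
  proof -
    have "integrable (M1 \<Otimes>\<^sub>M M2) (\<lambda>z. (case z of (x, y) \<Rightarrow> (Y y)\<^sup>2) + 2 * (case z of (x, y) \<Rightarrow> Y y * d x y) + (case z of (x, y) \<Rightarrow> (d x y)\<^sup>2))"
      by (intro Bochner_Integration.integrable_add integrable_mult_right iY iYd d2)
    then show ?thesis unfolding expand by (simp add: case_prod_beta')
  qed
  have zero: "(\<integral>(x, y). Y y * d x y \<partial>(M1 \<Otimes>\<^sub>M M2)) = 0"
  proof -
    have "(\<integral>(x, y). Y y * d x y \<partial>(M1 \<Otimes>\<^sub>M M2)) = (\<integral>y. (\<integral>x. Y y * d x y \<partial>M1) \<partial>M2)"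
      by (rule integral_snd[symmetric, OF iYd])
    also have "\<dots> = (\<integral>y. 0 \<partial>M2)"
    proof (rule integral_cong_AE)
      show "AE y in M2. (\<integral>x. Y y * d x y \<partial>M1) = 0" using d0 by eventually_elim simp
    qed measurable
    finally show ?thesis by simp
  qed
  have "(\<integral>(x, y). (Y y)\<^sup>2 \<partial>(M1 \<Otimes>\<^sub>M M2)) = (\<integral>y. (Y y)\<^sup>2 \<partial>M2)"
    using integral_snd[OF iY] by (simp add: M1.prob_space)
  moreover have "(\<integral>(x, y). (Y y + d x y)\<^sup>2 \<partial>(M1 \<Otimes>\<^sub>M M2))
      = (\<integral>(x, y). (Y y)\<^sup>2 \<partial>(M1 \<Otimes>\<^sub>M M2)) + 2 * (\<integral>(x, y). Y y * d x y \<partial>(M1 \<Otimes>\<^sub>M M2)) + (\<integral>(x, y). (d x y)\<^sup>2 \<partial>(M1 \<Otimes>\<^sub>M M2))"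
  proof -
    have "(\<integral>z. (case z of (x, y) \<Rightarrow> (Y y)\<^sup>2) + 2 * (case z of (x, y) \<Rightarrow> Y y * d x y) + (case z of (x, y) \<Rightarrow> (d x y)\<^sup>2) \<partial>(M1 \<Otimes>\<^sub>M M2))
       = (\<integral>(x, y). (Y y)\<^sup>2 \<partial>(M1 \<Otimes>\<^sub>M M2)) + 2 * (\<integral>(x, y). Y y * d x y \<partial>(M1 \<Otimes>\<^sub>M M2)) + (\<integral>(x, y). (d x y)\<^sup>2 \<partial>(M1 \<Otimes>\<^sub>M M2))"
      using iY iYd d2 by (subst Bochner_Integration.integral_add Bochner_Integration.integral_add; simp)+
    then show ?thesis unfolding expand by (simp add: case_prod_beta')
  qed
  ultimately have "(\<integral>x. (\<integral>y. (Y y + d x y)\<^sup>2 \<partial>M2) \<partial>M1)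
      = (\<integral>y. (Y y)\<^sup>2 \<partial>M2) + (\<integral>(x, y). (d x y)\<^sup>2 \<partial>(M1 \<Otimes>\<^sub>M M2))"
    using integral_fst[OF ig] zero by simp
  moreover have "AE x in M1. Q x \<and> integrable M2 (\<lambda>y. (d x y)\<^sup>2)"
    using Q AE_integrable_fst[OF d2] by eventually_elim simp
  ultimately show ?thesis
    using M1.ex_le_expectation[OF integrable_fst[OF ig], of "\<lambda>x. Q x \<and> integrable M2 (\<lambda>y. (d x y)\<^sup>2)"] by auto
qed

text \<open>
  Maurey's empirical method.  The points are chosen one by one with the previous lemma, the current
  partial sum in place of \<open>Y\<close>; its squared norm then grows at most linearly, as for a sum of independent
  centered variables.
\<close>
lemma (in pair_prob_space) ex_sampling_sequence:
  fixes d :: "'a \<Rightarrow> 'b \<Rightarrow> real"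
  assumes d[measurable]: "(\<lambda>(x, y). d x y) \<in> borel_measurable (M1 \<Otimes>\<^sub>M M2)"
    and d2: "integrable (M1 \<Otimes>\<^sub>M M2) (\<lambda>(x, y). (d x y)\<^sup>2)"
    and d0: "AE y in M2. (\<integral>x. d x y \<partial>M1) = 0"
    and Q: "AE x in M1. Q x"
  obtains \<tau> :: "nat \<Rightarrow> 'a" where "\<And>i. \<tau> i \<in> space M1" "\<And>i. Q (\<tau> i)"
    "\<And>n. integrable M2 (\<lambda>y. (\<Sum>i<n. d (\<tau> i) y)\<^sup>2)"
    "\<And>n. (\<integral>y. (\<Sum>i<n. d (\<tau> i) y)\<^sup>2 \<partial>M2) \<le> real n * (\<integral>(x, y). (d x y)\<^sup>2 \<partial>(M1 \<Otimes>\<^sub>M M2))"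
proof -
  define C where "C = (\<integral>(x, y). (d x y)\<^sup>2 \<partial>(M1 \<Otimes>\<^sub>M M2))"
  define ok where "ok Y x \<longleftrightarrow> x \<in> space M1 \<and> Q x \<and> integrable M2 (\<lambda>y. (d x y)\<^sup>2) \<and>
    (\<integral>y. (Y y + d x y)\<^sup>2 \<partial>M2) \<le> (\<integral>y. (Y y)\<^sup>2 \<partial>M2) + C" for Y x
  define pick where "pick Y = (SOME x. ok Y x)" for Y
  have pick: "ok Y (pick Y)" if "Y \<in> borel_measurable M2" "integrable M2 (\<lambda>y. (Y y)\<^sup>2)" for Y
    unfolding pick_def
    by (rule someI_ex) (use ex_section_small_increment[OF d d2 d0 Q that] in \<open>auto simp: ok_def C_def\<close>)
  define S where "S = rec_nat (\<lambda>_. 0::real) (\<lambda>_ Y y. Y y + d (pick Y) y)"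
  define \<tau> where "\<tau> n = pick (S n)" for n
  have S_simps: "S 0 = (\<lambda>_. 0)" "S (Suc n) = (\<lambda>y. S n y + d (\<tau> n) y)" for n
    by (simp_all add: S_def \<tau>_def)
  have S: "S n \<in> borel_measurable M2 \<and> integrable M2 (\<lambda>y. (S n y)\<^sup>2) \<and> (\<integral>y. (S n y)\<^sup>2 \<partial>M2) \<le> real n * C" for n
  proof (induction n)
    case 0
    then show ?case by (simp add: S_simps)
  next
    case (Suc n)
    then have *: "ok (S n) (\<tau> n)" unfolding \<tau>_def by (intro pick) auto
    have [measurable]: "S n \<in> borel_measurable M2" using Suc by simp
    have md[measurable]: "d (\<tau> n) \<in> borel_measurable M2"
      using measurable_Pair2[OF d, of "\<tau> n"] * by (simp add: ok_def)
    have "integrable M2 (\<lambda>y. (S (Suc n) y)\<^sup>2)"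
    proof (rule Bochner_Integration.integrable_bound)
      show "integrable M2 (\<lambda>y. 2 * (S n y)\<^sup>2 + 2 * (d (\<tau> n) y)\<^sup>2)" using Suc * by (auto simp: ok_def)
      have "(a + b)\<^sup>2 \<le> 2 * a\<^sup>2 + 2 * b\<^sup>2" for a b :: real
        using zero_le_power2[of "a - b"] by (simp add: power2_eq_square algebra_simps)
      then show "AE y in M2. norm ((S (Suc n) y)\<^sup>2) \<le> norm (2 * (S n y)\<^sup>2 + 2 * (d (\<tau> n) y)\<^sup>2)"
        by (simp add: S_simps)
    qed (simp add: S_simps)
    moreover have "(\<integral>y. (S (Suc n) y)\<^sup>2 \<partial>M2) \<le> real (Suc n) * C"
      using * Suc by (simp add: ok_def S_simps algebra_simps)
    ultimately show ?case by (simp add: S_simps)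
  qed
  have S_sum: "S n y = (\<Sum>i<n. d (\<tau> i) y)" for n y by (induction n) (simp_all add: S_simps)
  have "ok (S n) (\<tau> n)" for n unfolding \<tau>_def using S by (intro pick) auto
  then show ?thesis
    using S by (intro that[of \<tau>]) (auto simp: S_sum ok_def C_def)
qed

lemma (in pair_prob_space) AE_snd_of_factor:
  assumes "AE y in M2. Q y" shows "AE w in M1 \<Otimes>\<^sub>M M2. Q (snd w)"
proof -
  obtain N where N: "{y\<in>space M2. \<not> Q y} \<subseteq> N" "emeasure M2 N = 0" "N \<in> sets M2"
    using AE_E[OF assms] by blast
  show ?thesis
  proof (rule AE_I)
    show "{w \<in> space (M1 \<Otimes>\<^sub>M M2). \<not> Q (snd w)} \<subseteq> space M1 \<times> N"
      using N(1) by (auto simp: space_pair_measure)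
    show "emeasure (M1 \<Otimes>\<^sub>M M2) (space M1 \<times> N) = 0" "space M1 \<times> N \<in> sets (M1 \<Otimes>\<^sub>M M2)"
      using N by (simp_all add: M2.emeasure_pair_measure_Times)
  qed
qed

lemma (in pair_prob_space) AE_fst_of_factor:
  assumes "AE x in M1. Q x" shows "AE w in M1 \<Otimes>\<^sub>M M2. Q (fst w)"
proof -
  obtain N where N: "{y\<in>space M1. \<not> Q y} \<subseteq> N" "emeasure M1 N = 0" "N \<in> sets M1"
    using AE_E[OF assms] by blast
  show ?thesis
  proof (rule AE_I)
    show "{w \<in> space (M1 \<Otimes>\<^sub>M M2). \<not> Q (fst w)} \<subseteq> N \<times> space M2"
      using N(1) by (auto simp: space_pair_measure)
    show "emeasure (M1 \<Otimes>\<^sub>M M2) (N \<times> space M2) = 0" "N \<times> space M2 \<in> sets (M1 \<Otimes>\<^sub>M M2)"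
      using N by (simp_all add: M2.emeasure_pair_measure_Times)
  qed
qed

lemma (in pair_prob_space) AE_pair_swapped:
  assumes "AE w in M1 \<Otimes>\<^sub>M M2. Q (fst w) (snd w)"
  shows "AE y in M2. AE x in M1. Q x y"
proof -
  interpret S: pair_prob_space M2 M1 ..
  have "AE w in distr (M2 \<Otimes>\<^sub>M M1) (M1 \<Otimes>\<^sub>M M2) (\<lambda>(x, y). (y, x)). Q (fst w) (snd w)"
    using assms by (subst (asm) distr_pair_swap)
  then have "AE w in M2 \<Otimes>\<^sub>M M1. Q (fst (case w of (x, y) \<Rightarrow> (y, x))) (snd (case w of (x, y) \<Rightarrow> (y, x)))"
    by (rule AE_distrD[rotated]) measurable
  then have "AE w in M2 \<Otimes>\<^sub>M M1. Q (snd w) (fst w)" by (simp add: case_prod_beta')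
  from S.AE_pair[OF this] show ?thesis by simp
qed

text \<open>
  One system of fixed size.  Integrals in both orders are computed with \<open>H'\<close>, a jointly measurable
  version of the field \<open>H\<close>; the Gaussian hypotheses concern \<open>H\<close> itself.
\<close>
locale gaussian_model =
  fixes M :: "'a measure" and P :: "'b measure" and H H' :: "'a \<Rightarrow> 'b \<Rightarrow> real" and V :: real
  assumes prob_M: "prob_space M" and prob_P: "prob_space P"
    and gaussian: "centered_gaussian_field P (space M) H"
    and variance_le: "\<And>\<sigma>. \<sigma> \<in> space M \<Longrightarrow> field_variance P H \<sigma> \<le> V"
    and version_measurable[measurable]: "(\<lambda>(\<sigma>, \<omega>). H' \<sigma> \<omega>) \<in> borel_measurable (M \<Otimes>\<^sub>M P)"
    and version: "AE w in M \<Otimes>\<^sub>M P. H (fst w) (snd w) = H' (fst w) (snd w)"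

sublocale gaussian_model \<subseteq> MP: pair_prob_space M P
proof -
  interpret M: prob_space M by (rule prob_M)
  interpret P: prob_space P by (rule prob_P)
  show "pair_prob_space M P" ..
qed

sublocale gaussian_model \<subseteq> PP: pair_prob_space P P ..

context gaussian_model
begin

text \<open>
  The partition function computed from the version \<open>H'\<close>, which makes it measurable in the disorder.
\<close>
definition Z :: "real \<Rightarrow> 'b \<Rightarrow> real" where
  "Z \<beta> \<omega> = (\<integral>\<sigma>. exp (\<beta> * H' \<sigma> \<omega>) \<partial>M)"

lemma Z_measurable[measurable]: "Z \<beta> \<in> borel_measurable P"
  unfolding Z_def by measurable

lemma version_fst: "AE \<sigma> in M. AE \<omega> in P. H \<sigma> \<omega> = H' \<sigma> \<omega>"
  using MP.AE_pair[OF version] by simp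

lemma version_snd: "AE \<omega> in P. AE \<sigma> in M. H \<sigma> \<omega> = H' \<sigma> \<omega>"
  by (rule MP.AE_pair_swapped[OF version])

lemma combination_gaussian:
  fixes \<tau> :: "'i \<Rightarrow> 'a"
  assumes I: "finite I" and \<tau>: "\<And>i. i \<in> I \<Longrightarrow> \<tau> i \<in> space M"
  shows "centered_gaussian P (\<lambda>\<omega>. \<Sum>i\<in>I. c i * H (\<tau> i) \<omega>)"
proof -
  \<comment> \<open>Points may be repeated in \<open>\<tau>\<close>, so the coefficients of equal points are collected.\<close>
  have "centered_gaussian P (\<lambda>\<omega>. \<Sum>\<sigma>\<in>\<tau> ` I. (\<Sum>i\<in>{i\<in>I. \<tau> i = \<sigma>}. c i) * H \<sigma> \<omega>)"
    by (rule gaussian[unfolded centered_gaussian_field_def, rule_format]) (use I \<tau> in auto)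
  also have "(\<lambda>\<omega>. \<Sum>\<sigma>\<in>\<tau> ` I. (\<Sum>i\<in>{i\<in>I. \<tau> i = \<sigma>}. c i) * H \<sigma> \<omega>) = (\<lambda>\<omega>. \<Sum>i\<in>I. c i * H (\<tau> i) \<omega>)"
  proof
    fix \<omega>
    have "(\<Sum>\<sigma>\<in>\<tau> ` I. (\<Sum>i\<in>{i\<in>I. \<tau> i = \<sigma>}. c i) * H \<sigma> \<omega>) = (\<Sum>\<sigma>\<in>\<tau> ` I. \<Sum>i\<in>{i\<in>I. \<tau> i = \<sigma>}. c i * H (\<tau> i) \<omega>)"
      unfolding sum_distrib_right by (intro sum.cong) auto
    also have "\<dots> = (\<Sum>i\<in>I. c i * H (\<tau> i) \<omega>)"
      using I by (intro sum.group) auto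
    finally show "(\<Sum>\<sigma>\<in>\<tau> ` I. (\<Sum>i\<in>{i\<in>I. \<tau> i = \<sigma>}. c i) * H \<sigma> \<omega>) = (\<Sum>i\<in>I. c i * H (\<tau> i) \<omega>)" .
  qed
  finally show ?thesis .
qed

lemma H_gaussian: "\<sigma> \<in> space M \<Longrightarrow> centered_gaussian P (H \<sigma>)"
  using combination_gaussian[of "{()}" "\<lambda>_. \<sigma>" "\<lambda>_. 1"] by simp

lemma exp_H: "\<sigma> \<in> space M \<Longrightarrow>
    (\<integral>\<^sup>+\<omega>. ennreal (exp (t * H \<sigma> \<omega>)) \<partial>P) = ennreal (exp (t\<^sup>2 * field_variance P H \<sigma> / 2))"
  using centered_gaussian_transforms(3)[OF prob_P H_gaussian] by (simp add: field_variance_def)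

lemma nn_integral_exp_le:
  "(\<integral>\<^sup>+w. ennreal (exp (t * H' (fst w) (snd w))) \<partial>(M \<Otimes>\<^sub>M P)) \<le> ennreal (exp (t\<^sup>2 * V / 2))"
proof -
  have "(\<integral>\<^sup>+w. ennreal (exp (t * H' (fst w) (snd w))) \<partial>(M \<Otimes>\<^sub>M P)) = (\<integral>\<^sup>+\<sigma>. (\<integral>\<^sup>+\<omega>. ennreal (exp (t * H' \<sigma> \<omega>)) \<partial>P) \<partial>M)"
    by (subst MP.M2.nn_integral_fst[symmetric]) (auto simp: case_prod_beta'[symmetric])
  also have "\<dots> \<le> (\<integral>\<^sup>+\<sigma>. ennreal (exp (t\<^sup>2 * V / 2)) \<partial>M)"
  proof (rule nn_integral_mono_AE)
    show "AE \<sigma> in M. (\<integral>\<^sup>+\<omega>. ennreal (exp (t * H' \<sigma> \<omega>)) \<partial>P) \<le> ennreal (exp (t\<^sup>2 * V / 2))"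
      using version_fst AE_space
    proof eventually_elim
      case (elim \<sigma>)
      have "(\<integral>\<^sup>+\<omega>. ennreal (exp (t * H' \<sigma> \<omega>)) \<partial>P) = (\<integral>\<^sup>+\<omega>. ennreal (exp (t * H \<sigma> \<omega>)) \<partial>P)"
        by (rule nn_integral_cong_AE) (use elim(1) in \<open>eventually_elim, simp\<close>)
      then show ?case using exp_H[OF elim(2)] variance_le[OF elim(2)]
        by (auto intro!: ennreal_leI mult_left_mono)
    qed
  qed
  finally show ?thesis by (simp add: MP.M1.emeasure_space_1)
qed

lemma exp_integrable: "integrable (M \<Otimes>\<^sub>M P) (\<lambda>(\<sigma>, \<omega>). exp (t * H' \<sigma> \<omega>))"
  using nn_integral_exp_le[of t]
  by (intro integrableI_bounded) (auto simp: case_prod_beta' intro: le_less_trans)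

lemma exp_integrable_section: "AE \<omega> in P. integrable M (\<lambda>\<sigma>. exp (t * H' \<sigma> \<omega>))"
  by (rule MP.AE_integrable_snd[OF exp_integrable])

lemma Z_pos: "AE \<omega> in P. 0 < Z \<beta> \<omega>"
  using exp_integrable_section[of \<beta>]
proof eventually_elim
  case (elim \<omega>)
  have "Z \<beta> \<omega> \<noteq> 0"
    unfolding Z_def using integral_nonneg_eq_0_iff_AE[OF elim] by (simp add: MP.M1.AE_False)
  moreover have "0 \<le> Z \<beta> \<omega>" unfolding Z_def by (intro integral_nonneg_AE) auto
  ultimately show ?case by simp
qed

lemma Z_square_le: "AE \<omega> in P. (Z \<beta> \<omega>)\<^sup>2 \<le> (\<integral>\<sigma>. (exp (\<beta> * H' \<sigma> \<omega>))\<^sup>2 \<partial>M)"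
  using exp_integrable_section[of \<beta>] exp_integrable_section[of "2 * \<beta>"]
proof eventually_elim
  case (elim \<omega>)
  have e: "(exp (\<beta> * x))\<^sup>2 = exp (2 * \<beta> * x)" for x :: real
    by (simp add: power2_eq_square exp_add[symmetric])
  have "integrable M (\<lambda>\<sigma>. (exp (\<beta> * H' \<sigma> \<omega>))\<^sup>2)" unfolding e by (rule elim)
  from MP.M1.variance_eq[OF elim(1) this] MP.M1.variance_positive[of "\<lambda>\<sigma>. exp (\<beta> * H' \<sigma> \<omega>)"]
  show ?case by (simp add: Z_def)
qed

text \<open>
  The partition function is an average of exponentials over \<open>M\<close> and so a limit of averages over finitely
  many points.  This reduces concentration for the whole field to the finite-dimensional case.
\<close>
lemma ex_empirical_partition_functions:
  obtains \<tau> :: "nat \<Rightarrow> 'a" and r :: "nat \<Rightarrow> nat" where "\<And>i. \<tau> i \<in> space M" "strict_mono r"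
    "AE \<omega> in P. (\<lambda>n. (\<Sum>i<r n. exp (\<beta> * H (\<tau> i) \<omega>)) / real (r n)) \<longlonglongrightarrow> Z \<beta> \<omega>"
proof -
  define d where "d \<sigma> \<omega> = exp (\<beta> * H' \<sigma> \<omega>) - Z \<beta> \<omega>" for \<sigma> \<omega>
  have md[measurable]: "(\<lambda>(\<sigma>, \<omega>). d \<sigma> \<omega>) \<in> borel_measurable (M \<Otimes>\<^sub>M P)"
    unfolding d_def by measurable
  have e: "(exp (\<beta> * x))\<^sup>2 = exp (2 * \<beta> * x)" for x :: real
    by (simp add: power2_eq_square exp_add[symmetric])
  have i2: "integrable (M \<Otimes>\<^sub>M P) (\<lambda>(\<sigma>, \<omega>). (exp (\<beta> * H' \<sigma> \<omega>))\<^sup>2)"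
    unfolding e by (rule exp_integrable)
  have iZ: "integrable P (\<lambda>\<omega>. (Z \<beta> \<omega>)\<^sup>2)"
    by (rule Bochner_Integration.integrable_bound[OF MP.integrable_snd[OF i2]])
      (use Z_square_le[of \<beta>] in \<open>auto elim!: eventually_mono\<close>)
  have iZ': "integrable (M \<Otimes>\<^sub>M P) (\<lambda>(\<sigma>, \<omega>). (Z \<beta> \<omega>)\<^sup>2)"
    by (rule MP.integrable_snd_factor[OF iZ])
  have d2: "integrable (M \<Otimes>\<^sub>M P) (\<lambda>(\<sigma>, \<omega>). (d \<sigma> \<omega>)\<^sup>2)"
  proof (rule Bochner_Integration.integrable_bound)
    show "integrable (M \<Otimes>\<^sub>M P) (\<lambda>w. 2 * (case w of (\<sigma>, \<omega>) \<Rightarrow> (exp (\<beta> * H' \<sigma> \<omega>))\<^sup>2) + 2 * (case w of (\<sigma>, \<omega>) \<Rightarrow> (Z \<beta> \<omega>)\<^sup>2))"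
      using i2 iZ' by auto
    have "(a - b)\<^sup>2 \<le> 2 * a\<^sup>2 + 2 * b\<^sup>2" for a b :: real
      using zero_le_power2[of "a + b"] by (simp add: power2_eq_square algebra_simps)
    then show "AE w in M \<Otimes>\<^sub>M P. norm (case w of (\<sigma>, \<omega>) \<Rightarrow> (d \<sigma> \<omega>)\<^sup>2)
       \<le> norm (2 * (case w of (\<sigma>, \<omega>) \<Rightarrow> (exp (\<beta> * H' \<sigma> \<omega>))\<^sup>2) + 2 * (case w of (\<sigma>, \<omega>) \<Rightarrow> (Z \<beta> \<omega>)\<^sup>2))"
      by (intro AE_I2) (auto simp: d_def split: prod.split)
  qed measurable
  have d0: "AE \<omega> in P. (\<integral>\<sigma>. d \<sigma> \<omega> \<partial>M) = 0"
    using exp_integrable_section[of \<beta>]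
    by eventually_elim (simp add: d_def Z_def MP.M1.prob_space)
  obtain \<tau> where \<tau>: "\<And>i. \<tau> i \<in> space M" "\<And>i. AE \<omega> in P. H (\<tau> i) \<omega> = H' (\<tau> i) \<omega>"
    and S: "\<And>n. integrable P (\<lambda>\<omega>. (\<Sum>i<n. d (\<tau> i) \<omega>)\<^sup>2)"
      "\<And>n. (\<integral>\<omega>. (\<Sum>i<n. d (\<tau> i) \<omega>)\<^sup>2 \<partial>P) \<le> real n * (\<integral>(x, y). (d x y)\<^sup>2 \<partial>(M \<Otimes>\<^sub>M P))"
    using MP.ex_sampling_sequence[OF md d2 d0 version_fst] by blast
  define C where "C = (\<integral>(x, y). (d x y)\<^sup>2 \<partial>(M \<Otimes>\<^sub>M P))"
  define D where "D n \<omega> = ((\<Sum>i<n. d (\<tau> i) \<omega>) / real n)\<^sup>2" for n \<omega>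
  have iD: "integrable P (D n)" for n
    unfolding D_def power_divide by (intro integrable_divide_zero S)
  have D0: "(\<lambda>n. \<integral>\<omega>. norm (D n \<omega>) \<partial>P) \<longlonglongrightarrow> 0"
  proof (rule tendsto_sandwich[OF _ _ tendsto_const])
    show "\<forall>\<^sub>F n in sequentially. 0 \<le> (\<integral>\<omega>. norm (D n \<omega>) \<partial>P)" by simp
    show "(\<lambda>n. C / real n) \<longlonglongrightarrow> 0" by (rule lim_const_over_n)
    show "\<forall>\<^sub>F n in sequentially. (\<integral>\<omega>. norm (D n \<omega>) \<partial>P) \<le> C / real n"
      using eventually_gt_at_top[of 0]
    proof eventually_elim
      case (elim n)
      have "(\<integral>\<omega>. norm (D n \<omega>) \<partial>P) = (\<integral>\<omega>. (\<Sum>i<n. d (\<tau> i) \<omega>)\<^sup>2 \<partial>P) / (real n)\<^sup>2"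
        by (simp add: D_def power_divide)
      also have "\<dots> \<le> real n * C / (real n)\<^sup>2"
        using S(2)[of n] by (intro divide_right_mono) (auto simp: C_def)
      also have "\<dots> = C / real n" using elim by (simp add: power2_eq_square)
      finally show ?case .
    qed
  qed
  obtain r where r: "strict_mono r" "AE \<omega> in P. (\<lambda>n. D (r n) \<omega>) \<longlonglongrightarrow> 0"
    using tendsto_L1_AE_subseq[OF iD D0] by blast
  have "AE \<omega> in P. \<forall>i. H (\<tau> i) \<omega> = H' (\<tau> i) \<omega>" using \<tau>(2) by (simp add: AE_all_countable)
  then have "AE \<omega> in P. (\<lambda>n. (\<Sum>i<r n. exp (\<beta> * H (\<tau> i) \<omega>)) / real (r n)) \<longlonglongrightarrow> Z \<beta> \<omega>"
    using r(2)
  proof eventually_elim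
    case (elim \<omega>)
    have "(\<lambda>n. sqrt (D (r n) \<omega>)) \<longlonglongrightarrow> sqrt 0" by (intro tendsto_real_sqrt elim)
    then have "(\<lambda>n. (\<Sum>i<r n. d (\<tau> i) \<omega>) / real (r n)) \<longlonglongrightarrow> 0"
      unfolding D_def real_sqrt_abs real_sqrt_zero by (rule tendsto_rabs_zero_cancel)
    then have "(\<lambda>n. (\<Sum>i<r n. d (\<tau> i) \<omega>) / real (r n) + Z \<beta> \<omega>) \<longlonglongrightarrow> 0 + Z \<beta> \<omega>"
      by (intro tendsto_add tendsto_const)
    then have "(\<lambda>n. (\<Sum>i<r n. d (\<tau> i) \<omega>) / real (r n) + Z \<beta> \<omega>) \<longlonglongrightarrow> Z \<beta> \<omega>" by simp
    then show ?case
    proof (rule Lim_transform_eventually)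
      show "\<forall>\<^sub>F n in sequentially. (\<Sum>i<r n. d (\<tau> i) \<omega>) / real (r n) + Z \<beta> \<omega> = (\<Sum>i<r n. exp (\<beta> * H (\<tau> i) \<omega>)) / real (r n)"
        using eventually_gt_at_top[of 0]
      proof eventually_elim
        case (elim n)
        then have "0 < r n" using strict_mono_imp_increasing[OF r(1), of n] by simp
        then show ?case using \<open>\<forall>i. H (\<tau> i) \<omega> = H' (\<tau> i) \<omega>\<close>
          by (simp add: d_def sum_subtractf diff_divide_distrib)
      qed
    qed
  qed
  then show ?thesis using that \<tau>(1) r(1) by blast
qed

text \<open>
  Fatou's lemma carries the dimension-free bound from the empirical averages to the partition
  function.
\<close>
lemma partition_function_decoupled_bound:
  assumes l: "0 \<le> l"
  shows "(\<integral>\<^sup>+w. ennreal (exp (l * (ln (Z \<beta> (fst w)) - ln (Z \<beta> (snd w))))) \<partial>(P \<Otimes>\<^sub>M P))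
     \<le> ennreal (exp (l\<^sup>2 * pi\<^sup>2 * \<beta>\<^sup>2 * V / 8))" (is "_ \<le> ?K")
proof -
  obtain \<tau> r where \<tau>: "\<And>i. \<tau> i \<in> space M" and r: "strict_mono r"
    and lim: "AE \<omega> in P. (\<lambda>n. (\<Sum>i<r n. exp (\<beta> * H (\<tau> i) \<omega>)) / real (r n)) \<longlonglongrightarrow> Z \<beta> \<omega>"
    using ex_empirical_partition_functions[of \<beta>] by blast
  define A where "A n \<omega> = ln ((\<Sum>i<r n. exp (\<beta> * H (\<tau> i) \<omega>)) / real (r n))" for n \<omega>
  have mH[measurable]: "H (\<tau> i) \<in> borel_measurable P" for i
    by (rule centered_gaussian_transforms(1)[OF prob_P H_gaussian[OF \<tau>]])
  have mA[measurable]: "A n \<in> borel_measurable P" for n unfolding A_def by measurable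
  have A_lim: "AE \<omega> in P. (\<lambda>n. A n \<omega>) \<longlonglongrightarrow> ln (Z \<beta> \<omega>)"
    using lim Z_pos[of \<beta>] by eventually_elim (auto simp: A_def intro!: tendsto_ln)
  have bound: "(\<integral>\<^sup>+w. ennreal (exp (l * (A n (fst w) - A n (snd w)))) \<partial>(P \<Otimes>\<^sub>M P)) \<le> ?K" if n: "0 < n" for n
  proof -
    have rn: "0 < r n" using n strict_mono_imp_increasing[OF r, of n] by simp
    have "A n \<omega> = log_sum_exp \<beta> {..<r n} (\<lambda>i. H (\<tau> i) \<omega>) - ln (real (r n))" for \<omega>
    proof -
      have "0 < (\<Sum>i<r n. exp (\<beta> * H (\<tau> i) \<omega>))" using rn by (intro sum_pos) auto
      then show ?thesis using rn by (simp add: A_def log_sum_exp_def ln_div)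
    qed
    then have "(\<integral>\<^sup>+w. ennreal (exp (l * (A n (fst w) - A n (snd w)))) \<partial>(P \<Otimes>\<^sub>M P))
       = (\<integral>\<^sup>+w. ennreal (exp (l * (log_sum_exp \<beta> {..<r n} (\<lambda>i. H (\<tau> i) (fst w)) - log_sum_exp \<beta> {..<r n} (\<lambda>i. H (\<tau> i) (snd w))))) \<partial>(P \<Otimes>\<^sub>M P))"
      by simp
    also have "\<dots> \<le> ?K"
    proof (rule log_sum_exp_decoupled_bound[OF prob_P _ _ _ _ l])
      show "(\<integral>\<omega>. (H (\<tau> i) \<omega>)\<^sup>2 \<partial>P) \<le> V" for i
        using variance_le[OF \<tau>] by (simp add: field_variance_def)
    qed (use rn \<tau> in \<open>auto intro!: combination_gaussian\<close>)
    finally show ?thesis .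
  qed
  have "(\<integral>\<^sup>+w. ennreal (exp (l * (ln (Z \<beta> (fst w)) - ln (Z \<beta> (snd w))))) \<partial>(P \<Otimes>\<^sub>M P))
     = (\<integral>\<^sup>+w. liminf (\<lambda>n. ennreal (exp (l * (A n (fst w) - A n (snd w))))) \<partial>(P \<Otimes>\<^sub>M P))"
  proof (rule nn_integral_cong_AE)
    show "AE w in P \<Otimes>\<^sub>M P. ennreal (exp (l * (ln (Z \<beta> (fst w)) - ln (Z \<beta> (snd w)))))
        = liminf (\<lambda>n. ennreal (exp (l * (A n (fst w) - A n (snd w)))))"
      using PP.AE_fst_of_factor[OF A_lim] PP.AE_snd_of_factor[OF A_lim]
    proof eventually_elim
      case (elim w)
      have "(\<lambda>n. ennreal (exp (l * (A n (fst w) - A n (snd w))))) \<longlonglongrightarrow> ennreal (exp (l * (ln (Z \<beta> (fst w)) - ln (Z \<beta> (snd w)))))"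
        by (intro tendsto_ennrealI tendsto_intros elim)
      from lim_imp_Liminf[OF _ this] show ?case by simp
    qed
  qed
  also have "\<dots> \<le> liminf (\<lambda>n. \<integral>\<^sup>+w. ennreal (exp (l * (A n (fst w) - A n (snd w)))) \<partial>(P \<Otimes>\<^sub>M P))"
    by (intro nn_integral_liminf) measurable
  also have "\<dots> \<le> ?K"
  proof (rule Liminf_le)
    show "\<forall>\<^sub>F n in sequentially. (\<integral>\<^sup>+w. ennreal (exp (l * (A n (fst w) - A n (snd w)))) \<partial>(P \<Otimes>\<^sub>M P)) \<le> ?K"
      using eventually_gt_at_top[of 0] by eventually_elim (rule bound)
  qed simp
  finally show ?thesis .
qed

end

section \<open>The lower tail of the partition function and the first moment at one point\<close>

lemma ennreal_integral_le_nn_integral: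
  fixes g :: "'a \<Rightarrow> real"
  assumes g: "integrable M g" and le: "\<And>x. g x \<le> f x"
  shows "ennreal (\<integral>x. g x \<partial>M) \<le> (\<integral>\<^sup>+x. ennreal (f x) \<partial>M)"
proof -
  have i: "integrable M (\<lambda>x. max 0 (g x))" using g by auto
  have "ennreal (\<integral>x. g x \<partial>M) \<le> ennreal (\<integral>x. max 0 (g x) \<partial>M)"
    by (intro ennreal_leI integral_mono g i) auto
  also have "\<dots> = (\<integral>\<^sup>+x. ennreal (max 0 (g x)) \<partial>M)"
    by (rule nn_integral_eq_integral[symmetric, OF i]) auto
  also have "\<dots> \<le> (\<integral>\<^sup>+x. ennreal (f x) \<partial>M)"
    by (intro nn_integral_mono) (auto simp: max_def ennreal_leI le)
  finally show ?thesis .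
qed

text \<open>
  Jensen's inequality in a form that allows the right-hand side to be infinite; the tangent line
  of the exponential at \<open>l * expectation L\<close> is integrated.
\<close>
lemma (in prob_space) exp_expectation_le:
  assumes L: "integrable M L"
  shows "ennreal (exp (l * expectation L)) \<le> (\<integral>\<^sup>+\<omega>. ennreal (exp (l * L \<omega>)) \<partial>M)"
proof -
  define u where "u = l * expectation L"
  have "exp u = (\<integral>\<omega>. exp u * (1 + (l * L \<omega> - u)) \<partial>M)"
    using L by (simp add: prob_space u_def)
  moreover have "ennreal (\<integral>\<omega>. exp u * (1 + (l * L \<omega> - u)) \<partial>M) \<le> (\<integral>\<^sup>+\<omega>. ennreal (exp (l * L \<omega>)) \<partial>M)"
  proof (rule ennreal_integral_le_nn_integral)
    show "integrable M (\<lambda>\<omega>. exp u * (1 + (l * L \<omega> - u)))" using L by auto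
    show "exp u * (1 + (l * L \<omega> - u)) \<le> exp (l * L \<omega>)" for \<omega>
    proof -
      have "exp u * (1 + (l * L \<omega> - u)) \<le> exp u * exp (l * L \<omega> - u)"
        by (intro mult_left_mono exp_ge_add_one_self) auto
      then show ?thesis by (simp add: exp_add[symmetric])
    qed
  qed
  ultimately show ?thesis by (simp add: u_def)
qed

context gaussian_model
begin

text \<open>
  The decoupled bound factorizes into \<open>E (Z ^ l) * E (Z ^ -l)\<close>.  The first factor is bounded from below with Jensen's
  inequality, and Markov's inequality is applied to the second.
\<close>
lemma ln_Z_lower_tail:
  assumes int: "integrable P (\<lambda>\<omega>. ln (Z \<beta> \<omega>))" and l: "0 \<le> l"
  shows "emeasure P {\<omega>\<in>space P. ln (Z \<beta> \<omega>) \<le> (\<integral>\<omega>. ln (Z \<beta> \<omega>) \<partial>P) - t}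
    \<le> ennreal (exp (- (l * t) + l\<^sup>2 * pi\<^sup>2 * \<beta>\<^sup>2 * V / 8))"
proof -
  define m where "m = (\<integral>\<omega>. ln (Z \<beta> \<omega>) \<partial>P)"
  define K where "K = l\<^sup>2 * pi\<^sup>2 * \<beta>\<^sup>2 * V / 8"
  let ?E = "{\<omega>\<in>space P. ln (Z \<beta> \<omega>) \<le> m - t}"
  let ?u = "\<integral>\<^sup>+\<omega>. ennreal (exp (l * ln (Z \<beta> \<omega>))) \<partial>P"
  let ?v = "\<integral>\<^sup>+\<omega>. ennreal (exp (- l * ln (Z \<beta> \<omega>))) \<partial>P"
  have "?u * ?v = (\<integral>\<^sup>+w. ennreal (exp (l * ln (Z \<beta> (fst w)))) * ennreal (exp (- l * ln (Z \<beta> (snd w)))) \<partial>(P \<Otimes>\<^sub>M P))"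
    by (subst MP.M2.nn_integral_fst[symmetric]) (auto simp: nn_integral_cmult nn_integral_multc)
  also have "\<dots> = (\<integral>\<^sup>+w. ennreal (exp (l * (ln (Z \<beta> (fst w)) - ln (Z \<beta> (snd w))))) \<partial>(P \<Otimes>\<^sub>M P))"
    by (intro nn_integral_cong) (simp add: ennreal_mult[symmetric] exp_add[symmetric] algebra_simps)
  also have "\<dots> \<le> ennreal (exp K)"
    unfolding K_def by (rule partition_function_decoupled_bound[OF l])
  finally have uv: "?u * ?v \<le> ennreal (exp K)" .
  have "emeasure P ?E = (\<integral>\<^sup>+\<omega>. indicator ?E \<omega> \<partial>P)" by simp
  also have "\<dots> \<le> (\<integral>\<^sup>+\<omega>. ennreal (exp (l * (m - t))) * ennreal (exp (- l * ln (Z \<beta> \<omega>))) \<partial>P)"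
  proof (rule nn_integral_mono)
    fix \<omega>
    show "indicator ?E \<omega> \<le> ennreal (exp (l * (m - t))) * ennreal (exp (- l * ln (Z \<beta> \<omega>)))"
    proof (cases "\<omega> \<in> ?E")
      case True
      then have "0 \<le> l * ((m - t) - ln (Z \<beta> \<omega>))" using l by (intro mult_nonneg_nonneg) auto
      then have "1 \<le> exp (l * (m - t)) * exp (- l * ln (Z \<beta> \<omega>))"
        by (simp add: exp_add[symmetric] algebra_simps)
      then show ?thesis using True by (simp add: ennreal_mult[symmetric])
    qed simp
  qed
  also have "\<dots> = ennreal (exp (l * (m - t))) * ?v" by (simp add: nn_integral_cmult)
  finally have "emeasure P ?E \<le> ennreal (exp (l * (m - t))) * ?v" .
  then have "ennreal (exp (l * m)) * emeasure P ?E \<le> ?u * (ennreal (exp (l * (m - t))) * ?v)"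
    using MP.M2.exp_expectation_le[OF int, of l] by (intro mult_mono) (auto simp: m_def)
  also have "\<dots> = ennreal (exp (l * (m - t))) * (?u * ?v)" by (simp add: ac_simps)
  also have "\<dots> \<le> ennreal (exp (l * (m - t))) * ennreal (exp K)"
    by (intro mult_left_mono uv) auto
  finally have *: "ennreal (exp (l * m)) * emeasure P ?E \<le> ennreal (exp (l * (m - t)) * exp K)"
    by (simp add: ennreal_mult)
  have "emeasure P ?E = ennreal (exp (- (l * m))) * (ennreal (exp (l * m)) * emeasure P ?E)"
    by (simp add: mult.assoc[symmetric] ennreal_mult[symmetric] exp_add[symmetric])
  also have "\<dots> \<le> ennreal (exp (- (l * m))) * ennreal (exp (l * (m - t)) * exp K)"
    by (intro mult_left_mono *) auto
  also have "\<dots> = ennreal (exp (- (l * t) + K))"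
    by (simp add: ennreal_mult[symmetric] exp_add[symmetric] algebra_simps)
  finally show ?thesis by (simp add: m_def K_def)
qed

end

text \<open>
  The exponential weight \<open>exp (\<beta> * X)\<close> moves the mean of \<open>X / n\<close> close to \<open>\<beta>\<close>.  Inside the window around \<open>\<beta>\<close> the weight
  times the Gaussian density is at most \<open>exp (\<beta>\<^sup>2 * v / 2)\<close>, up to the normalization, which
  leaves the integral of the conditional probability.  Outside the window an exponential Markov inequality with parameter \<open>\<epsilon>\<close>
  gains the factor \<open>exp (- n * \<epsilon>\<^sup>2 / 2)\<close>, up to the error that comes from \<open>\<eta>\<close>.
\<close>
lemma gaussian_window_bound:
  fixes X Y :: "'b \<Rightarrow> real"
  assumes P: "prob_space P" and X: "centered_gaussian P X" and Y[measurable]: "Y \<in> borel_measurable P"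
    and A[measurable]: "A \<in> sets borel"
    and n: "1 \<le> n" and v: "v = (\<integral>\<omega>. (X \<omega>)\<^sup>2 \<partial>P)" "n / 2 \<le> v" "v \<le> n * (1 + \<eta>)"
    and \<beta>: "0 \<le> \<beta>" and \<epsilon>: "0 < \<epsilon>" and \<eta>: "0 \<le> \<eta>"
    and p: "is_conditional_probability P Y A (\<lambda>\<omega>. X \<omega> / n) (normal_density 0 (sqrt v / n)) p"
  shows "(\<integral>\<^sup>+\<omega>. ennreal (exp (\<beta> * X \<omega>)) * indicator A (Y \<omega>) \<partial>P)
    \<le> ennreal (n * exp (n * (\<beta>\<^sup>2 * (1 + \<eta>) / 2))) * (\<integral>\<^sup>+E\<in>{\<beta> - \<epsilon>..\<beta> + \<epsilon>}. p E \<partial>lborel)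
      + ennreal (2 * exp (n * (\<beta>\<^sup>2 / 2 - \<epsilon>\<^sup>2 / 2 + \<eta> * (\<beta> + \<epsilon>)\<^sup>2 / 2)))"
proof -
  note [measurable] = centered_gaussian_transforms(1)[OF P X]
  let ?W = "{\<beta> - \<epsilon>..\<beta> + \<epsilon>}"
  let ?\<phi> = "normal_density 0 (sqrt v / n)"
  define c where "c = n * exp (n * (\<beta>\<^sup>2 * (1 + \<eta>) / 2))"
  define k where "k = exp (n * (\<beta>\<^sup>2 / 2 - \<epsilon>\<^sup>2 / 2 + \<eta> * (\<beta> + \<epsilon>)\<^sup>2 / 2))"
  have v0: "0 < v" using n v(2) by simp
  obtain D where D[measurable]: "D \<in> borel_measurable lborel"
    and D_eq: "density lborel D = distr (restrict_space P {\<omega>\<in>space P. Y \<omega> \<in> A}) borel (\<lambda>\<omega>. X \<omega> / n)"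
    and pD: "\<And>E. p E = D E / ennreal (?\<phi> E)"
    using p unfolding is_conditional_probability_def by blast
  have D_borel[measurable]: "D \<in> borel_measurable borel" using D by simp
  have \<phi>_pos: "0 < ?\<phi> E" for E using n v0 by (intro normal_density_pos) auto
  have Dp: "D E = p E * ennreal (?\<phi> E)" for E
    using \<phi>_pos[of E] by (simp add: pD ennreal_divide_times ennreal_divide_self)
  have p_meas[measurable]: "p \<in> borel_measurable borel"
    unfolding pD[abs_def] by measurable
  have density_bound: "exp (n * \<beta> * E) * ?\<phi> E \<le> c" for E
  proof -
    have e: "n * \<beta> * E - n\<^sup>2 * E\<^sup>2 / (2 * v) \<le> n * (\<beta>\<^sup>2 * (1 + \<eta>) / 2)"
    proof -
      have "0 \<le> (n * E - \<beta> * v)\<^sup>2 / (2 * v)" using v0 by simp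
      also have "\<dots> = \<beta>\<^sup>2 * v / 2 - (n * \<beta> * E - n\<^sup>2 * E\<^sup>2 / (2 * v))"
        using v0 by (simp add: field_simps power2_eq_square)
      finally have "n * \<beta> * E - n\<^sup>2 * E\<^sup>2 / (2 * v) \<le> \<beta>\<^sup>2 * v / 2" by simp
      also have "\<dots> \<le> \<beta>\<^sup>2 * (n * (1 + \<eta>)) / 2" using v(3) by (intro divide_right_mono mult_left_mono) auto
      finally show ?thesis by (simp add: mult_ac)
    qed
    have s2: "(sqrt v / n)\<^sup>2 = v / n\<^sup>2" using v0 by (simp add: power_divide)
    have "1 \<le> 2 * pi * v" 
    proof -
      have "1 * 1 \<le> pi * (2 * v)" using n v(2) pi_gt3 by (intro mult_mono) auto
      then show ?thesis by simp
    qed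
    then have "1 \<le> sqrt (2 * pi * v)" by (rule real_sqrt_ge_one)
    then have "n / sqrt (2 * pi * v) \<le> n / 1" using n by (intro divide_left_mono) auto
    moreover have "sqrt (2 * pi * (v / n\<^sup>2)) = sqrt (2 * pi * v) / n"
      using n by (simp add: real_sqrt_divide)
    ultimately have "1 / sqrt (2 * pi * (v / n\<^sup>2)) \<le> n" by simp
    then have "?\<phi> E \<le> n * exp (- (E\<^sup>2) / (2 * (v / n\<^sup>2)))"
      unfolding normal_density_def s2 diff_zero by (rule mult_right_mono) simp
    then have "exp (n * \<beta> * E) * ?\<phi> E \<le> exp (n * \<beta> * E) * (n * exp (- (E\<^sup>2) / (2 * (v / n\<^sup>2))))"
      by (rule mult_left_mono) simp
    also have "\<dots> = n * exp (n * \<beta> * E - n\<^sup>2 * E\<^sup>2 / (2 * v))"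
    proof -
      have "- (E\<^sup>2) / (2 * (v / n\<^sup>2)) = - (n\<^sup>2 * E\<^sup>2 / (2 * v))" using n v0 by (simp add: field_simps)
      then show ?thesis
        using exp_add[of "n * \<beta> * E" "- (n\<^sup>2 * E\<^sup>2 / (2 * v))"] by simp
    qed
    also have "\<dots> \<le> c" unfolding c_def using e n by (intro mult_left_mono) auto
    finally show ?thesis .
  qed
  let ?w = "\<lambda>\<omega>. ennreal (exp (\<beta> * X \<omega>)) * indicator ?W (X \<omega> / n)"
  have window: "(\<integral>\<^sup>+\<omega>. ?w \<omega> * indicator {\<omega>\<in>space P. Y \<omega> \<in> A} \<omega> \<partial>P) \<le> ennreal c * (\<integral>\<^sup>+E\<in>?W. p E \<partial>lborel)"
  proof -
    have [measurable]: "{\<omega>\<in>space P. Y \<omega> \<in> A} \<in> sets P" by measurable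
    have mX: "(\<lambda>\<omega>. X \<omega> / n) \<in> restrict_space P {\<omega>\<in>space P. Y \<omega> \<in> A} \<rightarrow>\<^sub>M borel"
      by (intro measurable_restrict_space1) measurable
    have "(\<integral>\<^sup>+\<omega>. ?w \<omega> * indicator {\<omega>\<in>space P. Y \<omega> \<in> A} \<omega> \<partial>P)
      = (\<integral>\<^sup>+\<omega>. ?w \<omega> \<partial>restrict_space P {\<omega>\<in>space P. Y \<omega> \<in> A})"
      by (subst nn_integral_restrict_space) auto
    also have "\<dots> = (\<integral>\<^sup>+\<omega>. (\<lambda>E. ennreal (exp (n * \<beta> * E)) * indicator ?W E) (X \<omega> / n) \<partial>restrict_space P {\<omega>\<in>space P. Y \<omega> \<in> A})"
      using n by (intro nn_integral_cong) (simp add: mult.commute)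
    also have "\<dots> = (\<integral>\<^sup>+E. ennreal (exp (n * \<beta> * E)) * indicator ?W E \<partial>density lborel D)"
      unfolding D_eq by (rule nn_integral_distr[symmetric, OF mX]) measurable
    also have "\<dots> = (\<integral>\<^sup>+E. D E * (ennreal (exp (n * \<beta> * E)) * indicator ?W E) \<partial>lborel)"
      by (subst nn_integral_density) auto
    also have "\<dots> \<le> (\<integral>\<^sup>+E. ennreal c * (p E * indicator ?W E) \<partial>lborel)"
    proof (rule nn_integral_mono)
      fix E
      have "D E * (ennreal (exp (n * \<beta> * E)) * indicator ?W E)
         = ennreal (exp (n * \<beta> * E) * ?\<phi> E) * (p E * indicator ?W E)"
        using \<phi>_pos[of E] by (simp add: Dp ennreal_mult ac_simps)
      also have "\<dots> \<le> ennreal c * (p E * indicator ?W E)"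
        by (intro mult_right_mono ennreal_leI density_bound) auto
      finally show "D E * (ennreal (exp (n * \<beta> * E)) * indicator ?W E) \<le> ennreal c * (p E * indicator ?W E)" .
    qed
    also have "\<dots> = ennreal c * (\<integral>\<^sup>+E\<in>?W. p E \<partial>lborel)" by (simp add: nn_integral_cmult)
    finally show ?thesis .
  qed
  have tail: "(\<integral>\<^sup>+\<omega>. ennreal (exp (a * X \<omega>) * exp b) \<partial>P) \<le> ennreal k"
    if "a\<^sup>2 * (1 + \<eta>) / 2 * n + b \<le> n * (\<beta>\<^sup>2 / 2 - \<epsilon>\<^sup>2 / 2 + \<eta> * (\<beta> + \<epsilon>)\<^sup>2 / 2)" for a b
  proof -
    have "(\<integral>\<^sup>+\<omega>. ennreal (exp (a * X \<omega>) * exp b) \<partial>P) = ennreal (exp (a\<^sup>2 * v / 2 + b))"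
    proof -
      have "(\<integral>\<^sup>+\<omega>. ennreal (exp (a * X \<omega>) * exp b) \<partial>P) = (\<integral>\<^sup>+\<omega>. ennreal (exp (a * X \<omega>)) \<partial>P) * ennreal (exp b)"
        by (simp add: ennreal_mult nn_integral_multc)
      then show ?thesis
        by (simp only: centered_gaussian_transforms(3)[OF P X, of a] v(1) exp_add) (simp add: ennreal_mult)
    qed
    also have "a\<^sup>2 * v / 2 + b \<le> n * (\<beta>\<^sup>2 / 2 - \<epsilon>\<^sup>2 / 2 + \<eta> * (\<beta> + \<epsilon>)\<^sup>2 / 2)"
    proof -
      have "a\<^sup>2 * v \<le> a\<^sup>2 * (n * (1 + \<eta>))" using v(3) by (intro mult_left_mono) auto
      then show ?thesis using that by (simp add: mult_ac)
    qed
    finally show ?thesis by (simp add: k_def ennreal_leI)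
  qed
  have "(\<integral>\<^sup>+\<omega>. ennreal (exp (\<beta> * X \<omega>)) * indicator A (Y \<omega>) \<partial>P)
    \<le> (\<integral>\<^sup>+\<omega>. ?w \<omega> * indicator {\<omega>\<in>space P. Y \<omega> \<in> A} \<omega>
        + (ennreal (exp ((\<beta> + \<epsilon>) * X \<omega>) * exp (- \<epsilon> * n * (\<beta> + \<epsilon>)))
        + ennreal (exp ((\<beta> - \<epsilon>) * X \<omega>) * exp (\<epsilon> * n * (\<beta> - \<epsilon>)))) \<partial>P)"
  proof (rule nn_integral_mono)
    fix \<omega> assume \<omega>: "\<omega> \<in> space P"
    let ?e1 = "exp ((\<beta> + \<epsilon>) * X \<omega>) * exp (- \<epsilon> * n * (\<beta> + \<epsilon>))"
    let ?e2 = "exp ((\<beta> - \<epsilon>) * X \<omega>) * exp (\<epsilon> * n * (\<beta> - \<epsilon>))"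
    consider (mid) "X \<omega> / n \<in> ?W" | (gt) "X \<omega> / n > \<beta> + \<epsilon>" | (lt) "X \<omega> / n < \<beta> - \<epsilon>" by force
    then show "ennreal (exp (\<beta> * X \<omega>)) * indicator A (Y \<omega>)
      \<le> ?w \<omega> * indicator {\<omega>\<in>space P. Y \<omega> \<in> A} \<omega> + (ennreal ?e1 + ennreal ?e2)"
    proof cases
      case mid
      then show ?thesis using \<omega> by (auto simp: indicator_def)
    next
      case gt
      then have "n * (\<beta> + \<epsilon>) \<le> X \<omega>" using n by (simp add: field_simps)
      then have "\<epsilon> * (n * (\<beta> + \<epsilon>)) \<le> \<epsilon> * X \<omega>" using \<epsilon> by (intro mult_left_mono) auto
      then have "exp (\<beta> * X \<omega>) \<le> ?e1" by (simp add: exp_add[symmetric] algebra_simps)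
      then have "ennreal (exp (\<beta> * X \<omega>)) * indicator A (Y \<omega>) \<le> ennreal ?e1"
        by (auto simp: indicator_def ennreal_leI)
      also have "\<dots> \<le> ?w \<omega> * indicator {\<omega>\<in>space P. Y \<omega> \<in> A} \<omega> + (ennreal ?e1 + ennreal ?e2)"
        by (simp add: add_increasing add_increasing2)
      finally show ?thesis .
    next
      case lt
      then have "X \<omega> \<le> n * (\<beta> - \<epsilon>)" using n by (simp add: field_simps)
      then have "\<epsilon> * X \<omega> \<le> \<epsilon> * (n * (\<beta> - \<epsilon>))" using \<epsilon> by (intro mult_left_mono) auto
      then have "exp (\<beta> * X \<omega>) \<le> ?e2" by (simp add: exp_add[symmetric] algebra_simps)
      then have "ennreal (exp (\<beta> * X \<omega>)) * indicator A (Y \<omega>) \<le> ennreal ?e2"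
        by (auto simp: indicator_def ennreal_leI)
      also have "\<dots> \<le> ?w \<omega> * indicator {\<omega>\<in>space P. Y \<omega> \<in> A} \<omega> + (ennreal ?e1 + ennreal ?e2)"
        by (simp add: add_increasing)
      finally show ?thesis .
    qed
  qed
  also have "\<dots> = (\<integral>\<^sup>+\<omega>. ?w \<omega> * indicator {\<omega>\<in>space P. Y \<omega> \<in> A} \<omega> \<partial>P)
      + ((\<integral>\<^sup>+\<omega>. ennreal (exp ((\<beta> + \<epsilon>) * X \<omega>) * exp (- \<epsilon> * n * (\<beta> + \<epsilon>))) \<partial>P)
      + (\<integral>\<^sup>+\<omega>. ennreal (exp ((\<beta> - \<epsilon>) * X \<omega>) * exp (\<epsilon> * n * (\<beta> - \<epsilon>))) \<partial>P))"
    by (simp add: nn_integral_add)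
  also have "\<dots> \<le> ennreal c * (\<integral>\<^sup>+E\<in>?W. p E \<partial>lborel) + (ennreal k + ennreal k)"
  proof (intro add_mono window tail)
    show "(\<beta> + \<epsilon>)\<^sup>2 * (1 + \<eta>) / 2 * n + - \<epsilon> * n * (\<beta> + \<epsilon>) \<le> n * (\<beta>\<^sup>2 / 2 - \<epsilon>\<^sup>2 / 2 + \<eta> * (\<beta> + \<epsilon>)\<^sup>2 / 2)"
      by (simp add: power2_eq_square algebra_simps add_divide_distrib)
    have "(\<beta> - \<epsilon>)\<^sup>2 \<le> (\<beta> + \<epsilon>)\<^sup>2"
      using mult_nonneg_nonneg[OF \<beta> less_imp_le[OF \<epsilon>]] by (simp add: power2_eq_square algebra_simps)
    then have "n * (\<eta> * (\<beta> - \<epsilon>)\<^sup>2 / 2) \<le> n * (\<eta> * (\<beta> + \<epsilon>)\<^sup>2 / 2)"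
      using n \<eta> by (intro mult_left_mono divide_right_mono) auto
    moreover have "(\<beta> - \<epsilon>)\<^sup>2 * (1 + \<eta>) / 2 * n + \<epsilon> * n * (\<beta> - \<epsilon>) = n * (\<beta>\<^sup>2 / 2 - \<epsilon>\<^sup>2 / 2) + n * (\<eta> * (\<beta> - \<epsilon>)\<^sup>2 / 2)"
      by (simp add: power2_eq_square field_simps)
    ultimately show "(\<beta> - \<epsilon>)\<^sup>2 * (1 + \<eta>) / 2 * n + \<epsilon> * n * (\<beta> - \<epsilon>) \<le> n * (\<beta>\<^sup>2 / 2 - \<epsilon>\<^sup>2 / 2 + \<eta> * (\<beta> + \<epsilon>)\<^sup>2 / 2)"
      by (simp add: distrib_left)
  qed
  also have "ennreal k + ennreal k = ennreal (2 * k)" by (simp add: k_def ennreal_plus[symmetric] del: ennreal_plus)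
  finally show ?thesis by (simp add: c_def k_def)
qed

section \<open>Gibbs averages and exponential rates\<close>

lemma completion_measurable_AE_eq:
  fixes g h :: "'b \<Rightarrow> real"
  assumes h[measurable]: "h \<in> borel_measurable P" and eq: "AE \<omega> in P. g \<omega> = h \<omega>"
  shows "g \<in> borel_measurable (completion P)"
proof (rule measurableI)
  fix B :: "real set" assume B[measurable]: "B \<in> sets borel"
  have "h -` B \<inter> space P \<in> sets P" by measurable
  then have h_sets: "h -` B \<inter> space P \<in> sets (completion P)" by (rule sets_completionI_sets)
  have ae: "AE \<omega> in completion P. \<omega> \<in> h -` B \<inter> space P \<longleftrightarrow> \<omega> \<in> g -` B \<inter> space (completion P)"
    using AE_completion[OF eq] by eventually_elim simp
  show "g -` B \<inter> space (completion P) \<in> sets (completion P)"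
    by (rule completion.in_sets_AE[OF ae h_sets]) simp
qed simp

context gaussian_model
begin

lemma ln_Z_completion:
  assumes path: "AE \<omega> in P. (\<lambda>\<sigma>. H \<sigma> \<omega>) \<in> borel_measurable M"
  shows "AE \<omega> in P. (\<integral>\<sigma>. exp (\<beta> * H \<sigma> \<omega>) \<partial>M) = Z \<beta> \<omega>"
    and "(\<integral>\<omega>. ln (\<integral>\<sigma>. exp (\<beta> * H \<sigma> \<omega>) \<partial>M) / n \<partial>completion P) = (\<integral>\<omega>. ln (Z \<beta> \<omega>) \<partial>P) / n"
proof -
  show ae: "AE \<omega> in P. (\<integral>\<sigma>. exp (\<beta> * H \<sigma> \<omega>) \<partial>M) = Z \<beta> \<omega>"
    using path version_snd AE_space
  proof eventually_elim
    case (elim \<omega>)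
    note [measurable] = elim(1)
    have [measurable]: "(\<lambda>\<sigma>. H' \<sigma> \<omega>) \<in> borel_measurable M"
      using measurable_Pair1[OF version_measurable elim(3)] by simp
    show ?case unfolding Z_def
    proof (rule integral_cong_AE)
      show "AE \<sigma> in M. exp (\<beta> * H \<sigma> \<omega>) = exp (\<beta> * H' \<sigma> \<omega>)"
        using elim(2) by eventually_elim simp
    qed measurable
  qed
  have eq: "AE \<omega> in P. ln (\<integral>\<sigma>. exp (\<beta> * H \<sigma> \<omega>) \<partial>M) / n = ln (Z \<beta> \<omega>) / n"
    using ae by eventually_elim simp
  have m: "(\<lambda>\<omega>. ln (Z \<beta> \<omega>) / n) \<in> borel_measurable P" by measurable
  have "(\<integral>\<omega>. ln (\<integral>\<sigma>. exp (\<beta> * H \<sigma> \<omega>) \<partial>M) / n \<partial>completion P) = (\<integral>\<omega>. ln (Z \<beta> \<omega>) / n \<partial>completion P)"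
    by (rule integral_cong_AE[OF completion_measurable_AE_eq[OF m eq] measurable_completion[OF m] AE_completion[OF eq]])
  also have "\<dots> = (\<integral>\<omega>. ln (Z \<beta> \<omega>) / n \<partial>P)" by (rule integral_completion[OF m])
  finally show "(\<integral>\<omega>. ln (\<integral>\<sigma>. exp (\<beta> * H \<sigma> \<omega>) \<partial>M) / n \<partial>completion P) = (\<integral>\<omega>. ln (Z \<beta> \<omega>) \<partial>P) / n"
    by simp
qed

text \<open>
  The Gibbs weight of an event is its unnormalized weight divided by \<open>Z\<close>, and is at most \<open>1\<close>.  The first
  bound is used where \<open>Z > exp u\<close> and the second one elsewhere.
\<close>
lemma gibbs_average_le:
  assumes path: "AE \<omega> in P. (\<lambda>\<sigma>. H \<sigma> \<omega>) \<in> borel_measurable M"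
    and f_path: "AE \<omega> in P. (\<lambda>\<sigma>. f \<sigma> \<omega>) \<in> borel_measurable M"
    and f'[measurable]: "(\<lambda>(\<sigma>, \<omega>). f' \<sigma> \<omega>) \<in> borel_measurable (M \<Otimes>\<^sub>M P)"
    and f_version: "AE w in M \<Otimes>\<^sub>M P. f (fst w) (snd w) = f' (fst w) (snd w)"
    and A[measurable]: "A \<in> sets borel"
  shows "(\<integral>\<^sup>+\<omega>. emeasure (density M (\<lambda>\<sigma>. ennreal (exp (\<beta> * H \<sigma> \<omega>) / (\<integral>\<sigma>. exp (\<beta> * H \<sigma> \<omega>) \<partial>M)))) {\<sigma>\<in>space M. f \<sigma> \<omega> \<in> A} \<partial>P)
    \<le> ennreal (exp (- u)) * (\<integral>\<^sup>+\<sigma>. (\<integral>\<^sup>+\<omega>. ennreal (exp (\<beta> * H' \<sigma> \<omega>)) * indicator A (f' \<sigma> \<omega>) \<partial>P) \<partial>M)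
      + emeasure P {\<omega>\<in>space P. ln (Z \<beta> \<omega>) \<le> u}"
proof -
  let ?E = "{\<omega>\<in>space P. ln (Z \<beta> \<omega>) \<le> u}"
  let ?a = "\<lambda>\<omega>. \<integral>\<^sup>+\<sigma>. ennreal (exp (\<beta> * H' \<sigma> \<omega>)) * indicator A (f' \<sigma> \<omega>) \<partial>M"
  have fs: "AE \<omega> in P. AE \<sigma> in M. f \<sigma> \<omega> = f' \<sigma> \<omega>" by (rule MP.AE_pair_swapped[where Q="\<lambda>\<sigma> \<omega>. f \<sigma> \<omega> = f' \<sigma> \<omega>"]) (rule f_version)
  have "(\<integral>\<^sup>+\<omega>. emeasure (density M (\<lambda>\<sigma>. ennreal (exp (\<beta> * H \<sigma> \<omega>) / (\<integral>\<sigma>. exp (\<beta> * H \<sigma> \<omega>) \<partial>M)))) {\<sigma>\<in>space M. f \<sigma> \<omega> \<in> A} \<partial>P)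
     \<le> (\<integral>\<^sup>+\<omega>. ennreal (exp (- u)) * ?a \<omega> + indicator ?E \<omega> \<partial>P)"
  proof (rule nn_integral_mono_AE)
    show "AE \<omega> in P. emeasure (density M (\<lambda>\<sigma>. ennreal (exp (\<beta> * H \<sigma> \<omega>) / (\<integral>\<sigma>. exp (\<beta> * H \<sigma> \<omega>) \<partial>M)))) {\<sigma>\<in>space M. f \<sigma> \<omega> \<in> A}
       \<le> ennreal (exp (- u)) * ?a \<omega> + indicator ?E \<omega>"
      using path f_path version_snd fs ln_Z_completion(1)[OF path, of \<beta>] Z_pos[of \<beta>] exp_integrable_section[of \<beta>] AE_space
    proof eventually_elim
      case (elim \<omega>)
      note [measurable] = elim(1) elim(2)
      have [measurable]: "(\<lambda>\<sigma>. H' \<sigma> \<omega>) \<in> borel_measurable M" "(\<lambda>\<sigma>. f' \<sigma> \<omega>) \<in> borel_measurable M"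
        using measurable_Pair1[OF version_measurable elim(8)] measurable_Pair1[OF f' elim(8)] by simp_all
      let ?z = "Z \<beta> \<omega>"
      have "emeasure (density M (\<lambda>\<sigma>. ennreal (exp (\<beta> * H \<sigma> \<omega>) / (\<integral>\<sigma>. exp (\<beta> * H \<sigma> \<omega>) \<partial>M)))) {\<sigma>\<in>space M. f \<sigma> \<omega> \<in> A}
         = (\<integral>\<^sup>+\<sigma>. ennreal (exp (\<beta> * H \<sigma> \<omega>) / ?z) * indicator {\<sigma>\<in>space M. f \<sigma> \<omega> \<in> A} \<sigma> \<partial>M)"
        by (subst emeasure_density) (simp_all add: elim(5))
      also have "\<dots> = (\<integral>\<^sup>+\<sigma>. ennreal (exp (\<beta> * H' \<sigma> \<omega>) / ?z) * indicator A (f' \<sigma> \<omega>) \<partial>M)"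
      proof (rule nn_integral_cong_AE)
        show "AE \<sigma> in M. ennreal (exp (\<beta> * H \<sigma> \<omega>) / ?z) * indicator {\<sigma>\<in>space M. f \<sigma> \<omega> \<in> A} \<sigma>
           = ennreal (exp (\<beta> * H' \<sigma> \<omega>) / ?z) * indicator A (f' \<sigma> \<omega>)"
          using elim(3) elim(4) AE_space by eventually_elim (auto simp: indicator_def)
      qed
      also have "\<dots> \<le> ennreal (exp (- u)) * ?a \<omega> + indicator ?E \<omega>"
      proof (cases "ln ?z \<le> u")
        case True
        have "(\<integral>\<^sup>+\<sigma>. ennreal (exp (\<beta> * H' \<sigma> \<omega>) / ?z) * indicator A (f' \<sigma> \<omega>) \<partial>M)
            \<le> (\<integral>\<^sup>+\<sigma>. ennreal (exp (\<beta> * H' \<sigma> \<omega>) / ?z) \<partial>M)"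
          by (intro nn_integral_mono) (auto simp: indicator_def)
        also have "\<dots> = ennreal (\<integral>\<sigma>. exp (\<beta> * H' \<sigma> \<omega>) / ?z \<partial>M)"
          using elim(6,7) by (intro nn_integral_eq_integral) auto
        also have "\<dots> = 1" using elim(6) by (simp add: Z_def)
        also have "1 \<le> ennreal (exp (- u)) * ?a \<omega> + indicator ?E \<omega>"
          using True elim(8) by (simp add: add_increasing)
        finally show ?thesis .
      next
        case False
        then have "exp u < exp (ln ?z)" by simp
        then have z: "exp u < ?z" using elim(6) by simp
        have "(\<integral>\<^sup>+\<sigma>. ennreal (exp (\<beta> * H' \<sigma> \<omega>) / ?z) * indicator A (f' \<sigma> \<omega>) \<partial>M)
            \<le> (\<integral>\<^sup>+\<sigma>. ennreal (exp (- u)) * (ennreal (exp (\<beta> * H' \<sigma> \<omega>)) * indicator A (f' \<sigma> \<omega>)) \<partial>M)"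
        proof (rule nn_integral_mono)
          fix \<sigma>
          have "exp (\<beta> * H' \<sigma> \<omega>) / ?z \<le> exp (\<beta> * H' \<sigma> \<omega>) / exp u"
            using z elim(6) by (intro divide_left_mono) auto
          also have "\<dots> = exp (- u) * exp (\<beta> * H' \<sigma> \<omega>)" by (simp add: exp_minus divide_inverse mult.commute)
          finally show "ennreal (exp (\<beta> * H' \<sigma> \<omega>) / ?z) * indicator A (f' \<sigma> \<omega>)
             \<le> ennreal (exp (- u)) * (ennreal (exp (\<beta> * H' \<sigma> \<omega>)) * indicator A (f' \<sigma> \<omega>))"
            by (auto simp: indicator_def ennreal_mult[symmetric] intro!: ennreal_leI)
        qed
        also have "\<dots> = ennreal (exp (- u)) * ?a \<omega>" by (simp add: nn_integral_cmult)
        also have "\<dots> \<le> ennreal (exp (- u)) * ?a \<omega> + indicator ?E \<omega>" by simp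
        finally show ?thesis .
      qed
      finally show ?case .
    qed
  qed
  also have "\<dots> = ennreal (exp (- u)) * (\<integral>\<^sup>+\<omega>. ?a \<omega> \<partial>P) + emeasure P ?E"
    by (subst nn_integral_add) (auto simp: nn_integral_cmult)
  also have "(\<integral>\<^sup>+\<omega>. ?a \<omega> \<partial>P) = (\<integral>\<^sup>+\<sigma>. (\<integral>\<^sup>+\<omega>. ennreal (exp (\<beta> * H' \<sigma> \<omega>)) * indicator A (f' \<sigma> \<omega>) \<partial>P) \<partial>M)"
    by (rule MP.Fubini') measurable
  finally show ?thesis .
qed

text \<open>
  Where the variance is close to \<open>n\<close> the single-point bound applies; on the remaining set the full moment
  \<open>exp (\<beta>\<^sup>2 * V / 2)\<close> is used, which costs little when this set is superexponentially small.
\<close>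
lemma first_moment_le:
  assumes f: "\<And>\<sigma>. \<sigma> \<in> space M \<Longrightarrow> f \<sigma> \<in> borel_measurable P"
    and f'[measurable]: "(\<lambda>(\<sigma>, \<omega>). f' \<sigma> \<omega>) \<in> borel_measurable (M \<Otimes>\<^sub>M P)"
    and f_version: "AE w in M \<Otimes>\<^sub>M P. f (fst w) (snd w) = f' (fst w) (snd w)"
    and A[measurable]: "A \<in> sets borel"
    and var[measurable]: "field_variance P H \<in> borel_measurable M"
    and n: "1 \<le> n" and \<beta>: "0 \<le> \<beta>" and \<epsilon>: "0 < \<epsilon>" and \<eta>: "0 \<le> \<eta>" "\<eta> \<le> 1 / 2"
    and p: "\<And>\<sigma>. \<sigma> \<in> space M \<Longrightarrow> is_conditional_probability P (f \<sigma>) A (\<lambda>\<omega>. H \<sigma> \<omega> / n)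
             (normal_density 0 (sqrt (field_variance P H \<sigma>) / n)) (p \<sigma>)"
  shows "(\<integral>\<^sup>+\<sigma>. (\<integral>\<^sup>+\<omega>. ennreal (exp (\<beta> * H' \<sigma> \<omega>)) * indicator A (f' \<sigma> \<omega>) \<partial>P) \<partial>M)
    \<le> ennreal (n * exp (n * (\<beta>\<^sup>2 * (1 + \<eta>) / 2))) * (\<integral>\<^sup>+\<sigma>. (\<integral>\<^sup>+E\<in>{\<beta> - \<epsilon>..\<beta> + \<epsilon>}. p \<sigma> E \<partial>lborel) \<partial>M)
      + ennreal (2 * exp (n * (\<beta>\<^sup>2 / 2 - \<epsilon>\<^sup>2 / 2 + \<eta> * (\<beta> + \<epsilon>)\<^sup>2 / 2)))
      + ennreal (exp (\<beta>\<^sup>2 * V / 2)) * emeasure M {\<sigma>\<in>space M. \<bar>field_variance P H \<sigma> / n - 1\<bar> > \<eta>}"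
proof -
  let ?bad = "{\<sigma>\<in>space M. \<bar>field_variance P H \<sigma> / n - 1\<bar> > \<eta>}"
  define c where "c = ennreal (n * exp (n * (\<beta>\<^sup>2 * (1 + \<eta>) / 2)))"
  define k where "k = ennreal (2 * exp (n * (\<beta>\<^sup>2 / 2 - \<epsilon>\<^sup>2 / 2 + \<eta> * (\<beta> + \<epsilon>)\<^sup>2 / 2)))"
  define b where "b = ennreal (exp (\<beta>\<^sup>2 * V / 2))"
  define q where "q \<sigma> = (\<integral>\<^sup>+E\<in>{\<beta> - \<epsilon>..\<beta> + \<epsilon>}. p \<sigma> E \<partial>lborel)" for \<sigma>
  define a where "a \<sigma> = (\<integral>\<^sup>+\<omega>. ennreal (exp (\<beta> * H' \<sigma> \<omega>)) * indicator A (f' \<sigma> \<omega>) \<partial>P)" for \<sigma>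
  define r where "r \<sigma> = k + b * indicator ?bad \<sigma>" for \<sigma>
  have [measurable]: "?bad \<in> sets M" by measurable
  have ma[measurable]: "a \<in> borel_measurable M" unfolding a_def by measurable
  have mr[measurable]: "r \<in> borel_measurable M" unfolding r_def by measurable
  have c0: "c \<noteq> 0" "c \<noteq> top" using n by (auto simp: c_def)
  have r_fin: "r \<sigma> \<noteq> top" for \<sigma> by (auto simp: r_def k_def b_def indicator_def)
  have f_fst: "AE \<sigma> in M. AE \<omega> in P. f \<sigma> \<omega> = f' \<sigma> \<omega>" using MP.AE_pair[OF f_version] by simp
  have a_le: "AE \<sigma> in M. a \<sigma> \<le> c * q \<sigma> + r \<sigma>"
    using version_fst f_fst AE_space
  proof eventually_elim
    case (elim \<sigma>)
    note \<sigma> = elim(3)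
    have a_eq: "a \<sigma> = (\<integral>\<^sup>+\<omega>. ennreal (exp (\<beta> * H \<sigma> \<omega>)) * indicator A (f \<sigma> \<omega>) \<partial>P)"
      unfolding a_def
    proof (rule nn_integral_cong_AE)
      show "AE \<omega> in P. ennreal (exp (\<beta> * H' \<sigma> \<omega>)) * indicator A (f' \<sigma> \<omega>) = ennreal (exp (\<beta> * H \<sigma> \<omega>)) * indicator A (f \<sigma> \<omega>)"
        using elim(1,2) by eventually_elim simp
    qed
    show ?case
    proof (cases "\<sigma> \<in> ?bad")
      case True
      have "a \<sigma> \<le> (\<integral>\<^sup>+\<omega>. ennreal (exp (\<beta> * H \<sigma> \<omega>)) \<partial>P)"
        unfolding a_eq by (intro nn_integral_mono) (auto simp: indicator_def)
      also have "\<dots> \<le> b"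
        unfolding exp_H[OF \<sigma>] b_def using variance_le[OF \<sigma>] by (auto intro!: ennreal_leI mult_left_mono)
      also have "\<dots> \<le> c * q \<sigma> + r \<sigma>" using True by (simp add: r_def add_increasing)
      finally show ?thesis .
    next
      case False
      then have good: "\<bar>field_variance P H \<sigma> / n - 1\<bar> \<le> \<eta>" using \<sigma> by auto
      then have "1 - \<eta> \<le> field_variance P H \<sigma> / n" "field_variance P H \<sigma> / n \<le> 1 + \<eta>" by linarith+
      then have v: "n * (1 - \<eta>) \<le> field_variance P H \<sigma>" "field_variance P H \<sigma> \<le> n * (1 + \<eta>)"
        using n by (simp_all add: field_simps)
      have "n * (1 / 2) \<le> n * (1 - \<eta>)" using n \<eta> by (intro mult_left_mono) auto
      with v(1) have "n / 2 \<le> field_variance P H \<sigma>" by simp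
      then have "a \<sigma> \<le> c * q \<sigma> + k"
        unfolding a_eq c_def q_def k_def
        by (intro gaussian_window_bound[OF prob_P H_gaussian[OF \<sigma>] f[OF \<sigma>] A n _ _ v(2) \<beta> \<epsilon> \<eta>(1) p[OF \<sigma>]])
          (auto simp: field_variance_def)
      then show ?thesis using False by (simp add: r_def)
    qed
  qed
  \<comment> \<open>The inequality is solved for \<open>q\<close> before it is integrated: the lower bound \<open>(a - r) / c\<close> is
    measurable, while \<open>q\<close> may fail to be.\<close>
  have "(\<integral>\<^sup>+\<sigma>. a \<sigma> \<partial>M) \<le> (\<integral>\<^sup>+\<sigma>. c * ((a \<sigma> - r \<sigma>) / c) + r \<sigma> \<partial>M)"
  proof (rule nn_integral_mono)
    fix \<sigma>
    have "c * ((a \<sigma> - r \<sigma>) / c) = a \<sigma> - r \<sigma>"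
      using c0 by (simp add: ennreal_times_divide mult.commute[of c] ennreal_mult_divide_eq)
    moreover have "a \<sigma> \<le> (a \<sigma> - r \<sigma>) + r \<sigma>"
      using r_fin[of \<sigma>] by (cases "r \<sigma> \<le> a \<sigma>") (auto simp: diff_add_cancel_ennreal add_increasing)
    ultimately show "a \<sigma> \<le> c * ((a \<sigma> - r \<sigma>) / c) + r \<sigma>" by simp
  qed
  also have "\<dots> = c * (\<integral>\<^sup>+\<sigma>. (a \<sigma> - r \<sigma>) / c \<partial>M) + (\<integral>\<^sup>+\<sigma>. r \<sigma> \<partial>M)"
    by (subst nn_integral_add) (auto simp: nn_integral_cmult)
  also have "\<dots> \<le> c * (\<integral>\<^sup>+\<sigma>. q \<sigma> \<partial>M) + (\<integral>\<^sup>+\<sigma>. r \<sigma> \<partial>M)"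
  proof (intro add_right_mono mult_left_mono nn_integral_mono_AE)
    show "AE \<sigma> in M. (a \<sigma> - r \<sigma>) / c \<le> q \<sigma>"
      using a_le
    proof eventually_elim
      case (elim \<sigma>)
      then have "a \<sigma> - r \<sigma> \<le> c * q \<sigma>"
        using r_fin[of \<sigma>] by (simp add: ennreal_minus_le_iff add.commute)
      then have "(a \<sigma> - r \<sigma>) / c \<le> c * q \<sigma> / c" by (rule divide_right_mono_ennreal)
      also have "\<dots> = q \<sigma>" using c0 by (simp add: mult.commute[of c] ennreal_mult_divide_eq)
      finally show ?case .
    qed
  qed simp
  also have "(\<integral>\<^sup>+\<sigma>. r \<sigma> \<partial>M) = k + b * emeasure M ?bad"
    unfolding r_def by (subst nn_integral_add) (auto simp: nn_integral_cmult_indicator MP.M1.emeasure_space_1)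
  finally show ?thesis by (simp add: a_def q_def c_def k_def b_def add.assoc)
qed

end

lemma elog_rate_lessD:
  assumes less: "ereal (1 / real N) * elog x < ereal r" and N: "1 \<le> N"
  shows "x \<le> ennreal (exp (real N * r))"
proof (cases x)
  case (real y)
  show ?thesis
  proof (cases "y = 0")
    case False
    then have "ln y / real N < r" using less real N by (simp add: elog_def)
    then have "ln y < real N * r" using N by (simp add: field_simps)
    then have "exp (ln y) \<le> exp (real N * r)" by simp
    then have "y \<le> exp (real N * r)" using False real by simp
    then show ?thesis using real by (simp add: ennreal_leI)
  qed (use real in simp)
next
  case top
  then show ?thesis using less N by (simp add: elog_def)
qed

lemma elog_rate_le:
  assumes le: "x \<le> ennreal y" and y: "0 < y"
  shows "ereal (1 / real N) * elog x \<le> ereal (ln y / real N)"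
proof (cases N)
  case 0
  then show ?thesis by (simp add: zero_ereal_def[symmetric])
next
  case (Suc m)
  have "elog x \<le> ereal (ln y)"
  proof (cases x)
    case (real z)
    then show ?thesis using le y by (auto simp: elog_def)
  next
    case top
    then show ?thesis using le by (simp add: top_unique)
  qed
  then have "ereal (1 / real N) * elog x \<le> ereal (1 / real N) * ereal (ln y)"
    by (intro ereal_mult_left_mono) auto
  then show ?thesis by simp
qed

lemma limsup_elog_rate_neg:
  assumes le: "\<forall>\<^sub>F N in sequentially. x N \<le> ennreal (5 * real N * exp (- (\<rho> * real N)))" and \<rho>: "0 < \<rho>"
  shows "limsup (\<lambda>N. ereal (1 / real N) * elog (x N)) < 0"
proof -
  have lim: "(\<lambda>N. ln 5 / real N + ln (real N) / real N - \<rho>) \<longlonglongrightarrow> 0 + 0 - \<rho>"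
    by (intro tendsto_intros lim_const_over_n lim_ln_over_n)
  have "limsup (\<lambda>N. ereal (1 / real N) * elog (x N)) \<le> limsup (\<lambda>N. ereal (ln 5 / real N + ln (real N) / real N - \<rho>))"
  proof (rule Limsup_mono)
    show "\<forall>\<^sub>F N in sequentially. ereal (1 / real N) * elog (x N) \<le> ereal (ln 5 / real N + ln (real N) / real N - \<rho>)"
      using le eventually_ge_at_top[of 1]
    proof eventually_elim
      case (elim N)
      have "ln (5 * real N * exp (- (\<rho> * real N))) / real N = ln 5 / real N + ln (real N) / real N - \<rho>"
        using elim(2) by (simp add: ln_mult diff_divide_distrib add_divide_distrib)
      then show ?case using elog_rate_le[OF elim(1), of N] elim(2) by simp
    qed
  qed
  also have "\<dots> = ereal (- \<rho>)"
    by (intro lim_imp_Limsup) (use lim in simp_all)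
  also have "\<dots> < 0" using \<rho> by simp
  finally show ?thesis .
qed

section \<open>The exponential decay of the averaged Gibbs weight\<close>

context gaussian_model
begin

text \<open>
  The finite-size estimate: \<open>Z\<close> is at least \<open>exp (n * (\<beta>\<^sup>2 / 2 - \<delta>))\<close> outside an event whose probability is
  controlled by the lower tail, and the expected unnormalized weight is controlled by the first moment.
\<close>
lemma gibbs_average_total_bound:
  assumes path: "AE \<omega> in P. (\<lambda>\<sigma>. H \<sigma> \<omega>) \<in> borel_measurable M"
    and f: "random_field P M f" and A: "A \<in> sets borel"
    and var: "field_variance P H \<in> borel_measurable M"
    and int: "integrable P (\<lambda>\<omega>. ln (Z \<beta> \<omega>))" and mean: "n * (\<beta>\<^sup>2 / 2 - \<delta> / 2) \<le> (\<integral>\<omega>. ln (Z \<beta> \<omega>) \<partial>P)"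
    and l: "0 \<le> l"
    and n: "1 \<le> n" and \<beta>: "0 \<le> \<beta>" and \<epsilon>: "0 < \<epsilon>" and \<eta>: "0 \<le> \<eta>" "\<eta> \<le> 1 / 2"
    and p: "\<And>\<sigma>. \<sigma> \<in> space M \<Longrightarrow> is_conditional_probability P (f \<sigma>) A (\<lambda>\<omega>. H \<sigma> \<omega> / n)
             (normal_density 0 (sqrt (field_variance P H \<sigma>) / n)) (p \<sigma>)"
  shows "(\<integral>\<^sup>+\<omega>. emeasure (density M (\<lambda>\<sigma>. ennreal (exp (\<beta> * H \<sigma> \<omega>) / (\<integral>\<sigma>. exp (\<beta> * H \<sigma> \<omega>) \<partial>M)))) {\<sigma>\<in>space M. f \<sigma> \<omega> \<in> A} \<partial>P)
    \<le> ennreal (exp (- (n * (\<beta>\<^sup>2 / 2 - \<delta>)))) *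
       (ennreal (n * exp (n * (\<beta>\<^sup>2 * (1 + \<eta>) / 2))) * (\<integral>\<^sup>+\<sigma>. (\<integral>\<^sup>+E\<in>{\<beta> - \<epsilon>..\<beta> + \<epsilon>}. p \<sigma> E \<partial>lborel) \<partial>M)
        + ennreal (2 * exp (n * (\<beta>\<^sup>2 / 2 - \<epsilon>\<^sup>2 / 2 + \<eta> * (\<beta> + \<epsilon>)\<^sup>2 / 2)))
        + ennreal (exp (\<beta>\<^sup>2 * V / 2)) * emeasure M {\<sigma>\<in>space M. \<bar>field_variance P H \<sigma> / n - 1\<bar> > \<eta>})
      + ennreal (exp (- (l * (n * \<delta> / 2)) + l\<^sup>2 * pi\<^sup>2 * \<beta>\<^sup>2 * V / 8))"
    (is "_ \<le> ennreal (exp (- ?u)) * ?B + ?C")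
proof -
  have f_sec: "\<And>\<sigma>. \<sigma> \<in> space M \<Longrightarrow> f \<sigma> \<in> borel_measurable P"
    and f_path: "AE \<omega> in P. (\<lambda>\<sigma>. f \<sigma> \<omega>) \<in> borel_measurable M"
    and f_joint: "(\<lambda>(\<sigma>, \<omega>). f \<sigma> \<omega>) \<in> borel_measurable (completion (M \<Otimes>\<^sub>M P))"
    using f by (auto simp: random_field_def)
  obtain g where g: "g \<in> borel_measurable (M \<Otimes>\<^sub>M P)" "AE w in M \<Otimes>\<^sub>M P. (case w of (\<sigma>, \<omega>) \<Rightarrow> f \<sigma> \<omega>) = g w"
    using completion_ex_borel_measurable_real[OF f_joint] by blast
  define f' where "f' \<sigma> \<omega> = g (\<sigma>, \<omega>)" for \<sigma> \<omega>
  have f': "(\<lambda>(\<sigma>, \<omega>). f' \<sigma> \<omega>) \<in> borel_measurable (M \<Otimes>\<^sub>M P)"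
    using g(1) by (simp add: f'_def case_prod_beta')
  have f_version: "AE w in M \<Otimes>\<^sub>M P. f (fst w) (snd w) = f' (fst w) (snd w)"
    using g(2) by (simp add: f'_def case_prod_beta')
  have "emeasure P {\<omega>\<in>space P. ln (Z \<beta> \<omega>) \<le> ?u}
      \<le> emeasure P {\<omega>\<in>space P. ln (Z \<beta> \<omega>) \<le> (\<integral>\<omega>. ln (Z \<beta> \<omega>) \<partial>P) - n * \<delta> / 2}"
  proof (rule emeasure_mono)
    have "n * (\<beta>\<^sup>2 / 2 - \<delta>) = n * (\<beta>\<^sup>2 / 2 - \<delta> / 2) - n * \<delta> / 2" by (simp add: algebra_simps)
    with mean have "?u \<le> (\<integral>\<omega>. ln (Z \<beta> \<omega>) \<partial>P) - n * \<delta> / 2" by linarith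
    then show "{\<omega>\<in>space P. ln (Z \<beta> \<omega>) \<le> ?u} \<subseteq> {\<omega>\<in>space P. ln (Z \<beta> \<omega>) \<le> (\<integral>\<omega>. ln (Z \<beta> \<omega>) \<partial>P) - n * \<delta> / 2}"
      by auto
  qed measurable
  also have "\<dots> \<le> ?C" by (rule ln_Z_lower_tail[OF int l])
  finally have "emeasure P {\<omega>\<in>space P. ln (Z \<beta> \<omega>) \<le> ?u} \<le> ?C" .
  moreover note first_moment_le[OF f_sec f' f_version A var n \<beta> \<epsilon> \<eta> p]
  ultimately show ?thesis
    by (intro order_trans[OF gibbs_average_le[OF path f_path f' f_version A, of \<beta> ?u]] add_mono mult_left_mono) auto
qed

end

theorem theorem1p2:
  fixes M :: "nat \<Rightarrow> 'a measure" and P :: "'b measure"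
    and H f :: "nat \<Rightarrow> 'a \<Rightarrow> 'b \<Rightarrow> real"
    and p :: "nat \<Rightarrow> 'a \<Rightarrow> real \<Rightarrow> ennreal"
    and A :: "real set" and \<beta> :: real and \<beta>\<^sub>c L :: ereal
  assumes "prob_space P"
    and "\<And>N. N \<ge> 1 \<Longrightarrow> prob_space (M N)"
    and "\<And>N. N \<ge> 1 \<Longrightarrow> random_field P (M N) (H N)"
    and "\<And>N. N \<ge> 1 \<Longrightarrow> centered_gaussian_field P (space (M N)) (H N)"
    and "\<And>N. N \<ge> 1 \<Longrightarrow> field_variance P (H N) \<in> borel_measurable (M N)"
    and "\<And>N \<sigma>. N \<ge> 1 \<Longrightarrow> \<sigma> \<in> space (M N) \<Longrightarrow> field_variance P (H N) \<sigma> > 0"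
    and "(SUP (N, \<sigma>) \<in> (SIGMA N:{1..}. space (M N)).
            ereal (field_variance P (H N) \<sigma> / real N)) < \<infinity>"
    and "\<And>\<epsilon>::real. \<epsilon> > 0 \<Longrightarrow>
           limsup (\<lambda>N. ereal (1 / real N) *
             elog (emeasure (M N)
               {\<sigma> \<in> space (M N). \<bar>field_variance P (H N) \<sigma> / real N - 1\<bar> > \<epsilon>})) = -\<infinity>"
    and "is_critical_inverse_temperature P M H \<beta>\<^sub>c"
    and "0 \<le> \<beta>" and "ereal \<beta> \<le> \<beta>\<^sub>c"
    and "\<And>N. N \<ge> 1 \<Longrightarrow> random_field P (M N) (f N)"
    and "A \<in> sets borel"
    and "\<And>N \<sigma>. N \<ge> 1 \<Longrightarrow> \<sigma> \<in> space (M N) \<Longrightarrow>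
           is_conditional_probability P (f N \<sigma>) A (\<lambda>\<omega>. H N \<sigma> \<omega> / real N)
             (normal_density 0 (sqrt (field_variance P (H N) \<sigma>) / real N)) (p N \<sigma>)"
    and "\<And>N. N \<ge> 1 \<Longrightarrow>
           (\<lambda>(\<sigma>, E). p N \<sigma> E) \<in> borel_measurable (completion (M N \<Otimes>\<^sub>M lborel))"
    and "((\<lambda>\<epsilon>::real. limsup (\<lambda>N. ereal (1 / real N) *
             elog (\<integral>\<^sup>+\<sigma>. (\<integral>\<^sup>+E\<in>{\<beta> - \<epsilon>..\<beta> + \<epsilon>}. p N \<sigma> E \<partial>lborel) \<partial>M N)))
           \<longlongrightarrow> L) (at_right 0)"
    and "L < 0"
  shows "limsup (\<lambda>N. ereal (1 / real N) *
           elog (\<integral>\<^sup>+\<omega>. emeasure (gibbs_measure M H N \<beta> \<omega>) {\<sigma> \<in> space (M N). f N \<sigma> \<omega> \<in> A} \<partial>P)) < 0"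
proof -
  note P = assms(1) and prob_M = assms(2) and H_field = assms(3) and gauss = assms(4) and var_meas = assms(5)
    and sup_fin = assms(7) and var_conc = assms(8) and crit = assms(9) and \<beta> = assms(10) and \<beta>_le = assms(11)
    and f_field = assms(12) and A = assms(13) and p = assms(14) and L_lim = assms(16) and L_neg = assms(17)

  obtain C where C: "\<And>N \<sigma>. 1 \<le> N \<Longrightarrow> \<sigma> \<in> space (M N) \<Longrightarrow> field_variance P (H N) \<sigma> \<le> C * real N" and C0: "0 \<le> C"
  proof -
    define S where "S = (SUP (N, \<sigma>) \<in> (SIGMA N:{1..}. space (M N)). ereal (field_variance P (H N) \<sigma> / real N))"
    obtain c where c: "S \<le> ereal c"
      using sup_fin[folded S_def] by (cases S) auto
    have "field_variance P (H N) \<sigma> \<le> max 0 c * real N" if "1 \<le> N" "\<sigma> \<in> space (M N)" for N \<sigma>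
    proof -
      have "ereal (field_variance P (H N) \<sigma> / real N) \<le> S"
        unfolding S_def using that by (intro SUP_upper2[of "(N, \<sigma>)"]) auto
      then have "ereal (field_variance P (H N) \<sigma> / real N) \<le> ereal c" using c by (rule order_trans)
      then have "field_variance P (H N) \<sigma> / real N \<le> max 0 c" by simp
      then show ?thesis using that(1) by (simp add: divide_le_eq)
    qed
    then show ?thesis by (intro that[of "max 0 c"]) auto
  qed

  have "\<forall>N\<in>{1..}. \<exists>g. g \<in> borel_measurable (M N \<Otimes>\<^sub>M P) \<and>
    (AE w in M N \<Otimes>\<^sub>M P. (case w of (\<sigma>, \<omega>) \<Rightarrow> H N \<sigma> \<omega>) = g w)"
  proof
    fix N :: nat assume "N \<in> {1..}"
    then have "(\<lambda>(\<sigma>, \<omega>). H N \<sigma> \<omega>) \<in> borel_measurable (completion (M N \<Otimes>\<^sub>M P))"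
      using H_field by (simp add: random_field_def)
    from completion_ex_borel_measurable_real[OF this]
    show "\<exists>g. g \<in> borel_measurable (M N \<Otimes>\<^sub>M P) \<and>
      (AE w in M N \<Otimes>\<^sub>M P. (case w of (\<sigma>, \<omega>) \<Rightarrow> H N \<sigma> \<omega>) = g w)" by blast
  qed
  from bchoice[OF this] obtain g where g: "\<And>N. 1 \<le> N \<Longrightarrow> g N \<in> borel_measurable (M N \<Otimes>\<^sub>M P)"
    "\<And>N. 1 \<le> N \<Longrightarrow> AE w in M N \<Otimes>\<^sub>M P. (case w of (\<sigma>, \<omega>) \<Rightarrow> H N \<sigma> \<omega>) = g N w"
    by auto
  define H' where "H' N \<sigma> \<omega> = g N (\<sigma>, \<omega>)" for N \<sigma> \<omega>
  have model: "gaussian_model (M N) P (H N) (H' N) (C * real N)" if N: "1 \<le> N" for N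
  proof (rule gaussian_model.intro)
    show "prob_space (M N)" "prob_space P" "centered_gaussian_field P (space (M N)) (H N)"
      using N by (auto simp: P prob_M gauss)
    show "field_variance P (H N) \<sigma> \<le> C * real N" if "\<sigma> \<in> space (M N)" for \<sigma>
      using C[OF N that] .
    show "(\<lambda>(\<sigma>, \<omega>). H' N \<sigma> \<omega>) \<in> borel_measurable (M N \<Otimes>\<^sub>M P)"
      using g(1)[OF N] by (simp add: H'_def)
    show "AE w in M N \<Otimes>\<^sub>M P. H N (fst w) (snd w) = H' N (fst w) (snd w)"
      using g(2)[OF N] by (simp add: H'_def case_prod_beta')
  qed
  have path: "AE \<omega> in P. (\<lambda>\<sigma>. H N \<sigma> \<omega>) \<in> borel_measurable (M N)" if "1 \<le> N" for N
    using H_field[OF that] by (simp add: random_field_def)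
  let ?Z = "\<lambda>N. gaussian_model.Z (M N) (H' N) \<beta>"
  let ?m = "\<lambda>N. \<integral>\<omega>. ln (?Z N \<omega>) \<partial>P"

  have F_lim: "(\<lambda>N. \<integral>\<omega>. free_energy M H N \<beta> \<omega> \<partial>completion P) \<longlonglongrightarrow> \<beta>\<^sup>2 / 2"
    using crit \<beta> \<beta>_le by (auto simp: is_critical_inverse_temperature_def)
  have F_eq: "(\<integral>\<omega>. free_energy M H N \<beta> \<omega> \<partial>completion P) = ?m N / real N" if "1 \<le> N" for N
    using gaussian_model.ln_Z_completion(2)[OF model path, OF that that, of \<beta> "real N"]
    by (simp add: free_energy_def partition_function_def)
  \<comment> \<open>A function that is not integrable has integral \<open>0\<close> by convention, which is impossible for large \<open>N\<close>
    when the limit is positive.\<close>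
  have int: "\<forall>\<^sub>F N in sequentially. integrable P (\<lambda>\<omega>. ln (?Z N \<omega>))"
  proof (cases "\<beta> = 0")
    case True
    show ?thesis
      using eventually_ge_at_top[of 1]
    proof eventually_elim
      case (elim N)
      interpret prob_space "M N" by (rule prob_M[OF elim])
      have "?Z N \<omega> = 1" for \<omega>
        by (simp add: gaussian_model.Z_def[OF model[OF elim]] True prob_space)
      then show ?case by simp
    qed
  next
    case False
    then have "0 < \<beta>\<^sup>2 / 2" by simp
    from order_tendstoD(1)[OF F_lim this] eventually_ge_at_top[of 1] show ?thesis
    proof eventually_elim
      case (elim N)
      then have "?m N \<noteq> 0" by (auto simp: F_eq)
      then show ?case using not_integrable_integral_eq by blast
    qed
  qed

  obtain r where r: "L < ereal r" "r < 0"
    using ereal_dense2[OF L_neg] by (auto simp: zero_ereal_def)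
  define c where "c = - r"
  have c: "0 < c" using r by (simp add: c_def)
  have "\<forall>\<^sub>F \<epsilon> in at_right 0. limsup (\<lambda>N. ereal (1 / real N) *
             elog (\<integral>\<^sup>+\<sigma>. (\<integral>\<^sup>+E\<in>{\<beta> - \<epsilon>..\<beta> + \<epsilon>}. p N \<sigma> E \<partial>lborel) \<partial>M N)) < ereal r"
    by (rule order_tendstoD(2)[OF L_lim r(1)])
  then have "\<forall>\<^sub>F \<epsilon> in at_right 0. (0::real) < \<epsilon> \<and> limsup (\<lambda>N. ereal (1 / real N) *
             elog (\<integral>\<^sup>+\<sigma>. (\<integral>\<^sup>+E\<in>{\<beta> - \<epsilon>..\<beta> + \<epsilon>}. p N \<sigma> E \<partial>lborel) \<partial>M N)) < ereal r"
    using eventually_at_right_less[of 0] by eventually_elim simp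
  then obtain \<epsilon> where \<epsilon>: "0 < \<epsilon>" and \<epsilon>_lim: "limsup (\<lambda>N. ereal (1 / real N) *
             elog (\<integral>\<^sup>+\<sigma>. (\<integral>\<^sup>+E\<in>{\<beta> - \<epsilon>..\<beta> + \<epsilon>}. p N \<sigma> E \<partial>lborel) \<partial>M N)) < ereal r"
    using eventually_happens[of _ "at_right (0::real)"] by (auto simp: trivial_limit_at_right_real)
  let ?I = "\<lambda>N. \<integral>\<^sup>+\<sigma>. (\<integral>\<^sup>+E\<in>{\<beta> - \<epsilon>..\<beta> + \<epsilon>}. p N \<sigma> E \<partial>lborel) \<partial>M N"

  \<comment> \<open>The gain is at least \<open>4 * \<kappa>\<close> both inside the window (rate \<open>c\<close>) and outside of it (rate \<open>\<epsilon>\<^sup>2 / 2\<close>).  At most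
    \<open>2 * \<kappa>\<close> of it is spent, on the error from \<open>\<eta>\<close> and on the deviation of \<open>ln Z\<close> from its limit.  The
    parameter \<open>l\<close> makes the quadratic term of the lower tail at most half of the linear one, and \<open>R\<close> beats the moment
    on the exceptional set.\<close>
  define \<kappa> where "\<kappa> = min c (\<epsilon>\<^sup>2 / 2) / 4"
  have \<kappa>: "0 < \<kappa>" "4 * \<kappa> \<le> c" "4 * \<kappa> \<le> \<epsilon>\<^sup>2 / 2" using c \<epsilon> by (auto simp: \<kappa>_def min_def)
  define \<eta> where "\<eta> = min (1 / 2) (\<kappa> / ((\<beta> + \<epsilon>)\<^sup>2 + 1))"
  have sq_pos: "0 < (\<beta> + \<epsilon>)\<^sup>2 + 1" by (simp add: add_nonneg_pos)
  have \<eta>: "0 < \<eta>" "\<eta> \<le> 1 / 2" using \<kappa> sq_pos by (simp_all only: \<eta>_def min.cobounded1) simp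
  have \<eta>1: "\<eta> * (\<beta> + \<epsilon>)\<^sup>2 \<le> \<kappa>"
  proof -
    have "\<eta> * (\<beta> + \<epsilon>)\<^sup>2 \<le> \<kappa> / ((\<beta> + \<epsilon>)\<^sup>2 + 1) * ((\<beta> + \<epsilon>)\<^sup>2 + 1)"
      using \<kappa> sq_pos by (intro mult_mono) (simp_all add: \<eta>_def)
    then show ?thesis using sq_pos by simp
  qed
  have \<eta>2: "\<eta> * \<beta>\<^sup>2 \<le> \<kappa>"
  proof -
    have "\<beta>\<^sup>2 \<le> (\<beta> + \<epsilon>)\<^sup>2" using \<beta> \<epsilon> by (intro power_mono) auto
    then have "\<eta> * \<beta>\<^sup>2 \<le> \<eta> * (\<beta> + \<epsilon>)\<^sup>2" using \<eta> by (intro mult_left_mono) auto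
    with \<eta>1 show ?thesis by simp
  qed
  define K where "K = pi\<^sup>2 * \<beta>\<^sup>2 * C / 8"
  have K: "0 \<le> K" using C0 by (simp add: K_def)
  define l where "l = \<kappa> / (4 * (K + 1))"
  have l: "0 < l" using \<kappa> K by (simp add: l_def)
  have lK: "l * K \<le> \<kappa> / 4"
  proof -
    have "l * K \<le> l * (K + 1)" using l by (intro mult_left_mono) auto
    also have "\<dots> = \<kappa> / 4" using K by (simp add: l_def field_simps)
    finally show ?thesis .
  qed
  define R where "R = \<beta>\<^sup>2 * C / 2 + 3 * \<kappa>"
  define \<rho> where "\<rho> = min (2 * \<kappa>) (l * \<kappa> / 4)"
  have \<rho>: "0 < \<rho>" "\<rho> \<le> 2 * \<kappa>" "\<rho> \<le> l * \<kappa> / 4" using \<kappa> l by (auto simp: \<rho>_def)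

  have ev_I: "\<forall>\<^sub>F N in sequentially. ereal (1 / real N) * elog (?I N) < ereal r"
    by (rule Limsup_lessD[OF \<epsilon>_lim])
  have ev_bad: "\<forall>\<^sub>F N in sequentially. ereal (1 / real N) *
      elog (emeasure (M N) {\<sigma> \<in> space (M N). \<bar>field_variance P (H N) \<sigma> / real N - 1\<bar> > \<eta>}) < ereal (- R)"
    by (rule Limsup_lessD) (simp add: var_conc[OF \<eta>(1)])
  have ev_m: "\<forall>\<^sub>F N in sequentially. \<beta>\<^sup>2 / 2 - \<kappa> / 2 < (\<integral>\<omega>. free_energy M H N \<beta> \<omega> \<partial>completion P)"
    using \<kappa> by (intro order_tendstoD(1)[OF F_lim]) auto
  have "\<forall>\<^sub>F N in sequentially. (\<integral>\<^sup>+\<omega>. emeasure (gibbs_measure M H N \<beta> \<omega>) {\<sigma> \<in> space (M N). f N \<sigma> \<omega> \<in> A} \<partial>P)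
      \<le> ennreal (5 * real N * exp (- (\<rho> * real N)))"
    using ev_I ev_bad ev_m int eventually_ge_at_top[of 1]
  proof eventually_elim
    case (elim N)
    note N = elim(5)
    define n where "n = real N"
    have n: "1 \<le> n" using N by (simp add: n_def)
    have I: "?I N \<le> ennreal (exp (- (n * c)))"
      using elog_rate_lessD[OF elim(1) N] by (simp add: c_def n_def)
    have bad: "emeasure (M N) {\<sigma> \<in> space (M N). \<bar>field_variance P (H N) \<sigma> / n - 1\<bar> > \<eta>} \<le> ennreal (exp (- (n * R)))"
      using elog_rate_lessD[OF elim(2) N] by (simp add: n_def)
    have mean: "n * (\<beta>\<^sup>2 / 2 - \<kappa> / 2) \<le> ?m N"
      using elim(3) N unfolding F_eq[OF N] n_def by (simp add: less_divide_eq mult.commute)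
    have small: "exp (n * x) \<le> exp (- (\<rho> * n))" if "x \<le> - \<rho>" for x
      using mult_left_mono[OF that, of n] n by (simp add: mult.commute)
    let ?b1 = "n * exp (n * (\<beta>\<^sup>2 * (1 + \<eta>) / 2))" and ?b2 = "2 * exp (n * (\<beta>\<^sup>2 / 2 - \<epsilon>\<^sup>2 / 2 + \<eta> * (\<beta> + \<epsilon>)\<^sup>2 / 2))"
      and ?b3 = "exp (\<beta>\<^sup>2 * (C * n) / 2)" and ?b4 = "exp (- (l * (n * \<kappa> / 2)) + l\<^sup>2 * pi\<^sup>2 * \<beta>\<^sup>2 * (C * n) / 8)"
      and ?z = "exp (- (n * (\<beta>\<^sup>2 / 2 - \<kappa>)))"
    have "(\<integral>\<^sup>+\<omega>. emeasure (gibbs_measure M H N \<beta> \<omega>) {\<sigma> \<in> space (M N). f N \<sigma> \<omega> \<in> A} \<partial>P)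
      \<le> ennreal ?z * (ennreal ?b1 * ?I N + ennreal ?b2
          + ennreal ?b3 * emeasure (M N) {\<sigma> \<in> space (M N). \<bar>field_variance P (H N) \<sigma> / n - 1\<bar> > \<eta>}) + ennreal ?b4"
      unfolding gibbs_measure_def partition_function_def n_def
      by (rule gaussian_model.gibbs_average_total_bound[OF model[OF N] path[OF N] f_field[OF N] A var_meas[OF N]
            elim(4) mean[unfolded n_def] less_imp_le[OF l] n[unfolded n_def] \<beta> \<epsilon> less_imp_le[OF \<eta>(1)] \<eta>(2) p[OF N]])
    also have "\<dots> \<le> ennreal ?z * (ennreal ?b1 * ennreal (exp (- (n * c))) + ennreal ?b2
          + ennreal ?b3 * ennreal (exp (- (n * R)))) + ennreal ?b4"
      by (intro add_mono mult_left_mono I bad order_refl) auto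
    also have "\<dots> = ennreal (?z * (?b1 * exp (- (n * c)) + ?b2 + ?b3 * exp (- (n * R))) + ?b4)"
      using n by (simp add: ennreal_mult ennreal_plus)
    also have "\<dots> \<le> ennreal (5 * n * exp (- (\<rho> * n)))"
    proof (rule ennreal_leI)
      have 1: "?z * (?b1 * exp (- (n * c))) \<le> n * exp (- (\<rho> * n))"
      proof -
        have "?z * (?b1 * exp (- (n * c))) = n * exp (n * (\<kappa> + \<eta> * \<beta>\<^sup>2 / 2 - c))"
          by (simp add: exp_add[symmetric] algebra_simps add_divide_distrib)
        also have "\<dots> \<le> n * exp (- (\<rho> * n))" using \<kappa> \<rho> \<eta>2 n by (intro mult_left_mono small) auto
        finally show ?thesis .
      qed
      have 2: "?z * ?b2 \<le> 2 * (n * exp (- (\<rho> * n)))"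
      proof -
        have "?z * ?b2 = 2 * exp (n * (\<kappa> - \<epsilon>\<^sup>2 / 2 + \<eta> * (\<beta> + \<epsilon>)\<^sup>2 / 2))"
          by (simp add: exp_add[symmetric] algebra_simps add_divide_distrib)
        also have "\<dots> \<le> 2 * (1 * exp (- (\<rho> * n)))"           using small[of "\<kappa> - \<epsilon>\<^sup>2 / 2 + \<eta> * (\<beta> + \<epsilon>)\<^sup>2 / 2"] \<kappa> \<rho> \<eta>1 by linarith
        also have "\<dots> \<le> 2 * (n * exp (- (\<rho> * n)))" using n by (intro mult_left_mono mult_right_mono) auto
        finally show ?thesis .
      qed
      have 3: "?z * (?b3 * exp (- (n * R))) \<le> n * exp (- (\<rho> * n))"
      proof -
        have "?z * (?b3 * exp (- (n * R))) = exp (n * (\<kappa> - \<beta>\<^sup>2 / 2 + \<beta>\<^sup>2 * C / 2 - R))"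
          by (simp add: exp_add[symmetric] algebra_simps add_divide_distrib)
        also have "\<dots> \<le> 1 * exp (- (\<rho> * n))" 
          using small[of "\<kappa> - \<beta>\<^sup>2 / 2 + \<beta>\<^sup>2 * C / 2 - R"] \<kappa> \<rho> zero_le_power2[of \<beta>] unfolding R_def by linarith
        also have "\<dots> \<le> n * exp (- (\<rho> * n))" using n by (intro mult_right_mono) auto
        finally show ?thesis .
      qed
      have 4: "?b4 \<le> n * exp (- (\<rho> * n))"
      proof -
        have "?b4 = exp (n * (l * (l * K - \<kappa> / 2)))"
          by (simp add: K_def algebra_simps power2_eq_square)
        also have "\<dots> \<le> 1 * exp (- (\<rho> * n))"
        proof -
          have "l * (l * K - \<kappa> / 2) \<le> l * (- (\<kappa> / 4))" using lK l by (intro mult_left_mono) auto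
          then show ?thesis using \<rho>(3) small[of "l * (l * K - \<kappa> / 2)"] by simp
        qed
        also have "\<dots> \<le> n * exp (- (\<rho> * n))" using n by (intro mult_right_mono) auto
        finally show ?thesis .
      qed
      show "?z * (?b1 * exp (- (n * c)) + ?b2 + ?b3 * exp (- (n * R))) + ?b4 \<le> 5 * n * exp (- (\<rho> * n))"
        using 1 2 3 4 by (simp add: distrib_left)
    qed
    finally show ?case by (simp add: n_def)
  qed
  then show ?thesis by (rule limsup_elog_rate_neg[OF _ \<rho>(1)])
qed

end
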